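(* Let $f(X)\in\mathbb{Z}[X]$ be a monic irreducible polynomial of odd degree $n\geq5$, let $L_f$ be its splitting field over $\mathbb{Q}$, and suppose $G=\mathrm{Gal}(L_f/\mathbb{Q})$ is either a simple group or $G\cong S_n$. Let $\mathfrak{p}$ be a non-zero prime ideal of the ring of integers of $L_f$ not lying over $(2)\subset\mathbb{Z}$. Let $d\in L_f$ be such that (i) $d\in\mathfrak{p}$; (ii) $g(X)=f(X)+d^2\in L_f[X]$ is irreducible over $L_f$; (iii) $g(X)\equiv f(X)\pmod{\mathfrak{p}}$ has distinct roots. Let $C$ be the hyperelliptic curve $Y^2=g(X)$ over $L_f$, of genus $g_C=\frac{n-1}{2}$, with Jacobian $J$, and embed $C\hookrightarrow J$ using $\infty\in C(L_f)$. Then: (1) for any root $u$ of $f$, $C$ has the $L_f$-rational points $(u,\pm d)$; (2) for each root $u$, these points are of infinite order in $J(L_f)$; (3) $J(L_f)$ has rank at least $m(G)$ if $G$ is simple, and at least $n-1=2g_C$ if $G\cong S_n$.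
   Context: For a finite group $G$, $m(G)$ denotes the minimum of the dimensions of faithful representations of $G$ on finite-dimensional $\mathbb{Q}$-vector spaces. *)

theory Defs
  imports
    "HOL-Algebra.Algebra"
    "HOL-Algebra.Algebraic_Closure_Type"
    "HOL-Library.Product_Plus"
    "HOL-Library.Extended_Nat"
    "HOL-Library.Poly_Mapping"
    "Jordan_Normal_Form.Matrix"
begin

section \<open>Field theory\<close>

text \<open>
  Fields are represented by types: an element of a field extension of the rationals is an element
  of a type \<open>'k\<close> of class \<open>field_char_0\<close>, and \<open>ring_of_type_algebra\<close> is that field as a ring record.
\<close>

definition is_splitting_field :: "'k::field_char_0 poly \<Rightarrow> bool" where
  "is_splitting_field F \<longleftrightarrow>
     (\<exists>us. F = Polynomial.smult (Polynomial.lead_coeff F) (\<Prod>u\<leftarrow>us. [:- u, 1:])) \<and>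
     generate_field (ring_of_type_algebra :: 'k ring) (\<rat> \<union> {u. poly F u = 0}) = UNIV"

definition field_auts :: "'k::field set \<Rightarrow> ('k \<Rightarrow> 'k) set" where
  "field_auts S = {\<sigma> \<in> ring_iso ring_of_type_algebra ring_of_type_algebra. \<forall>c\<in>S. \<sigma> c = c}"

definition galois_group_over_rat :: "('k::field_char_0 \<Rightarrow> 'k) monoid" where
  "galois_group_over_rat = \<lparr>carrier = field_auts \<rat>, monoid.mult = (\<circ>), one = id\<rparr>"

definition ring_of_integers :: "'k::field_char_0 ring" where
  "ring_of_integers = ring_of_type_algebra\<lparr>carrier := {x. algebraic_int x}\<rparr>"

text \<open>
  For a prime ideal \<open>\<pp>\<close> and a polynomial with coefficients in the ring of integers: the image of the
  polynomial over an algebraic closure of the residue field, as a coefficient list with the leading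
  coefficient first (the convention of HOL-Algebra). If the polynomial is monic, its image is
  again a polynomial of the same degree.
\<close>

definition residue_closure ::
    "'k::field_char_0 set \<Rightarrow> (('k set list \<times> nat) multiset \<Rightarrow> 'k set) ring" where
  "residue_closure \<pp> = field.alg_closure (ring_of_integers Quot \<pp>)"

definition reduce_poly ::
    "'k::field_char_0 set \<Rightarrow> 'k poly \<Rightarrow> (('k set list \<times> nat) multiset \<Rightarrow> 'k set) list" where
  "reduce_poly \<pp> q =
     map (\<lambda>c. ring.indexed_const (ring_of_integers Quot \<pp>) (\<pp> +>\<^bsub>ring_of_integers\<^esub> c))
       (rev (coeffs q))"

definition distinct_roots_mod :: "'k::field_char_0 set \<Rightarrow> 'k poly \<Rightarrow> bool" where
  "distinct_roots_mod \<pp> q \<longleftrightarrow>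
     card {x. ring.is_root (residue_closure \<pp>) (reduce_poly \<pp> q) x}
       = Polynomials.degree (reduce_poly \<pp> q)"


section \<open>Group theory\<close>

text \<open>A representation on a \<open>k\<close>-dimensional rational vector space is, after choosing a basis,
  a homomorphism into the group of invertible rational matrices of size \<open>k\<close>.\<close>

definition GL_rat :: "nat \<Rightarrow> rat mat monoid" where
  "GL_rat k = units_of (ring_mat TYPE(rat) k ())"

definition min_faithful_dim :: "('a, 'm) monoid_scheme \<Rightarrow> nat" where
  "min_faithful_dim G = (LEAST k. \<exists>\<rho> \<in> hom G (GL_rat k). inj_on \<rho> (carrier G))"

definition int_independent :: "('a, 'm) monoid_scheme \<Rightarrow> 'a set \<Rightarrow> bool" where
  "int_independent G S \<longleftrightarrow> finite S \<and> S \<subseteq> carrier G \<and>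
     (\<forall>a :: 'a \<Rightarrow> int. finprod G (\<lambda>s. s [^]\<^bsub>G\<^esub> a s) S = \<one>\<^bsub>G\<^esub> \<longrightarrow> (\<forall>s\<in>S. a s = 0))"

definition abelian_rank :: "('a, 'm) monoid_scheme \<Rightarrow> enat" where
  "abelian_rank G = Sup {enat (card S) | S. int_independent G S}"


section \<open>The curve \<open>Y\<^sup>2 = g(X)\<close>\<close>

text \<open>
  Throughout, \<open>g\<close> is meant to be squarefree of odd degree, so that the smooth projective model of
  the affine curve has exactly one point at infinity, which is rational.
\<close>

datatype 'a curve_point = Infty | Aff 'a 'a

definition curve_points :: "'a::field poly \<Rightarrow> 'a curve_point set" where
  "curve_points g = insert Infty {Aff x y | x y. y ^ 2 = poly g x}"

text \<open>
  The function field is the quotient of \<open>K(X)[Y]\<close> by \<open>Y\<^sup>2 - g(X)\<close>; the pair \<open>(a, b)\<close> stands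
  for \<open>a + b Y\<close>.
\<close>

type_synonym 'a curve_fun = "'a poly fract \<times> 'a poly fract"

definition function_field :: "'a::field poly \<Rightarrow> 'a curve_fun ring" where
  "function_field g =
     \<lparr>carrier = UNIV,
      monoid.mult = (\<lambda>(a, b) (c, e). (a * c + b * e * Fraction_Field.Fract g 1, a * e + b * c)),
      one = (1, 0), ring.zero = 0, add = (+)\<rparr>"

definition const_fun :: "'a::field \<Rightarrow> 'a curve_fun" where
  "const_fun c = (Fraction_Field.Fract [:c:] 1, 0)"

definition X_fun :: "'a::field curve_fun" where
  "X_fun = (Fraction_Field.Fract [:0, 1:] 1, 0)"

definition Y_fun :: "'a::field curve_fun" where
  "Y_fun = (0, 1)"

text \<open>Normalised discrete valuations of the function field, trivial on the constants.
  The value at zero, which should be infinite, is fixed to be \<open>0\<close> by convention.\<close>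

definition discrete_valuation :: "'a::field poly \<Rightarrow> ('a curve_fun \<Rightarrow> int) \<Rightarrow> bool" where
  "discrete_valuation g v \<longleftrightarrow>
     v 0 = 0 \<and> surj v \<and> (\<forall>c. c \<noteq> 0 \<longrightarrow> v (const_fun c) = 0) \<and>
     (\<forall>F H. F \<noteq> 0 \<longrightarrow> H \<noteq> 0 \<longrightarrow> v (F \<otimes>\<^bsub>function_field g\<^esub> H) = v F + v H) \<and>
     (\<forall>F H. F \<noteq> 0 \<longrightarrow> H \<noteq> 0 \<longrightarrow> F + H \<noteq> 0 \<longrightarrow> min (v F) (v H) \<le> v (F + H))"

fun centred_at :: "('a::field curve_fun \<Rightarrow> int) \<Rightarrow> 'a curve_point \<Rightarrow> bool" where
  "centred_at v Infty \<longleftrightarrow> v X_fun < 0"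
| "centred_at v (Aff x y) \<longleftrightarrow> v (X_fun - const_fun x) > 0 \<and> v (Y_fun - const_fun y) > 0"

text \<open>The order of vanishing at a point \<open>P\<close> of the curve: the valuation whose valuation ring is
  the local ring of the smooth model at \<open>P\<close>.\<close>

definition ord_at :: "'a::field poly \<Rightarrow> 'a curve_point \<Rightarrow> 'a curve_fun \<Rightarrow> int" where
  "ord_at g P = (THE v. discrete_valuation g v \<and> centred_at v P)"


section \<open>Divisors, genus and Jacobian\<close>

text \<open>Divisors are only considered over an algebraically closed field, where closed points are points
  with coordinates in the field.\<close>

definition divisors :: "'a::alg_closed_field poly \<Rightarrow> ('a curve_point \<Rightarrow>\<^sub>0 int) monoid" where
  "divisors g = free_Abelian_group (curve_points g)"

definition div_degree :: "('a curve_point \<Rightarrow>\<^sub>0 int) \<Rightarrow> int" where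
  "div_degree D = (\<Sum>P \<in> Poly_Mapping.keys D. Poly_Mapping.lookup D P)"

definition divisors0 :: "'a::alg_closed_field poly \<Rightarrow> ('a curve_point \<Rightarrow>\<^sub>0 int) monoid" where
  "divisors0 g = (divisors g)\<lparr>carrier := {D \<in> carrier (divisors g). div_degree D = 0}\<rparr>"

definition principal_divisors :: "'a::alg_closed_field poly \<Rightarrow> ('a curve_point \<Rightarrow>\<^sub>0 int) set" where
  "principal_divisors g =
     {D \<in> carrier (divisors g).
        \<exists>F. F \<noteq> 0 \<and> (\<forall>P \<in> curve_points g. Poly_Mapping.lookup D P = ord_at g P F)}"

definition pic0 :: "'a::alg_closed_field poly \<Rightarrow> ('a curve_point \<Rightarrow>\<^sub>0 int) set monoid" where
  "pic0 g = divisors0 g Mod principal_divisors g"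

definition riemann_roch_space ::
    "'a::alg_closed_field poly \<Rightarrow> ('a curve_point \<Rightarrow>\<^sub>0 int) \<Rightarrow> 'a curve_fun set" where
  "riemann_roch_space g D =
     {F. F = 0 \<or> (\<forall>P \<in> curve_points g. ord_at g P F \<ge> - Poly_Mapping.lookup D P)}"

definition scale_fun :: "'a::field \<Rightarrow> 'a curve_fun \<Rightarrow> 'a curve_fun" where
  "scale_fun c = (\<lambda>(a, b). (Fraction_Field.Fract [:c:] 1 * a, Fraction_Field.Fract [:c:] 1 * b))"

text \<open>Riemann's definition of the genus: the maximum of \<open>deg D - l(D) + 1\<close> over all divisors.\<close>

definition genus :: "'a::alg_closed_field poly \<Rightarrow> int" where
  "genus g = (SUP D \<in> carrier (divisors g).
     div_degree D - int (vector_space.dim scale_fun (riemann_roch_space g D)) + 1)"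

definition base_change :: "'k::field poly \<Rightarrow> 'k alg_closure poly" where
  "base_change g = map_poly to_ac g"

definition act_on_divisor :: "('a \<Rightarrow> 'a) \<Rightarrow> ('a curve_point \<Rightarrow>\<^sub>0 int) \<Rightarrow> ('a curve_point \<Rightarrow>\<^sub>0 int)" where
  "act_on_divisor \<sigma> = frag_extend (\<lambda>P. frag_of (map_curve_point \<sigma> P))"

text \<open>
  The group \<open>J(K)\<close> of \<open>K\<close>-rational points of the Jacobian of the curve, for \<open>K\<close> of characteristic
  zero: the points of \<open>J\<close> over an algebraic closure are the classes of divisors of degree zero, and
  the rational ones are those fixed by the absolute Galois group. The elements of \<open>pic0\<close> are cosets,
  on which an automorphism acts by taking images.
\<close>

definition jacobian_points ::
    "'k::field_char_0 poly \<Rightarrow> ('k alg_closure curve_point \<Rightarrow>\<^sub>0 int) set monoid" where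
  "jacobian_points g =
     (pic0 (base_change g))\<lparr>carrier :=
        {c \<in> carrier (pic0 (base_change g)).
           \<forall>\<sigma> \<in> field_auts (range to_ac). act_on_divisor \<sigma> ` c = c}\<rparr>"

text \<open>The embedding of the curve into its Jacobian which sends \<open>P\<close> to the class of \<open>P - \<infinity>\<close>.\<close>

definition curve_to_jacobian ::
    "'k::field_char_0 poly \<Rightarrow> 'k curve_point \<Rightarrow> ('k alg_closure curve_point \<Rightarrow>\<^sub>0 int) set" where
  "curve_to_jacobian g P =
     principal_divisors (base_change g) #>\<^bsub>divisors0 (base_change g)\<^esub>
       (frag_of (map_curve_point to_ac P) - frag_of Infty)"

definition has_infinite_order :: "('a, 'm) monoid_scheme \<Rightarrow> 'a \<Rightarrow> bool" where
  "has_infinite_order G x \<longleftrightarrow> x \<in> carrier G \<and> (\<forall>k::nat. k > 0 \<longrightarrow> x [^]\<^bsub>G\<^esub> k \<noteq> \<one>\<^bsub>G\<^esub>)"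

end

theory Submission
  imports Defs
begin

text \<open>
  Modulo \<open>\<pp>\<close> the curve becomes \<open>Y\<^sup>2 = f(X)\<close>, and the points \<open>(u, d)\<close> become the points of order two
  \<open>(u, 0)\<close>, whose only relation is that all of them sum to zero. So in a relation among the classes of
  \<open>(u, d) - \<infinity>\<close> with at least one coefficient zero all coefficients are even; since \<open>g\<close> is
  irreducible, such a relation can be divided by two, and infinite descent shows that it is trivial.
  In terms of polynomials, a relation is an equation \<open>A\<^sup>2 - g B\<^sup>2 = l \<Prod> (X - u)\<^bsup>c u\<^esup>\<close>. It can be taken over
  the base field, it is reduced modulo the maximal ideal of a valuation ring dominating \<open>\<pp>\<close>, and it is
  halved by factoring \<open>(A - H) (A + H) = g B\<^sup>2\<close> in the polynomial ring, where \<open>H\<^sup>2\<close> is the product.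
  Hence any \<open>n - 1\<close> of the \<open>n\<close> classes are independent. The Galois group acts faithfully
  on the roots, hence on the hyperplane of sum zero, so that also \<open>m(G) \<le> n - 1\<close>.
\<close>

section \<open>Valuation rings dominating a given ring\<close>

text \<open>The full sum of the classes is a genuine relation: at the roots u of f the value of g is
  d^2, so the function Y - d has the divisor of all (u, d) - \<infinity>, added up. Parity modulo
  \<open>\<pp>\<close> can therefore only give "all even or all odd"; a coefficient that is zero
  excludes the odd case, and it stays zero when a relation is halved. Halving rests on g dividing
  one of A - H and A + H. What is left of the two factors is coprime, hence square up to constants,
  and the two square roots form a pair whose norm is a multiple of H instead of H^2. The equation
  has to be primitive before it is reduced, that is, scaled by a coefficient of least value. In a
  valuation ring such a coefficient exists because any two elements are comparable, whence the
  choice of Chevalley's extension theorem. Orders of functions are given by a definite description.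
  Before any divisor can be computed, the valuation at each point has to be shown unique, by
  formulas for the values of A + B Y, and to exist, by Laurent expansions.\<close>

definition coeffs_in :: "'a::zero set \<Rightarrow> 'a poly \<Rightarrow> bool" where
  "coeffs_in S p \<longleftrightarrow> (\<forall>i. coeff p i \<in> S)"

lemma coeffs_inD: "coeffs_in S p \<Longrightarrow> coeff p i \<in> S"
  by (simp add: coeffs_in_def)

text \<open>Subring and ideal are plain subsets of a type instead of ring records. Polynomials stay
  in the type \<open>'a poly\<close>, and working over the subring or modulo the ideal only means to
  track, by \<open>coeffs_in\<close>, where the coefficients lie.\<close>

locale subring_ideal =
  fixes V m :: "'a::comm_ring_1 set"
  assumes one_in: "1 \<in> V"
    and diff_in: "x \<in> V \<Longrightarrow> y \<in> V \<Longrightarrow> x - y \<in> V"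
    and mult_in: "x \<in> V \<Longrightarrow> y \<in> V \<Longrightarrow> x * y \<in> V"
    and ideal_subset: "m \<subseteq> V"
    and ideal_zero: "0 \<in> m"
    and ideal_add: "x \<in> m \<Longrightarrow> y \<in> m \<Longrightarrow> x + y \<in> m"
    and ideal_mult: "x \<in> V \<Longrightarrow> y \<in> m \<Longrightarrow> x * y \<in> m"
    and ideal_proper: "1 \<notin> m"
begin

lemma zero_in: "0 \<in> V"
  using diff_in[OF one_in one_in] by simp

lemma uminus_in: "x \<in> V \<Longrightarrow> - x \<in> V"
  using diff_in[OF zero_in] by simp

lemma add_in: "x \<in> V \<Longrightarrow> y \<in> V \<Longrightarrow> x + y \<in> V"
  using diff_in[OF _ uminus_in, of x y] by simp

lemma ideal_uminus: "x \<in> m \<Longrightarrow> - x \<in> m"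
  using ideal_mult[OF uminus_in[OF one_in], of x] by simp

lemma ideal_diff: "x \<in> m \<Longrightarrow> y \<in> m \<Longrightarrow> x - y \<in> m"
  using ideal_add[OF _ ideal_uminus, of x y] by simp

lemma ideal_mult_right: "x \<in> m \<Longrightarrow> y \<in> V \<Longrightarrow> x * y \<in> m"
  using ideal_mult[of y x] by (simp add: mult.commute)

lemma ideal_in: "x \<in> m \<Longrightarrow> x \<in> V"
  using ideal_subset by blast

lemma power_in: "x \<in> V \<Longrightarrow> x ^ k \<in> V"
  by (induction k) (auto intro: one_in mult_in)

lemma sum_in: "(\<And>i. i \<in> A \<Longrightarrow> f i \<in> V) \<Longrightarrow> sum f A \<in> V"
  by (induction A rule: infinite_finite_induct) (auto intro: zero_in add_in)

lemma ideal_sum: "(\<And>i. i \<in> A \<Longrightarrow> f i \<in> m) \<Longrightarrow> sum f A \<in> m"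
  by (induction A rule: infinite_finite_induct) (auto intro: ideal_zero ideal_add)

lemma coeffs_in_0: "coeffs_in V 0" and coeffs_in_ideal_0: "coeffs_in m 0"
  by (auto simp: coeffs_in_def zero_in ideal_zero)

lemma coeffs_in_const: "c \<in> V \<Longrightarrow> coeffs_in V [:c:]"
  by (auto simp: coeffs_in_def zero_in coeff_pCons split: nat.split)

lemma coeffs_in_ideal_const: "c \<in> m \<Longrightarrow> coeffs_in m [:c:]"
  by (auto simp: coeffs_in_def ideal_zero coeff_pCons split: nat.split)

lemma coeffs_in_pCons: "coeffs_in V (pCons c p) \<longleftrightarrow> c \<in> V \<and> coeffs_in V p"
  unfolding coeffs_in_def by (metis coeff_pCons_0 coeff_pCons_Suc not0_implies_Suc)

lemma coeffs_in_1: "coeffs_in V 1"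
  unfolding one_pCons by (rule coeffs_in_const[OF one_in])

lemma coeffs_in_diff: "coeffs_in V p \<Longrightarrow> coeffs_in V q \<Longrightarrow> coeffs_in V (p - q)"
  by (auto simp: coeffs_in_def diff_in)

lemma coeffs_in_add: "coeffs_in V p \<Longrightarrow> coeffs_in V q \<Longrightarrow> coeffs_in V (p + q)"
  by (auto simp: coeffs_in_def add_in)

lemma coeffs_in_mult: "coeffs_in V p \<Longrightarrow> coeffs_in V q \<Longrightarrow> coeffs_in V (p * q)"
  by (auto simp: coeffs_in_def coeff_mult intro!: sum_in mult_in)

lemma coeffs_in_smult: "c \<in> V \<Longrightarrow> coeffs_in V p \<Longrightarrow> coeffs_in V (smult c p)"
  by (auto simp: coeffs_in_def mult_in)

lemma coeffs_in_power: "coeffs_in V p \<Longrightarrow> coeffs_in V (p ^ k)"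
  by (induction k) (auto intro: coeffs_in_mult coeffs_in_1)

lemma coeffs_in_prod: "(\<And>i. i \<in> A \<Longrightarrow> coeffs_in V (f i)) \<Longrightarrow> coeffs_in V (prod f A)"
  by (induction A rule: infinite_finite_induct) (auto intro: coeffs_in_mult coeffs_in_1)

lemma coeffs_in_ideal_add: "coeffs_in m p \<Longrightarrow> coeffs_in m q \<Longrightarrow> coeffs_in m (p + q)"
  by (auto simp: coeffs_in_def ideal_add)

lemma coeffs_in_ideal_diff: "coeffs_in m p \<Longrightarrow> coeffs_in m q \<Longrightarrow> coeffs_in m (p - q)"
  by (auto simp: coeffs_in_def ideal_diff)

lemma coeffs_in_ideal_mult: "coeffs_in V p \<Longrightarrow> coeffs_in m q \<Longrightarrow> coeffs_in m (p * q)"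
  by (auto simp: coeffs_in_def coeff_mult intro!: ideal_sum ideal_mult)

lemma coeffs_in_ideal_mult_right: "coeffs_in m p \<Longrightarrow> coeffs_in V q \<Longrightarrow> coeffs_in m (p * q)"
  using coeffs_in_ideal_mult[of q p] by (simp add: mult.commute)

lemma coeffs_in_ideal_smult: "c \<in> m \<Longrightarrow> coeffs_in V p \<Longrightarrow> coeffs_in m (smult c p)"
  by (auto simp: coeffs_in_def ideal_mult_right)

lemma coeffs_in_ideal_in: "coeffs_in m p \<Longrightarrow> coeffs_in V p"
  by (auto simp: coeffs_in_def ideal_in)

lemma poly_in: "coeffs_in V p \<Longrightarrow> x \<in> V \<Longrightarrow> poly p x \<in> V"
  unfolding poly_altdef by (intro sum_in mult_in power_in) (auto simp: coeffs_in_def)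

lemma poly_in_ideal: "coeffs_in m p \<Longrightarrow> x \<in> V \<Longrightarrow> poly p x \<in> m"
  unfolding poly_altdef by (intro ideal_sum ideal_mult_right power_in) (auto simp: coeffs_in_def)

text \<open>These are V[x] and the ideal that m generates in it. The ring and ideal laws carry over
  from polynomials by evaluation; only properness can fail, and the assumption is exactly that it
  does not.\<close>

lemma subring_ideal_adjoin:
  assumes "\<And>q. coeffs_in m q \<Longrightarrow> poly q x \<noteq> 1"
  shows "subring_ideal {poly q x | q. coeffs_in V q} {poly q x | q. coeffs_in m q}"
proof
  show "1 \<in> {poly q x | q. coeffs_in V q}"
    using coeffs_in_1 by force
  show "0 \<in> {poly q x | q. coeffs_in m q}"
    using coeffs_in_ideal_0 by force
  show "1 \<notin> {poly q x | q. coeffs_in m q}"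
    using assms by force
  show "{poly q x | q. coeffs_in m q} \<subseteq> {poly q x | q. coeffs_in V q}"
    using coeffs_in_ideal_in by blast
  show "a - b \<in> {poly q x | q. coeffs_in V q}"
    if "a \<in> {poly q x | q. coeffs_in V q}" "b \<in> {poly q x | q. coeffs_in V q}" for a b
    using that coeffs_in_diff by (smt (verit) mem_Collect_eq poly_diff)
  show "a * b \<in> {poly q x | q. coeffs_in V q}"
    if "a \<in> {poly q x | q. coeffs_in V q}" "b \<in> {poly q x | q. coeffs_in V q}" for a b
    using that coeffs_in_mult by (smt (verit) mem_Collect_eq poly_mult)
  show "a + b \<in> {poly q x | q. coeffs_in m q}"
    if "a \<in> {poly q x | q. coeffs_in m q}" "b \<in> {poly q x | q. coeffs_in m q}" for a b
    using that coeffs_in_ideal_add by (smt (verit) mem_Collect_eq poly_add)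
  show "a * b \<in> {poly q x | q. coeffs_in m q}"
    if "a \<in> {poly q x | q. coeffs_in V q}" "b \<in> {poly q x | q. coeffs_in m q}" for a b
    using that coeffs_in_ideal_mult by (smt (verit) mem_Collect_eq poly_mult)
qed

lemma subring_ideal_enlarge:
  assumes "y \<in> V" "\<And>a r. a \<in> m \<Longrightarrow> r \<in> V \<Longrightarrow> a + r * y \<noteq> 1"
  shows "subring_ideal V {a + r * y | a r. a \<in> m \<and> r \<in> V}"
proof
  show "{a + r * y | a r. a \<in> m \<and> r \<in> V} \<subseteq> V"
    using assms(1) ideal_in add_in mult_in by blast
  show "0 \<in> {a + r * y | a r. a \<in> m \<and> r \<in> V}"
    using ideal_zero zero_in by force
  show "1 \<notin> {a + r * y | a r. a \<in> m \<and> r \<in> V}"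
    using assms(2) by force
  show "u + v \<in> {a + r * y | a r. a \<in> m \<and> r \<in> V}"
    if "u \<in> {a + r * y | a r. a \<in> m \<and> r \<in> V}" "v \<in> {a + r * y | a r. a \<in> m \<and> r \<in> V}" for u v
  proof -
    from that obtain a r b s where *: "u = a + r * y" "v = b + s * y"
      and "a \<in> m" "b \<in> m" "r \<in> V" "s \<in> V" by blast
    then have "a + b \<in> m" "r + s \<in> V" by (auto intro: ideal_add add_in)
    moreover have "u + v = (a + b) + (r + s) * y" by (simp add: * algebra_simps)
    ultimately show ?thesis by blast
  qed
  show "u * v \<in> {a + r * y | a r. a \<in> m \<and> r \<in> V}"
    if "u \<in> V" "v \<in> {a + r * y | a r. a \<in> m \<and> r \<in> V}" for u v
  proof -
    from that obtain a r where *: "v = a + r * y" and "a \<in> m" "r \<in> V" by blast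
    then have "u * a \<in> m" "u * r \<in> V" using that(1) by (auto intro: ideal_mult mult_in)
    moreover have "u * v = u * a + (u * r) * y" by (simp add: * algebra_simps)
    ultimately show ?thesis by blast
  qed
qed (auto intro: one_in diff_in mult_in)

end

text \<open>The upper bound for Zorn's lemma. Each law involves at most two elements, and two
  elements of the union of a chain lie in a common member.\<close>

lemma subring_ideal_Union:
  assumes "C \<noteq> {}" "subset.chain A C" "\<And>S. S \<in> A \<Longrightarrow> subring_ideal (Inl -` S) (Inr -` S)"
  shows "subring_ideal (Inl -` \<Union>C) (Inr -` \<Union>C)"
proof -
  have sub: "subring_ideal (Inl -` S) (Inr -` S)" if "S \<in> C" for S
    using assms(2,3) that unfolding subset.chain_def by blast
  have common: "\<exists>S\<in>C. x \<in> S \<and> y \<in> S" if "x \<in> \<Union>C" "y \<in> \<Union>C" for x y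
  proof -
    from that obtain S T where "S \<in> C" "x \<in> S" "T \<in> C" "y \<in> T" by blast
    moreover have "S \<subseteq> T \<or> T \<subseteq> S"
      using subset_chain_def assms(2) calculation(1,3) by (metis (no_types, lifting))
    ultimately show ?thesis by blast
  qed
  show ?thesis
  proof
    show "1 \<in> Inl -` \<Union>C" "0 \<in> Inr -` \<Union>C"
      using assms(1) subring_ideal.one_in[OF sub] subring_ideal.ideal_zero[OF sub] by fastforce+
    show "1 \<notin> Inr -` \<Union>C"
      using subring_ideal.ideal_proper[OF sub] by auto
    show "Inr -` \<Union>C \<subseteq> Inl -` \<Union>C"
      using subring_ideal.ideal_subset[OF sub] by fastforce
    fix x y
    show "x - y \<in> Inl -` \<Union>C" if "x \<in> Inl -` \<Union>C" "y \<in> Inl -` \<Union>C"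
      using common[of "Inl x" "Inl y"] subring_ideal.diff_in[OF sub, of _ x y] that by auto
    show "x * y \<in> Inl -` \<Union>C" if "x \<in> Inl -` \<Union>C" "y \<in> Inl -` \<Union>C"
      using common[of "Inl x" "Inl y"] subring_ideal.mult_in[OF sub, of _ x y] that by auto
    show "x + y \<in> Inr -` \<Union>C" if "x \<in> Inr -` \<Union>C" "y \<in> Inr -` \<Union>C"
      using common[of "Inr x" "Inr y"] subring_ideal.ideal_add[OF sub, of _ x y] that by auto
    show "x * y \<in> Inr -` \<Union>C" if "x \<in> Inl -` \<Union>C" "y \<in> Inr -` \<Union>C"
      using common[of "Inl x" "Inr y"] subring_ideal.ideal_mult[OF sub, of _ x y] that by auto
  qed
qed

text \<open>The last axiom says that everything outside m is a unit, so that m, being proper, is the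
  maximal ideal of V and V / m is the residue field.\<close>

locale valuation_subring = subring_ideal V m for V m :: "'a::field set" +
  assumes valuation: "x \<in> V \<or> inverse x \<in> V"
    and unit_inverse_in: "x \<in> V \<Longrightarrow> x \<notin> m \<Longrightarrow> inverse x \<in> V"

text \<open>A pair \<open>(V, m)\<close> is encoded as a subset of the sum type, which turns the order by domination
  into set inclusion as Zorn's lemma requires.\<close>

theorem exists_dominating_valuation_subring:
  fixes R P :: "'a::field set"
  assumes "subring_ideal R P"
  obtains V m where "valuation_subring V m" "R \<subseteq> V" "P \<subseteq> m"
proof -
  define A where "A = {S :: ('a + 'a) set. subring_ideal (Inl -` S) (Inr -` S) \<and> R \<subseteq> Inl -` S \<and> P \<subseteq> Inr -` S}"
  have "Inl ` R \<union> Inr ` P \<in> A"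
  proof -
    have "Inl -` (Inl ` R \<union> Inr ` P) = R" "Inr -` (Inl ` R \<union> Inr ` P) = P"
      by auto
    then show ?thesis using assms by (simp add: A_def)
  qed
  then have "A \<noteq> {}" by blast
  moreover have "\<Union>C \<in> A" if "C \<noteq> {}" "subset.chain A C" for C
  proof -
    have "subring_ideal (Inl -` \<Union>C) (Inr -` \<Union>C)"
      by (rule subring_ideal_Union[OF that]) (simp add: A_def)
    moreover have "C \<subseteq> A" using that(2) unfolding subset.chain_def by blast
    with that(1) have "R \<subseteq> Inl -` \<Union>C" "P \<subseteq> Inr -` \<Union>C"
      unfolding A_def by blast+
    ultimately show ?thesis by (simp add: A_def)
  qed
  ultimately obtain M where M: "M \<in> A" "\<And>S. S \<in> A \<Longrightarrow> M \<subseteq> S \<Longrightarrow> S = M"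
    using subset_Zorn_nonempty[of A] by blast
  define V m where "V = Inl -` M" and "m = Inr -` M"
  interpret subring_ideal V m using M(1) by (simp add: A_def V_def m_def)
  have RV: "R \<subseteq> V" "P \<subseteq> m" using M(1) by (auto simp: A_def V_def m_def)
  have maximal: "W = V \<and> n = m" if "subring_ideal W n" "V \<subseteq> W" "m \<subseteq> n" for W n
  proof -
    have inv_simps: "Inl -` (Inl ` W \<union> Inr ` n) = W" "Inr -` (Inl ` W \<union> Inr ` n) = n"
      by auto
    have "Inl ` W \<union> Inr ` n \<in> A"
      unfolding A_def mem_Collect_eq inv_simps using that RV by blast
    moreover have "M \<subseteq> Inl ` W \<union> Inr ` n"
    proof
      fix z assume "z \<in> M"
      then show "z \<in> Inl ` W \<union> Inr ` n"
        using that(2,3) by (cases z) (auto simp: V_def m_def)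
    qed
    ultimately have "Inl ` W \<union> Inr ` n = M" by (rule M(2))
    then show ?thesis using inv_simps by (simp add: V_def m_def)
  qed
  \<comment> \<open>Maximality applied to V[x]: either the extended ideal is proper and V[x] = V, or
    1 is a polynomial in x with coefficients in m.\<close>
  have adjoin: "x \<in> V \<or> (\<exists>q. coeffs_in m q \<and> poly q x = 1)" for x
  proof (rule disjCI)
    assume "\<not> (\<exists>q. coeffs_in m q \<and> poly q x = 1)"
    then have pr: "subring_ideal {poly q x | q. coeffs_in V q} {poly q x | q. coeffs_in m q}"
      by (intro subring_ideal_adjoin) blast
    have "V \<subseteq> {poly q x | q. coeffs_in V q}" "m \<subseteq> {poly q x | q. coeffs_in m q}"
      using coeffs_in_const coeffs_in_ideal_const by force+
    then have "{poly q x | q. coeffs_in V q} = V"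
      using maximal[OF pr] by simp
    moreover have "poly [:0, 1:] x = x" "coeffs_in V [:0, 1:]"
      by (simp_all add: coeffs_in_pCons zero_in one_in coeffs_in_0)
    ultimately show "x \<in> V" by (metis (mono_tags, lifting) mem_Collect_eq)
  qed
  have enlarge: "\<exists>a\<in>m. \<exists>r\<in>V. a + r * y = 1" if "y \<in> V" "y \<notin> m" for y
  proof (rule ccontr)
    assume "\<not> ?thesis"
    then have pr: "subring_ideal V {a + r * y | a r. a \<in> m \<and> r \<in> V}"
      by (intro subring_ideal_enlarge that) blast
    have "m \<subseteq> {a + r * y | a r. a \<in> m \<and> r \<in> V}"
      using zero_in by force
    then have "{a + r * y | a r. a \<in> m \<and> r \<in> V} = m"
      using maximal[OF pr] by simp
    moreover have "y = 0 + 1 * y" by simp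
    ultimately show False using that(2) ideal_zero one_in by blast
  qed
  \<comment> \<open>Primality of m is not yet available. Multiplying a + r y = 1 by y^k shows that
    y^(k+1) in m would put y^k into m, and so on down to 1.\<close>
  have power_notin: "y ^ k \<notin> m" if y: "y \<in> V" "y \<notin> m" for y and k :: nat
  proof (induction k)
    case (Suc k)
    obtain a r where ar: "a \<in> m" "r \<in> V" "a + r * y = 1" using enlarge[OF y] by blast
    have "y ^ k = y ^ k * (a + r * y)" using ar(3) by simp
    then have eq: "y ^ k = y ^ k * a + r * y ^ Suc k" by (simp add: algebra_simps)
    have "y ^ k \<in> m" if "y ^ Suc k \<in> m"
      by (subst eq) (intro ideal_add ideal_mult power_in ar y that)
    then show ?case using Suc by blast
  qed (simp add: ideal_proper)
  have clear: "x ^ degree q * poly q (inverse x) \<in> m" if "x \<in> V" "x \<noteq> 0" "coeffs_in m q" for x q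
  proof -
    have "x ^ degree q * poly q (inverse x) = (\<Sum>i\<le>degree q. coeff q i * x ^ (degree q - i))"
      unfolding poly_altdef sum_distrib_left
      by (rule sum.cong) (auto simp: that(2) power_diff field_simps)
    also have "\<dots> \<in> m"
      using that by (intro ideal_sum ideal_mult_right power_in) (auto dest: coeffs_inD)
    finally show ?thesis .
  qed
  \<comment> \<open>If 1/x were outside V, it would satisfy a relation q(1/x) = 1 over m; clearing
    denominators puts a power of x into m.\<close>
  have unit: "inverse x \<in> V" if "x \<in> V" "x \<notin> m" for x
  proof (rule ccontr)
    assume "inverse x \<notin> V"
    then obtain q where q: "coeffs_in m q" "poly q (inverse x) = 1" using adjoin by blast
    have "x \<noteq> 0" using that ideal_zero by auto
    then have "x ^ degree q \<in> m" using clear[OF that(1) _ q(1)] q(2) by simp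
    then show False using power_notin that by blast
  qed
  \<comment> \<open>The classical exchange: r has its constant coefficient in m, so that 1 minus
    this coefficient is a unit and x^k becomes a combination of lower powers with coefficients in m.
    Substituted into the top term of q, this gives the relation \<open>q'\<close> of smaller degree,
    against the minimality of q.\<close>
  have no_reduction: False
    if x: "x \<noteq> 0" and q: "coeffs_in m q" "poly q x = 1"
      and min: "\<And>q'. coeffs_in m q' \<Longrightarrow> poly q' x = 1 \<Longrightarrow> degree q \<le> degree q'"
      and r: "coeffs_in m r" "poly r (inverse x) = 1" and deg: "degree r \<le> degree q"
    for x q r
  proof -
    define k where "k = degree r"
    define n where "n = degree q"
    have n0: "n > 0"
    proof (rule ccontr)
      assume "\<not> n > 0"
      then obtain c where "q = [:c:]" unfolding n_def by (meson degree_eq_zeroE neq0_conv)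
      then have "coeff q 0 = 1" using q(2) by simp
      then show False using coeffs_inD[OF q(1), of 0] ideal_proper by simp
    qed
    define u where "u = 1 - coeff r 0"
    have "u \<in> V" unfolding u_def using coeffs_inD[OF r(1), of 0] by (intro diff_in one_in ideal_in)
    moreover have "u \<notin> m"
    proof
      assume "u \<in> m"
      from ideal_add[OF this coeffs_inD[OF r(1), of 0]] show False
        using ideal_proper by (simp add: u_def)
    qed
    ultimately have uV: "inverse u \<in> V" and u0: "u \<noteq> 0" using unit ideal_zero by auto
    have rk: "x ^ k = (\<Sum>i\<le>k. coeff r i * x ^ (k - i))"
    proof -
      have "x ^ k = x ^ k * poly r (inverse x)" by (simp add: r(2))
      also have "\<dots> = (\<Sum>i\<le>k. coeff r i * x ^ (k - i))"
        unfolding poly_altdef sum_distrib_left k_def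
        by (rule sum.cong) (auto simp: x power_diff field_simps)
      finally show ?thesis .
    qed
    have xk: "x ^ k = inverse u * (\<Sum>i=1..k. coeff r i * x ^ (k - i))"
    proof -
      have "{..k} = insert 0 {1..k}" by auto
      then have "x ^ k = coeff r 0 * x ^ k + (\<Sum>i=1..k. coeff r i * x ^ (k - i))"
        by (subst rk) simp
      then have "u * x ^ k = (\<Sum>i=1..k. coeff r i * x ^ (k - i))"
        by (simp add: u_def algebra_simps)
      then show ?thesis using u0 by (simp add: field_simps)
    qed
    define q' where "q' = (q - monom (coeff q n) n)
      + smult (inverse u * coeff q n) (\<Sum>i=1..k. monom (coeff r i) (n - i))"
    have c: "coeff q' j = (if j = n then 0 else coeff q j)
        + inverse u * coeff q n * (\<Sum>i=1..k. if n - i = j then coeff r i else 0)" for j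
      unfolding q'_def by (simp add: coeff_sum)
    have inm: "coeffs_in m q'"
      unfolding coeffs_in_def c
      using coeffs_inD[OF q(1)] coeffs_inD[OF r(1)] uV
      by (auto intro!: ideal_add ideal_zero ideal_mult ideal_sum mult_in intro: ideal_in)
    have ev: "poly q' x = 1"
    proof -
      have "(\<Sum>i=1..k. coeff r i * x ^ (n - i)) = x ^ (n - k) * (\<Sum>i=1..k. coeff r i * x ^ (k - i))"
        unfolding sum_distrib_left
      proof (rule sum.cong)
        fix i assume "i \<in> {1..k}"
        then have "n - i = (n - k) + (k - i)" using deg by (auto simp: k_def n_def)
        then show "coeff r i * x ^ (n - i) = x ^ (n - k) * (coeff r i * x ^ (k - i))"
          by (simp add: power_add)
      qed simp
      then have "inverse u * coeff q n * (\<Sum>i=1..k. coeff r i * x ^ (n - i)) = coeff q n * (x ^ (n - k) * x ^ k)"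
        by (subst xk) (simp add: algebra_simps)
      also have "x ^ (n - k) * x ^ k = x ^ n"
        using deg by (simp add: k_def n_def flip: power_add)
      finally show ?thesis
        using q(2) by (simp add: q'_def poly_sum poly_monom)
    qed
    have "coeff q' j = 0" if "j \<ge> n" for j
    proof -
      have "(\<Sum>i=1..k. if n - i = j then coeff r i else 0) = 0"
        using that n0 by (intro sum.neutral) auto
      moreover have "j \<noteq> n \<Longrightarrow> coeff q j = 0" using that by (simp add: n_def coeff_eq_0)
      ultimately show ?thesis by (simp add: c)
    qed
    then have "degree q' < n" using n0 by (simp add: degree_lessI)
    then show False using min[OF inm ev] by (simp add: n_def)
  qed
  have val: "x \<in> V \<or> inverse x \<in> V" for x
  proof (rule ccontr)
    assume notin: "\<not> (x \<in> V \<or> inverse x \<in> V)"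
    then have "x \<noteq> 0" using zero_in by auto
    obtain q where q: "coeffs_in m q" "poly q x = 1"
      and qmin: "\<And>q'. coeffs_in m q' \<Longrightarrow> poly q' x = 1 \<Longrightarrow> degree q \<le> degree q'"
      using ex_has_least_nat[of "\<lambda>q. coeffs_in m q \<and> poly q x = 1" _ degree] adjoin[of x] notin by metis
    obtain r where r: "coeffs_in m r" "poly r (inverse x) = 1"
      and rmin: "\<And>q'. coeffs_in m q' \<Longrightarrow> poly q' (inverse x) = 1 \<Longrightarrow> degree r \<le> degree q'"
      using ex_has_least_nat[of "\<lambda>q. coeffs_in m q \<and> poly q (inverse x) = 1" _ degree] adjoin[of "inverse x"] notin
      by metis
    show False
    proof (cases "degree r \<le> degree q")
      case True
      then show False using no_reduction[OF \<open>x \<noteq> 0\<close> q qmin r] by blast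
    next
      case False
      then show False
        using no_reduction[of "inverse x" r q] r rmin q \<open>x \<noteq> 0\<close> by auto
    qed
  qed
  show ?thesis
  proof (rule that[OF _ RV])
    show "valuation_subring V m"
      by unfold_locales (use val unit in auto)
  qed
qed

section \<open>Products of linear factors\<close>

definition root_prod :: "'a::comm_ring_1 set \<Rightarrow> ('a \<Rightarrow> nat) \<Rightarrow> 'a poly" where
  "root_prod U c = (\<Prod>u\<in>U. [:- u, 1:] ^ c u)"

lemma root_prod_update:
  assumes "finite U" "u \<in> U" "k \<le> c u"
  shows "root_prod U c = [:- u, 1:] ^ k * root_prod U (c(u := c u - k))"
proof -
  have "(\<Prod>v\<in>U - {u}. [:- v, 1:] ^ c v) = (\<Prod>v\<in>U - {u}. [:- v, 1:] ^ (c(u := c u - k)) v)"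
    by (rule prod.cong) auto
  moreover have "[:- u, 1:] ^ c u = [:- u, 1:] ^ k * [:- u, 1:] ^ (c u - k)"
    using assms(3) by (simp flip: power_add)
  ultimately show ?thesis
    unfolding root_prod_def using assms(1,2)
    by (simp add: prod.remove mult.assoc)
qed

lemma root_prod_cong: "(\<And>u. u \<in> U \<Longrightarrow> c u = c' u) \<Longrightarrow> root_prod U c = root_prod U c'"
  unfolding root_prod_def by (rule prod.cong) auto

lemma root_prod_0: "(\<And>u. u \<in> U \<Longrightarrow> c u = 0) \<Longrightarrow> root_prod U c = 1"
  unfolding root_prod_def by (simp cong: prod.cong)

lemma root_prod_double: "root_prod U (\<lambda>u. 2 * c u) = root_prod U c ^ 2"
  unfolding root_prod_def prod_power_distrib by (simp add: power_mult [symmetric] mult.commute)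

lemma root_prod_square:
  "(\<And>u. u \<in> U \<Longrightarrow> c u = 2 * c' u) \<Longrightarrow> root_prod U c = root_prod U c' ^ 2"
  using root_prod_cong[of U c "\<lambda>u. 2 * c' u"] root_prod_double[of U c'] by metis

lemma poly_root_prod: "poly (root_prod U c) x = (\<Prod>u\<in>U. (x - u) ^ c u)"
  by (simp add: root_prod_def poly_prod)

lemma poly_root_prod_eq_0_iff:
  fixes x :: "'a::idom"
  shows "finite U \<Longrightarrow> poly (root_prod U c) x = 0 \<longleftrightarrow> x \<in> U \<and> c x > 0"
  by (auto simp: poly_root_prod)

lemma lead_coeff_root_prod [simp]:
  fixes U :: "'a::idom set"
  shows "lead_coeff (root_prod U c) = 1"
  by (simp add: root_prod_def lead_coeff_prod lead_coeff_power)

lemma root_prod_nonzero [simp]: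
  fixes U :: "'a::idom set"
  shows "root_prod U c \<noteq> 0"
  by (metis lead_coeff_root_prod leading_coeff_0_iff zero_neq_one)

lemma degree_root_prod:
  fixes U :: "'a::idom set"
  shows "degree (root_prod U c) = (\<Sum>u\<in>U. c u)"
  unfolding root_prod_def by (subst degree_prod_sum_eq) (auto simp: degree_power_eq)

text \<open>Adds one root at a time, counted with multiplicity. A product of linear factors depends
  only on the values of c on U, hence the base case asks for no more than that c vanishes on
  U.\<close>

lemma multiplicity_induct [consumes 1, case_names zero add]:
  fixes U :: "'a set" and c :: "'a \<Rightarrow> nat"
  assumes "finite U"
    and "\<And>c. (\<And>u. u \<in> U \<Longrightarrow> c u = 0) \<Longrightarrow> P c"
    and "\<And>c u. u \<in> U \<Longrightarrow> P c \<Longrightarrow> P (c(u := Suc (c u)))"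
  shows "P c"
proof (induction "\<Sum>u\<in>U. c u" arbitrary: c)
  case 0
  then show ?case using assms(1) by (intro assms(2)) simp
next
  case (Suc n)
  then obtain u where u: "u \<in> U" "c u > 0"
    by (metis sum.neutral nat.distinct(1) not_gr_zero)
  have "(\<Sum>v\<in>U. c v) = Suc (\<Sum>v\<in>U. (c(u := c u - 1)) v)"
    using u assms(1) by (simp add: sum.remove)
  then have "P (c(u := c u - 1))"
    using Suc by (intro Suc.hyps(1)) simp
  from assms(3)[OF u(1) this] show ?case using u(2) by simp
qed

text \<open>The alternative \<open>q = 0\<close> covers a constant p: the zero polynomial has degree
  0, so its degree is never smaller than that of a constant.\<close>

lemma degree_diff_dominated:
  fixes p q :: "'a::comm_ring_1 poly"
  assumes "degree q < degree p \<or> q = 0"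
  shows "degree (p - q) = degree p \<and> lead_coeff (p - q) = lead_coeff p"
proof (cases "q = 0")
  case False
  then have less: "degree q < degree p" using assms by simp
  then have "degree (p + - q) = degree p" by (intro degree_add_eq_left) simp
  then show ?thesis using coeff_eq_0[OF less] by simp
qed simp

section \<open>The norm form modulo a prime\<close>

context valuation_subring
begin

lemma ideal_prime: "x \<in> V \<Longrightarrow> y \<in> V \<Longrightarrow> x * y \<in> m \<Longrightarrow> x \<in> m \<or> y \<in> m"
  using ideal_mult[OF unit_inverse_in, of x "x * y"] ideal_zero
  by (cases "x = 0") (auto simp: field_simps)

lemma ideal_prime_power: "x \<in> V \<Longrightarrow> x ^ k \<in> m \<Longrightarrow> x \<in> m"
  by (induction k) (use ideal_proper ideal_prime power_in in auto)

lemma ideal_prime_prod: "(\<And>i. i \<in> A \<Longrightarrow> f i \<in> V) \<Longrightarrow> (\<And>i. i \<in> A \<Longrightarrow> f i \<notin> m) \<Longrightarrow> prod f A \<in> V \<and> prod f A \<notin> m"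
proof (induction A rule: infinite_finite_induct)
  case (insert x F)
  then have "prod f F \<in> V" "prod f F \<notin> m" "f x \<in> V" "f x \<notin> m" by auto
  then show ?case using insert.hyps mult_in ideal_prime by (metis prod.insert)
qed (use ideal_proper one_in in auto)

text \<open>Stands in for the passage to polynomials over the residue field: top coefficients in m
  are dropped, so that q has the degree of the reduction of p.\<close>

lemma exists_unit_lead_coeff:
  assumes "coeffs_in V p"
  obtains q where "coeffs_in V q" "coeffs_in m (p - q)" "q = 0 \<or> lead_coeff q \<notin> m"
proof -
  have "\<exists>q. coeffs_in V q \<and> coeffs_in m (p - q) \<and> (q = 0 \<or> lead_coeff q \<notin> m)"
    using assms
  proof (induction p)
    case 0
    then show ?case using coeffs_in_0 coeffs_in_ideal_0 by (intro exI[of _ 0]) auto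
  next
    case (pCons a p)
    then obtain q where q: "coeffs_in V q" "coeffs_in m (p - q)" "q = 0 \<or> lead_coeff q \<notin> m"
      by (auto simp: coeffs_in_pCons)
    have a: "a \<in> V" using pCons by (simp add: coeffs_in_pCons)
    have pc: "coeffs_in m (pCons b r)" if "b \<in> m" "coeffs_in m r" for b r
      using that unfolding coeffs_in_def by (simp add: coeff_pCons split: nat.split)
    show ?case
    proof (cases "q = 0")
      case True
      show ?thesis
      proof (cases "a \<in> m")
        case True
        then show ?thesis using \<open>q = 0\<close> q pc coeffs_in_0 by (intro exI[of _ 0]) auto
      next
        case False
        then show ?thesis using \<open>q = 0\<close> q pc coeffs_in_const a ideal_zero
          by (intro exI[of _ "[:a:]"]) auto
      qed
    next
      case False
      then show ?thesis using q a pc ideal_zero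
        by (intro exI[of _ "pCons a q"]) (auto simp: coeffs_in_pCons)
    qed
  qed
  then show ?thesis using that by blast
qed

text \<open>Polynomials over the residue field form a domain. After trimming, the leading
  coefficient of the product is a product of two elements outside m, unless one of the trimmed
  factors is zero.\<close>

lemma coeffs_in_ideal_prime:
  assumes "coeffs_in V p" "coeffs_in V q" "coeffs_in m (p * q)"
  shows "coeffs_in m p \<or> coeffs_in m q"
proof -
  obtain p' where p': "coeffs_in V p'" "coeffs_in m (p - p')" "p' = 0 \<or> lead_coeff p' \<notin> m"
    using exists_unit_lead_coeff[OF assms(1)] .
  obtain q' where q': "coeffs_in V q'" "coeffs_in m (q - q')" "q' = 0 \<or> lead_coeff q' \<notin> m"
    using exists_unit_lead_coeff[OF assms(2)] .
  have "p' * q' = p * q - (p - p') * q - p' * (q - q')"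
    by (simp add: algebra_simps)
  then have "coeffs_in m (p' * q')"
    using assms p' q' by (metis coeffs_in_ideal_diff coeffs_in_ideal_mult coeffs_in_ideal_mult_right)
  then have "lead_coeff p' * lead_coeff q' \<in> m"
    using coeffs_inD[of m "p' * q'" "degree (p' * q')"] by (simp add: lead_coeff_mult)
  then have "lead_coeff p' \<in> m \<or> lead_coeff q' \<in> m"
    using p'(1) q'(1) by (intro ideal_prime) (auto dest: coeffs_inD)
  then have "p' = 0 \<or> q' = 0" using p'(3) q'(3) by blast
  then show ?thesis using p'(2) q'(2) by auto
qed

lemma coeffs_in_ideal_cancel:
  assumes "coeffs_in V p" "coeffs_in V q" "lead_coeff q = 1" "coeffs_in m (q * p)"
  shows "coeffs_in m p"
  using coeffs_in_ideal_prime[OF assms(2,1,4)] coeffs_inD[of m q "degree q"] assms(3) ideal_proper by auto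

text \<open>The pair is divided by a coefficient of least value, which becomes 1 while all others
  land in V. Such a coefficient exists because any two nonzero elements are comparable under
  divisibility in a valuation ring.\<close>

lemma exists_primitive_multiple:
  assumes "A \<noteq> 0 \<or> B \<noteq> (0 :: 'a poly)"
  obtains s where "s \<noteq> 0" "coeffs_in V (smult s A)" "coeffs_in V (smult s B)"
    "\<not> (coeffs_in m (smult s A) \<and> coeffs_in m (smult s B))"
proof -
  have minimal: "\<exists>c\<in>C. \<forall>x\<in>C. x / c \<in> V" if "finite C" "C \<noteq> {}" "0 \<notin> C" for C
    using that
  proof (induction C rule: finite_ne_induct)
    case (singleton x)
    then show ?case using one_in by auto
  next
    case (insert x F)
    then obtain c where c: "c \<in> F" "\<forall>y\<in>F. y / c \<in> V" by auto
    show ?case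
    proof (cases "x / c \<in> V")
      case True
      then show ?thesis using c by auto
    next
      case False
      then have cx: "c / x \<in> V" using valuation[of "x / c"] by simp
      have c0: "c \<noteq> 0" "x \<noteq> 0" using c(1) insert.prems by auto
      have "y / x \<in> V" if "y \<in> F" for y
        using mult_in[OF bspec[OF c(2) that] cx] c0 by simp
      then show ?thesis using one_in c0 by auto
    qed
  qed
  define C where "C = (coeff A ` {..degree A} \<union> coeff B ` {..degree B}) - {0}"
  have mem: "coeff A i = 0 \<or> coeff A i \<in> C" "coeff B i = 0 \<or> coeff B i \<in> C" for i
    using coeff_eq_0[of A i] coeff_eq_0[of B i] unfolding C_def by (cases "i \<le> degree A"; cases "i \<le> degree B"; force)+
  have "C \<noteq> {}"
    using assms mem(1)[of "degree A"] mem(2)[of "degree B"] by auto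
  then obtain c where c: "c \<in> C" "\<And>x. x \<in> C \<Longrightarrow> x / c \<in> V"
    using minimal[of C] by (auto simp: C_def)
  have c0: "c \<noteq> 0" using c(1) by (simp add: C_def)
  show ?thesis
  proof (rule that[of "1 / c"])
    show "1 / c \<noteq> 0" using c0 by simp
    have *: "inverse c * x \<in> V" if "x = 0 \<or> x \<in> C" for x
      using that c(2)[of x] zero_in by (auto simp: field_simps)
    show "coeffs_in V (smult (1 / c) A)" "coeffs_in V (smult (1 / c) B)"
      unfolding coeffs_in_def using * mem by (simp_all add: field_simps)
    obtain i where "coeff A i = c \<or> coeff B i = c"
      using c(1) by (auto simp: C_def)
    then have "coeff (smult (1 / c) A) i = 1 \<or> coeff (smult (1 / c) B) i = 1"
      using c0 by auto
    then show "\<not> (coeffs_in m (smult (1 / c) A) \<and> coeffs_in m (smult (1 / c) B))"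
      using ideal_proper by (metis coeffs_inD)
  qed
qed

lemma coeffs_in_linear: "u \<in> V \<Longrightarrow> coeffs_in V [:- u, 1:]"
  by (simp add: coeffs_in_pCons coeffs_in_0 uminus_in one_in)

lemma coeffs_in_root_prod: "U \<subseteq> V \<Longrightarrow> coeffs_in V (root_prod U c)"
  unfolding root_prod_def by (intro coeffs_in_prod coeffs_in_power coeffs_in_linear) auto

lemma coeffs_in_synthetic_div: "coeffs_in V p \<Longrightarrow> u \<in> V \<Longrightarrow> coeffs_in V (synthetic_div p u)"
  by (induction p) (auto simp: coeffs_in_pCons coeffs_in_0 intro: poly_in)

lemma root_mod_factor:
  assumes "coeffs_in V p" "u \<in> V" "poly p u \<in> m"
  obtains q where "coeffs_in V q" "coeffs_in m (p - [:- u, 1:] * q)"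
proof (rule that)
  show "coeffs_in V (synthetic_div p u)" using coeffs_in_synthetic_div assms by blast
  have "p - [:- u, 1:] * synthetic_div p u = [:poly p u:]"
    using synthetic_div_correct'[of u p] by (metis add_diff_cancel_left')
  then show "coeffs_in m (p - [:- u, 1:] * synthetic_div p u)"
    using coeffs_in_ideal_const[OF assms(3)] by simp
qed

text \<open>Incongruent roots split off one by one: the product over the earlier roots takes a value
  outside m at the next root, so p can vanish there modulo m only if the cofactor does.\<close>

lemma roots_mod_factor:
  assumes "finite S" "S \<subseteq> V" "\<And>u v. u \<in> S \<Longrightarrow> v \<in> S \<Longrightarrow> u \<noteq> v \<Longrightarrow> u - v \<notin> m"
    and "coeffs_in V p" "\<And>u. u \<in> S \<Longrightarrow> poly p u \<in> m"
  shows "\<exists>q. coeffs_in V q \<and> coeffs_in m (p - root_prod S (\<lambda>_. 1) * q)"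
  using assms
proof (induction S rule: finite_induct)
  case empty
  then show ?case using coeffs_in_ideal_0 by (intro exI[of _ p]) (simp add: root_prod_def)
next
  case (insert u S)
  then obtain q where q: "coeffs_in V q" "coeffs_in m (p - root_prod S (\<lambda>_. 1) * q)"
    by force
  have u: "u \<in> V" and S: "S \<subseteq> V" using insert.prems by auto
  have "poly p u - poly (p - root_prod S (\<lambda>_. 1) * q) u = poly (root_prod S (\<lambda>_. 1)) u * poly q u"
    by simp
  then have "poly (root_prod S (\<lambda>_. 1)) u * poly q u \<in> m"
    using ideal_diff[OF insert.prems(4)[of u] poly_in_ideal[OF q(2) u]] by simp
  moreover have "poly (root_prod S (\<lambda>_. 1)) u \<notin> m"
  proof -
    have "(\<Prod>v\<in>S. u - v) \<in> V \<and> (\<Prod>v\<in>S. u - v) \<notin> m"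
    proof (rule ideal_prime_prod)
      fix v assume v: "v \<in> S"
      then show "u - v \<in> V" using u S by (auto intro: diff_in)
      have "u \<noteq> v" using v insert.hyps by auto
      then show "u - v \<notin> m" using insert.prems(2)[of u v] v by auto
    qed
    then show ?thesis by (simp add: poly_root_prod)
  qed
  ultimately have "poly q u \<in> m"
    using ideal_prime poly_in[OF coeffs_in_root_prod[OF S] u] poly_in[OF q(1) u] by blast
  then obtain r where r: "coeffs_in V r" "coeffs_in m (q - [:- u, 1:] * r)"
    using root_mod_factor[OF q(1) u] by blast
  have split: "p - root_prod (insert u S) (\<lambda>_. 1) * r
      = (p - root_prod S (\<lambda>_. 1) * q) + root_prod S (\<lambda>_. 1) * (q - [:- u, 1:] * r)"
    using insert.hyps by (simp add: root_prod_def algebra_simps)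
  have "coeffs_in m (p - root_prod (insert u S) (\<lambda>_. 1) * r)"
    unfolding split by (intro coeffs_in_ideal_add coeffs_in_ideal_mult coeffs_in_root_prod S q r)
  then show ?case using r(1) by blast
qed

text \<open>Squares of linear factors are divided out until \<open>c \<le> 1\<close>. Then, with \<open>h\<close> the product over
  \<open>c u = 1\<close> and \<open>k\<close> its cofactor in \<open>f\<close>, the equation becomes \<open>h A\<^sup>2 - k B\<^sup>2 = l\<close> modulo \<open>m\<close>. The two terms
  have degrees of different parity, so that \<open>h\<close> or \<open>k\<close> is constant.\<close>

lemma norm_mod_parity:
  fixes U :: "'a set"
  assumes U: "finite U" "U \<subseteq> V" "\<And>u v. u \<in> U \<Longrightarrow> v \<in> U \<Longrightarrow> u \<noteq> v \<Longrightarrow> u - v \<notin> m" "odd (card U)"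
    and "coeffs_in V A" "coeffs_in V B" "l0 \<in> V" "\<not> (coeffs_in m A \<and> coeffs_in m B)"
    and "coeffs_in m (A\<^sup>2 - root_prod U (\<lambda>_. 1) * B\<^sup>2 - smult l0 (root_prod U c))"
  shows "(\<forall>u\<in>U. even (c u)) \<or> (\<forall>u\<in>U. odd (c u))"
  using assms(5-)
proof (induction "\<Sum>u\<in>U. c u" arbitrary: c A B rule: less_induct)
  case less
  note A = less.prems(1) and B = less.prems(2) and l = less.prems(3) and AB = less.prems(4)
    and eq = less.prems(5)
  define f where "f = root_prod U (\<lambda>_. 1)"
  have fV: "coeffs_in V f" unfolding f_def using U by (intro coeffs_in_root_prod)
  show ?case
  proof (cases "\<exists>u\<in>U. c u \<ge> 2")
    case True
    then obtain u where u: "u \<in> U" "c u \<ge> 2" by blast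
    have uV: "u \<in> V" using u U by blast
    define L where "L = [:- u, 1:]"
    have L: "coeffs_in V L" "lead_coeff L = 1" "poly L u = 0"
      using coeffs_in_linear[OF uV] by (simp_all add: L_def)
    define h where "h = root_prod U ((\<lambda>_. 1)(u := 0))"
    define R where "R = root_prod U (c(u := c u - 2))"
    have "root_prod U (\<lambda>_. 1) = L ^ 1 * root_prod U ((\<lambda>_. 1)(u := 1 - 1))"
      unfolding L_def by (rule root_prod_update[OF U(1) u(1)]) simp
    then have h: "f = L * h"
      by (simp only: f_def h_def power_one_right diff_self_eq_0)
    moreover have "coeffs_in V h"
      unfolding h_def using U(2) by (rule coeffs_in_root_prod)
    ultimately have h: "f = L * h" "coeffs_in V h" .
    have R: "root_prod U c = L\<^sup>2 * R" "coeffs_in V R"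
      unfolding L_def R_def using root_prod_update[OF U(1) u(1), of 2 c] u(2) U coeffs_in_root_prod by auto
    have hu: "poly h u \<notin> m"
    proof -
      have "(\<Prod>v\<in>U. (u - v) ^ ((\<lambda>_. 1)(u := 0)) v) \<in> V \<and> (\<Prod>v\<in>U. (u - v) ^ ((\<lambda>_. 1)(u := 0)) v) \<notin> m"
        by (rule ideal_prime_prod) (use U u ideal_proper in \<open>auto intro: diff_in power_in one_in\<close>)
      then show ?thesis by (simp add: h_def poly_root_prod)
    qed
    \<comment> \<open>At u both f and the product vanish, so that the congruence leaves A(u)^2 in
      m.\<close>
    have "poly (A\<^sup>2 - f * B\<^sup>2 - smult l0 (root_prod U c)) u \<in> m"
      using poly_in_ideal[OF eq uV] by (simp add: f_def)
    then have "poly A u \<in> m"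
      using ideal_prime_power[OF poly_in[OF A uV], of 2] by (simp add: h R L)
    then obtain A1 where A1: "coeffs_in V A1" "coeffs_in m (A - L * A1)"
      using root_mod_factor[OF A uV] unfolding L_def by blast
    \<comment> \<open>Replacing A by L A1 changes A^2 by (A - L A1) (A + L A1), which is zero modulo
      m. One factor L can then be cancelled, since L is monic.\<close>
    have "L * (L * A1\<^sup>2 - h * B\<^sup>2 - smult l0 (L * R))
        = (A\<^sup>2 - f * B\<^sup>2 - smult l0 (root_prod U c)) - (A - L * A1) * (A + L * A1)"
      by (simp add: h R algebra_simps power2_eq_square)
    also have "coeffs_in m \<dots>"
      by (rule coeffs_in_ideal_diff[OF eq [folded f_def] coeffs_in_ideal_mult_right
            [OF A1(2) coeffs_in_add[OF A coeffs_in_mult[OF L(1) A1(1)]]]])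
    finally have c1: "coeffs_in m (L * (L * A1\<^sup>2 - h * B\<^sup>2 - smult l0 (L * R)))" .
    then have eq1: "coeffs_in m (L * A1\<^sup>2 - h * B\<^sup>2 - smult l0 (L * R))"
      using L A1 h B l R
      by (intro coeffs_in_ideal_cancel[OF _ _ _ c1] coeffs_in_diff coeffs_in_mult coeffs_in_power coeffs_in_smult)
    \<comment> \<open>The other two terms still carry L, and h(u) is a product of differences of
      incongruent roots. So B vanishes at u modulo m as well and a second L cancels: A and B have
      each lost a factor, and c has dropped by 2 at u.\<close>
    have "poly h u * poly B u ^ 2 \<in> m"
      using ideal_uminus[OF poly_in_ideal[OF eq1 uV]] by (simp add: L)
    then have "poly B u \<in> m"
      using hu ideal_prime[OF poly_in[OF h(2) uV] power_in[OF poly_in[OF B uV]]]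
        ideal_prime_power[OF poly_in[OF B uV]] by blast
    then obtain B1 where B1: "coeffs_in V B1" "coeffs_in m (B - L * B1)"
      using root_mod_factor[OF B uV] unfolding L_def by blast
    have "L * (A1\<^sup>2 - f * B1\<^sup>2 - smult l0 R)
        = (L * A1\<^sup>2 - h * B\<^sup>2 - smult l0 (L * R)) + h * ((B - L * B1) * (B + L * B1))"
      by (simp add: h R algebra_simps power2_eq_square)
    also have "coeffs_in m \<dots>"
      by (rule coeffs_in_ideal_add[OF eq1 coeffs_in_ideal_mult[OF h(2) coeffs_in_ideal_mult_right
            [OF B1(2) coeffs_in_add[OF B coeffs_in_mult[OF L(1) B1(1)]]]]])
    finally have c2: "coeffs_in m (L * (A1\<^sup>2 - f * B1\<^sup>2 - smult l0 R))" .
    then have eq2: "coeffs_in m (A1\<^sup>2 - f * B1\<^sup>2 - smult l0 R)"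
      using L A1 B1 fV R l
      by (intro coeffs_in_ideal_cancel[OF _ _ _ c2] coeffs_in_diff coeffs_in_mult coeffs_in_power coeffs_in_smult)
    have AB1: "\<not> (coeffs_in m A1 \<and> coeffs_in m B1)"
    proof
      assume *: "coeffs_in m A1 \<and> coeffs_in m B1"
      have "coeffs_in m ((A - L * A1) + L * A1)" "coeffs_in m ((B - L * B1) + L * B1)"
        using * A1 B1 L by (blast intro: coeffs_in_ideal_add coeffs_in_ideal_mult)+
      then show False using AB by simp
    qed
    have "(\<Sum>v\<in>U. (c(u := c u - 2)) v) < (\<Sum>v\<in>U. c v)"
      using u U(1) by (intro sum_strict_mono_ex1) auto
    then have "(\<forall>v\<in>U. even ((c(u := c u - 2)) v)) \<or> (\<forall>v\<in>U. odd ((c(u := c u - 2)) v))"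
      by (rule less.hyps[OF _ A1(1) B1(1) l AB1 eq2 [unfolded f_def R_def]])
    moreover have "even ((c(u := c u - 2)) v) \<longleftrightarrow> even (c v)" for v
      using u(2) by auto
    ultimately show ?thesis by blast
  next
    case False
    define S where "S = {u\<in>U. c u = 1}"
    have S: "finite S" "S \<subseteq> U" using U(1) by (auto simp: S_def)
    define h where "h = root_prod S (\<lambda>_. 1)"
    define k where "k = root_prod (U - S) (\<lambda>_. 1)"
    have c: "c u = (if u \<in> S then 1 else 0)" if "u \<in> U" for u
      using False that by (auto simp: S_def)
    have fhk: "f = h * k"
      unfolding f_def h_def k_def root_prod_def using prod.subset_diff[OF S(2) U(1)]
      by (metis mult.commute)
    have W: "root_prod U c = h"
    proof -
      have "root_prod U c = (\<Prod>u\<in>U. if u \<in> S then [:- u, 1:] else 1)"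
        unfolding root_prod_def using c by (intro prod.cong) auto
      also have "\<dots> = h"
        unfolding h_def root_prod_def using S U(1) by (simp add: prod.If_cases Int_absorb1)
      finally show ?thesis .
    qed
    have hV: "coeffs_in V h" "coeffs_in V k"
      unfolding h_def k_def using U S by (auto intro!: coeffs_in_root_prod)
    have lc: "lead_coeff h = 1" "lead_coeff k = 1"
      unfolding h_def k_def by (rule lead_coeff_root_prod)+
    have h0: "h \<noteq> 0" "k \<noteq> 0"
      and deg: "degree h = card S" "degree k = card (U - S)"
      by (simp_all add: h_def k_def degree_root_prod)
    have "poly A u \<in> m" if u: "u \<in> S" for u
    proof -
      have uV: "u \<in> V" using u S U by blast
      have "poly h u = 0" using u S by (simp add: h_def poly_root_prod_eq_0_iff)
      then have "poly A u ^ 2 \<in> m"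
        using poly_in_ideal[OF eq [folded f_def] uV] by (simp add: fhk W)
      then show ?thesis using ideal_prime_power[OF poly_in[OF A uV]] by blast
    qed
    moreover have "S \<subseteq> V" using S U by blast
    moreover have "u - v \<notin> m" if "u \<in> S" "v \<in> S" "u \<noteq> v" for u v
      using that U S by blast
    ultimately obtain A1 where A1: "coeffs_in V A1" "coeffs_in m (A - h * A1)"
      using roots_mod_factor[OF S(1) _ _ A] unfolding h_def by blast
    have "h * (h * A1\<^sup>2 - k * B\<^sup>2 - [:l0:])
        = (A\<^sup>2 - f * B\<^sup>2 - smult l0 (root_prod U c)) - (A - h * A1) * (A + h * A1)"
      by (simp add: fhk W algebra_simps power2_eq_square)
    also have "coeffs_in m \<dots>"
      by (rule coeffs_in_ideal_diff[OF eq [folded f_def] coeffs_in_ideal_mult_right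
            [OF A1(2) coeffs_in_add[OF A coeffs_in_mult[OF hV(1) A1(1)]]]])
    finally have c3: "coeffs_in m (h * (h * A1\<^sup>2 - k * B\<^sup>2 - [:l0:]))" .
    then have eq1: "coeffs_in m (h * A1\<^sup>2 - k * B\<^sup>2 - [:l0:])"
      using hV lc A1 B l
      by (intro coeffs_in_ideal_cancel[OF _ _ _ c3] coeffs_in_diff coeffs_in_mult coeffs_in_power coeffs_in_const)
    have AB1: "\<not> (coeffs_in m A1 \<and> coeffs_in m B)"
    proof
      assume *: "coeffs_in m A1 \<and> coeffs_in m B"
      have "coeffs_in m ((A - h * A1) + h * A1)"
        using * A1 hV by (blast intro: coeffs_in_ideal_add coeffs_in_ideal_mult)+
      then show False using AB * by simp
    qed
    \<comment> \<open>Degrees have to be compared modulo m, so A1 and B are replaced by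
      representatives whose leading coefficients are units.\<close>
    obtain A' where A': "coeffs_in V A'" "coeffs_in m (A1 - A')" "A' = 0 \<or> lead_coeff A' \<notin> m"
      using exists_unit_lead_coeff[OF A1(1)] .
    obtain B' where B': "coeffs_in V B'" "coeffs_in m (B - B')" "B' = 0 \<or> lead_coeff B' \<notin> m"
      using exists_unit_lead_coeff[OF B] .
    have AB': "A' \<noteq> 0 \<or> B' \<noteq> 0" using AB1 A'(2) B'(2) by auto
    define P where "P = h * A'\<^sup>2 - k * B'\<^sup>2"
    have "P - [:l0:] = (h * A1\<^sup>2 - k * B\<^sup>2 - [:l0:]) - h * ((A1 - A') * (A1 + A')) + k * ((B - B') * (B + B'))"
      by (simp add: P_def algebra_simps power2_eq_square)
    also have "coeffs_in m \<dots>"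
      by (rule coeffs_in_ideal_add[OF coeffs_in_ideal_diff[OF eq1
              coeffs_in_ideal_mult[OF hV(1) coeffs_in_ideal_mult_right[OF A'(2) coeffs_in_add[OF A1(1) A'(1)]]]]
            coeffs_in_ideal_mult[OF hV(2) coeffs_in_ideal_mult_right[OF B'(2) coeffs_in_add[OF B B'(1)]]]])
    finally have Pl: "coeffs_in m (P - [:l0:])" .
    have odd_deg: "odd (card S + card (U - S))"
      using U(4) S card_Diff_subset[OF S(1,2)] card_mono[OF U(1) S(2)] by simp
    have dA: "degree (h * A'\<^sup>2) = card S + 2 * degree A'" if "A' \<noteq> 0"
      using that h0 deg by (simp add: degree_mult_eq degree_power_eq)
    have dB: "degree (k * B'\<^sup>2) = card (U - S) + 2 * degree B'" if "B' \<noteq> 0"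
      using that h0 deg by (simp add: degree_mult_eq degree_power_eq)
    have lA: "lead_coeff (h * A'\<^sup>2) \<notin> m" if "A' \<noteq> 0"
      using that A' ideal_prime_power[of "lead_coeff A'" 2] by (auto simp: lead_coeff_mult lc lead_coeff_power dest: coeffs_inD)
    have lB: "- lead_coeff (k * B'\<^sup>2) \<notin> m" if "B' \<noteq> 0"
      using that B' ideal_prime_power[of "lead_coeff B'" 2] ideal_uminus[of "- (lead_coeff B' ^ 2)"]
      by (auto simp: lead_coeff_mult lc lead_coeff_power dest: coeffs_inD)
    \<comment> \<open>The leading terms cannot cancel, and whichever term wins bounds the degree of
      P from below by the cardinality that belongs to it, \<open>card S\<close> for A' and
      \<open>card (U - S)\<close> for B'.\<close>
    have "lead_coeff P \<notin> m \<and> degree P \<ge> min (card S) (card (U - S))"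
    proof (cases "A' \<noteq> 0 \<and> (B' \<noteq> 0 \<longrightarrow> degree (k * B'\<^sup>2) < degree (h * A'\<^sup>2))")
      case True
      then have "degree (k * B'\<^sup>2) < degree (h * A'\<^sup>2) \<or> k * B'\<^sup>2 = 0" by auto
      then have "degree P = degree (h * A'\<^sup>2)" "lead_coeff P = lead_coeff (h * A'\<^sup>2)"
        using degree_diff_dominated unfolding P_def by blast+
      then show ?thesis using lA True dA by auto
    next
      case False
      have B0: "B' \<noteq> 0" using False AB' by auto
      have "degree (h * A'\<^sup>2) < degree (k * B'\<^sup>2) \<or> h * A'\<^sup>2 = 0"
      proof (rule disjCI)
        assume "h * A'\<^sup>2 \<noteq> 0"
        then have A0: "A' \<noteq> 0" by auto
        then have "degree (h * A'\<^sup>2) \<le> degree (k * B'\<^sup>2)" using False by auto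
        moreover have "degree (h * A'\<^sup>2) \<noteq> degree (k * B'\<^sup>2)"
          unfolding dA[OF A0] dB[OF B0] using odd_deg by presburger
        ultimately show "degree (h * A'\<^sup>2) < degree (k * B'\<^sup>2)" by simp
      qed
      moreover have mP: "- P = k * B'\<^sup>2 - h * A'\<^sup>2" by (simp add: P_def)
      ultimately have *: "degree (- P) = degree (k * B'\<^sup>2)" "lead_coeff (- P) = lead_coeff (k * B'\<^sup>2)"
        using degree_diff_dominated unfolding mP by blast+
      have "degree P = degree (k * B'\<^sup>2)" "lead_coeff P = - lead_coeff (k * B'\<^sup>2)"
        using *(1) apply (simp only: degree_minus)
        using *(2) by (metis lead_coeff_minus minus_minus)
      then show ?thesis using lB B0 dB by auto
    qed
    \<comment> \<open>P is congruent to the constant l0, so in positive degree its leading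
      coefficient would lie in m.\<close>
    moreover have "degree P = 0 \<or> lead_coeff P \<in> m"
    proof (cases "degree P")
      case (Suc d)
      then show ?thesis using coeffs_inD[OF Pl, of "degree P"] by (simp add: coeff_pCons)
    qed simp
    ultimately have "card S = 0 \<or> card (U - S) = 0" by auto
    then have "S = {} \<or> U - S = {}" using S U(1) by (simp add: finite_subset)
    then show ?thesis using c S(2) by auto
  qed
qed

text \<open>Since e lies in m, g = f + e reduces to f. The pair (A, B) is scaled to be primitive;
  the scaled constant then lies in V because it is the leading coefficient of the right-hand side,
  whose product is monic.\<close>

theorem norm_parity:
  fixes U :: "'a set"
  assumes U: "finite U" "U \<subseteq> V" "\<And>u v. u \<in> U \<Longrightarrow> v \<in> U \<Longrightarrow> u \<noteq> v \<Longrightarrow> u - v \<notin> m" "odd (card U)"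
    and "e \<in> m" and eq: "A\<^sup>2 - (root_prod U (\<lambda>_. 1) + [:e:]) * B\<^sup>2 = smult l0 (root_prod U c)" and "l0 \<noteq> 0"
  shows "(\<forall>u\<in>U. even (c u)) \<or> (\<forall>u\<in>U. odd (c u))"
proof -
  define f where "f = root_prod U (\<lambda>_. 1)"
  define W where "W = root_prod U c"
  have "A \<noteq> 0 \<or> B \<noteq> 0" using eq assms(7) by auto
  then obtain s where s: "s \<noteq> 0" "coeffs_in V (smult s A)" "coeffs_in V (smult s B)"
    "\<not> (coeffs_in m (smult s A) \<and> coeffs_in m (smult s B))"
    using exists_primitive_multiple by blast
  define A' B' l1 where "A' = smult s A" and "B' = smult s B" and "l1 = s\<^sup>2 * l0"
  have eq': "A'\<^sup>2 - (f + [:e:]) * B'\<^sup>2 = smult l1 W"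
  proof -
    have "A'\<^sup>2 - (f + [:e:]) * B'\<^sup>2 = smult (s\<^sup>2) (A\<^sup>2 - (f + [:e:]) * B\<^sup>2)"
      by (simp add: A'_def B'_def power2_eq_square smult_diff_right mult_ac)
    then show ?thesis using eq by (simp add: f_def W_def l1_def)
  qed
  have e: "e \<in> V" using assms(5) by (rule ideal_in)
  have fV: "coeffs_in V f" unfolding f_def using U by (intro coeffs_in_root_prod)
  have "coeffs_in V (A'\<^sup>2 - (f + [:e:]) * B'\<^sup>2)"
    unfolding A'_def B'_def using s fV e
    by (intro coeffs_in_diff coeffs_in_mult coeffs_in_add coeffs_in_power coeffs_in_const)
  then have "coeff (smult l1 W) (degree W) \<in> V" unfolding eq' by (rule coeffs_inD)
  then have "l1 \<in> V" by (simp add: W_def)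
  moreover have "coeffs_in m (A'\<^sup>2 - f * B'\<^sup>2 - smult l1 W)"
  proof -
    have "A'\<^sup>2 - f * B'\<^sup>2 - smult l1 W = smult e (B'\<^sup>2)"
      unfolding eq' [symmetric] by (simp add: algebra_simps)
    then show ?thesis
      using s(3) assms(5) coeffs_in_ideal_smult coeffs_in_power unfolding B'_def by metis
  qed
  ultimately show ?thesis
    using norm_mod_parity[OF U, of A' B' l1 c] s by (simp add: A'_def B'_def f_def W_def)
qed

end

section \<open>Descent by two\<close>

lemma exists_irreducible_factor:
  fixes p :: "'a::field poly"
  assumes "degree p > 0"
  obtains q where "Factorial_Ring.irreducible q" "q dvd p"
proof -
  obtain q where q: "degree q > 0 \<and> q dvd p" and min: "\<And>r. degree r > 0 \<and> r dvd p \<Longrightarrow> degree q \<le> degree r"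
    using ex_has_least_nat[of "\<lambda>q. degree q > 0 \<and> q dvd p" p degree] assms by auto
  have "Factorial_Ring.irreducible q"
  proof (rule Factorial_Ring.irreducibleI)
    show "q \<noteq> 0" using q by auto
    then show "\<not> q dvd 1" using q is_unit_iff_degree[of q] by auto
    fix a b assume ab: "q = a * b"
    show "a dvd 1 \<or> b dvd 1"
    proof (rule ccontr)
      assume "\<not> (a dvd 1 \<or> b dvd 1)"
      moreover have "a \<noteq> 0" "b \<noteq> 0" using \<open>q \<noteq> 0\<close> ab by auto
      ultimately have "degree a > 0" "degree b > 0" by (auto simp: is_unit_iff_degree)
      moreover have "degree q = degree a + degree b"
        using ab \<open>a \<noteq> 0\<close> \<open>b \<noteq> 0\<close> by (simp add: degree_mult_eq)
      moreover have "a dvd p" using q ab by (metis dvd_mult_left)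
      ultimately show False using min[of a] by simp
    qed
  qed
  then show ?thesis using that q by blast
qed

text \<open>An irreducible factor q of P divides R, so q^2 divides P Q; as q does not divide Q, the
  square q^2 divides P and can be removed on both sides. The constant \<alpha> remains because it
  need not be a square in the field.\<close>

lemma coprime_factor_of_square:
  fixes P Q R :: "'a::field poly"
  assumes "P * Q = R\<^sup>2" "R \<noteq> 0"
    and "\<And>q. Factorial_Ring.irreducible q \<Longrightarrow> q dvd P \<Longrightarrow> \<not> q dvd Q"
  shows "\<exists>\<alpha> s. \<alpha> \<noteq> 0 \<and> P = smult \<alpha> (s\<^sup>2)"
  using assms
proof (induction "degree P" arbitrary: P R rule: less_induct)
  case less
  have P0: "P \<noteq> 0" using less.prems by auto
  show ?case
  proof (cases "degree P = 0")
    case True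
    then obtain a where "P = [:a:]" by (meson degree_eq_zeroE)
    then show ?thesis using P0 by (intro exI[of _ a] exI[of _ 1]) auto
  next
    case False
    then obtain q where q: "Factorial_Ring.irreducible q" "q dvd P"
      using exists_irreducible_factor by blast
    have prime: "prime_elem q" using q(1) by (rule field_poly_irreducible_imp_prime)
    have q0: "q \<noteq> 0" and qd: "degree q > 0" using q(1) by (auto simp: Factorial_Ring.irreducible_def is_unit_iff_degree)
    have nQ: "\<not> q dvd Q" using less.prems(3) q by blast
    have "q dvd R\<^sup>2" using q(2) less.prems(1) by (metis dvd_mult2)
    then have "q dvd R" using prime prime_elem_dvd_power by blast
    then obtain R1 where R1: "R = q * R1" by (elim dvdE)
    obtain P1 where P1: "P = q * P1" using q(2) by (elim dvdE)
    have "q * (P1 * Q) = q * (q * R1\<^sup>2)"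
      using less.prems(1) by (simp add: P1 R1 power2_eq_square mult_ac)
    then have eq: "P1 * Q = q * R1\<^sup>2" using q0 by (metis mult_left_cancel)
    then have "q dvd P1 * Q" by simp
    then have "q dvd P1" using prime nQ prime_elem_dvd_multD by blast
    then obtain P2 where P2: "P1 = q * P2" by (elim dvdE)
    have "q * (P2 * Q) = q * R1\<^sup>2" using eq by (simp add: P2 mult_ac)
    then have eq2: "P2 * Q = R1\<^sup>2" using q0 by (metis mult_left_cancel)
    have R10: "R1 \<noteq> 0" using less.prems(2) R1 by auto
    have P20: "P2 \<noteq> 0" using P0 P1 P2 by auto
    have "degree P2 < degree P" using qd q0 P20 by (simp add: P1 P2 degree_mult_eq)
    moreover have "\<not> r dvd Q" if "Factorial_Ring.irreducible r" "r dvd P2" for r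
      using less.prems(3)[OF that(1)] that(2) P1 P2 by (metis dvd_mult)
    ultimately obtain \<alpha> s where "\<alpha> \<noteq> 0" "P2 = smult \<alpha> (s\<^sup>2)"
      using less.hyps[OF _ eq2 R10] by blast
    then show ?thesis
      by (intro exI[of _ \<alpha>] exI[of _ "q * s"]) (simp add: P1 P2 power2_eq_square mult_ac)
  qed
qed

text \<open>The degree of A^2 is even and that of g B^2 is odd, so the leading terms cannot cancel.
  The degree of the norm is the order of the pole of A + B Y at infinity, and its parity tells which
  of the two terms attains it.\<close>

lemma degree_norm:
  fixes A B g :: "'a::field poly"
  assumes "odd (degree g)" "A \<noteq> 0 \<or> B \<noteq> 0"
  shows "A\<^sup>2 - g * B\<^sup>2 \<noteq> 0"
    and "A \<noteq> 0 \<Longrightarrow> 2 * degree A \<le> degree (A\<^sup>2 - g * B\<^sup>2)"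
    and "B \<noteq> 0 \<Longrightarrow> 2 * degree B + degree g \<le> degree (A\<^sup>2 - g * B\<^sup>2)"
    and "even (degree (A\<^sup>2 - g * B\<^sup>2)) \<Longrightarrow> A \<noteq> 0 \<and> degree (A\<^sup>2 - g * B\<^sup>2) = 2 * degree A
            \<and> lead_coeff (A\<^sup>2 - g * B\<^sup>2) = lead_coeff A ^ 2"
    and "odd (degree (A\<^sup>2 - g * B\<^sup>2)) \<Longrightarrow> B \<noteq> 0 \<and> degree (A\<^sup>2 - g * B\<^sup>2) = 2 * degree B + degree g"
proof -
  have g0: "g \<noteq> 0" using assms(1) by auto
  have dA: "A \<noteq> 0 \<Longrightarrow> degree (A\<^sup>2) = 2 * degree A" by (simp add: degree_power_eq)
  have dB: "B \<noteq> 0 \<Longrightarrow> degree (g * B\<^sup>2) = 2 * degree B + degree g"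
    using g0 by (simp add: degree_mult_eq degree_power_eq)
  consider (a) "A \<noteq> 0" "degree (g * B\<^sup>2) < degree (A\<^sup>2) \<or> g * B\<^sup>2 = 0"
    | (b) "B \<noteq> 0" "degree (A\<^sup>2) < degree (g * B\<^sup>2) \<or> A\<^sup>2 = 0"
  proof (cases "A = 0 \<or> B = 0")
    case True
    then show ?thesis using assms(2) that by auto
  next
    case False
    then have "degree (A\<^sup>2) \<noteq> degree (g * B\<^sup>2)"
      using dA dB assms(1) by (metis even_add even_mult_iff even_numeral)
    then show ?thesis using False that by linarith
  qed
  then have "A\<^sup>2 - g * B\<^sup>2 \<noteq> 0 \<and>
    (A \<noteq> 0 \<longrightarrow> 2 * degree A \<le> degree (A\<^sup>2 - g * B\<^sup>2)) \<and>
    (B \<noteq> 0 \<longrightarrow> 2 * degree B + degree g \<le> degree (A\<^sup>2 - g * B\<^sup>2)) \<and>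
    (even (degree (A\<^sup>2 - g * B\<^sup>2)) \<longrightarrow> A \<noteq> 0 \<and> degree (A\<^sup>2 - g * B\<^sup>2) = 2 * degree A
            \<and> lead_coeff (A\<^sup>2 - g * B\<^sup>2) = lead_coeff A ^ 2) \<and>
    (odd (degree (A\<^sup>2 - g * B\<^sup>2)) \<longrightarrow> B \<noteq> 0 \<and> degree (A\<^sup>2 - g * B\<^sup>2) = 2 * degree B + degree g)"
  proof cases
    case a
    from degree_diff_dominated[OF a(2)]
    have d: "degree (A\<^sup>2 - g * B\<^sup>2) = 2 * degree A" "lead_coeff (A\<^sup>2 - g * B\<^sup>2) = lead_coeff A ^ 2"
      by (simp add: dA[OF a(1)], metis lead_coeff_power)
    moreover have "A\<^sup>2 - g * B\<^sup>2 \<noteq> 0"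
      using d(2) a(1) by (metis coeff_0 leading_coeff_0_iff power_eq_0_iff)
    moreover have "2 * degree B + degree g \<le> 2 * degree A" if "B \<noteq> 0"
      using a that g0 dA dB by auto
    ultimately show ?thesis using a(1) by auto
  next
    case b
    from degree_diff_dominated[OF b(2)]
    have d': "degree (g * B\<^sup>2 - A\<^sup>2) = 2 * degree B + degree g" "lead_coeff (g * B\<^sup>2 - A\<^sup>2) = lead_coeff g * lead_coeff B ^ 2"
      by (simp add: dB[OF b(1)], metis lead_coeff_power lead_coeff_mult)
    have "degree (A\<^sup>2 - g * B\<^sup>2) = degree (g * B\<^sup>2 - A\<^sup>2)"
      using degree_minus[of "g * B\<^sup>2 - A\<^sup>2"] by simp
    then have d: "degree (A\<^sup>2 - g * B\<^sup>2) = 2 * degree B + degree g" using d' by simp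
    moreover have "g * B\<^sup>2 - A\<^sup>2 \<noteq> 0"
      using d'(2) b(1) g0 by (metis coeff_0 leading_coeff_0_iff mult_eq_0_iff power_eq_0_iff)
    then have "A\<^sup>2 - g * B\<^sup>2 \<noteq> 0" by auto
    moreover have "2 * degree A \<le> 2 * degree B + degree g" if "A \<noteq> 0"
      using b that g0 dA dB by auto
    ultimately show ?thesis using b(1) assms(1) by auto
  qed
  then show "A\<^sup>2 - g * B\<^sup>2 \<noteq> 0"
    and "A \<noteq> 0 \<Longrightarrow> 2 * degree A \<le> degree (A\<^sup>2 - g * B\<^sup>2)"
    and "B \<noteq> 0 \<Longrightarrow> 2 * degree B + degree g \<le> degree (A\<^sup>2 - g * B\<^sup>2)"
    and "even (degree (A\<^sup>2 - g * B\<^sup>2)) \<Longrightarrow> A \<noteq> 0 \<and> degree (A\<^sup>2 - g * B\<^sup>2) = 2 * degree A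
            \<and> lead_coeff (A\<^sup>2 - g * B\<^sup>2) = lead_coeff A ^ 2"
    and "odd (degree (A\<^sup>2 - g * B\<^sup>2)) \<Longrightarrow> B \<noteq> 0 \<and> degree (A\<^sup>2 - g * B\<^sup>2) = 2 * degree B + degree g"
    by blast+
qed

lemma irreducible_common_root:
  fixes q :: "'a::field poly"
  assumes "Factorial_Ring.irreducible q" "q dvd root_prod U c" "finite U"
  obtains u where "u \<in> U" "c u > 0" "poly q u = 0"
proof -
  have prime: "prime_elem q" using assms(1) by (rule field_poly_irreducible_imp_prime)
  have "q dvd prod f U \<Longrightarrow> \<exists>u\<in>U. q dvd f u" for f :: "'a \<Rightarrow> 'a poly"
    using assms(3)
  proof (induction U rule: finite_induct)
    case empty
    then show ?case using prime by (simp add: prime_elem_def)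
  next
    case (insert u U)
    then show ?case using prime_elem_dvd_multD[OF prime, of "f u" "prod f U"] by auto
  qed
  then obtain u where u: "u \<in> U" "q dvd [:- u, 1:] ^ c u"
    using assms(2) unfolding root_prod_def by blast
  have nu: "\<not> q dvd 1" and q0: "q \<noteq> 0" using assms(1) by (auto simp: Factorial_Ring.irreducible_def)
  have "c u > 0" using u(2) nu by (cases "c u") auto
  have "q dvd [:- u, 1:]" using u(2) prime prime_elem_dvd_power by blast
  then obtain r where r: "[:- u, 1:] = q * r" by (elim dvdE)
  have r0: "r \<noteq> 0" using r by auto
  have "degree q + degree r = degree [:- u, 1:]" unfolding r using q0 r0 by (simp add: degree_mult_eq)
  then have "degree q + degree r = 1" by simp
  moreover have "degree q > 0" using nu q0 by (auto simp: is_unit_iff_degree)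
  ultimately have "degree r = 0" by simp
  then obtain b where b: "r = [:b:]" "b \<noteq> 0" using r0 by (metis degree_eq_zeroE pCons_0_0)
  have "poly q u * b = poly [:- u, 1:] u" unfolding r by (simp add: b)
  then have "poly q u = 0" using b by simp
  then show ?thesis using that u(1) \<open>c u > 0\<close> by blast
qed

text \<open>Parity is assumed for all equations of this form because it is applied anew after each
  halving. The condition \<open>poly A u \<noteq> 0\<close> says that A + B Y does not vanish at
  both points over u; the halved pair inherits it.\<close>

theorem norm_descent:
  fixes g :: "'a::field_char_0 poly" and U :: "'a set"
  assumes g: "Factorial_Ring.irreducible g" "odd (degree g)" and U: "finite U" "\<And>u. u \<in> U \<Longrightarrow> poly g u \<noteq> 0"
    and parity: "\<And>A B l c. l \<noteq> 0 \<Longrightarrow> A\<^sup>2 - g * B\<^sup>2 = smult l (root_prod U c)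
        \<Longrightarrow> (\<forall>u\<in>U. even (c u)) \<or> (\<forall>u\<in>U. odd (c u))"
    and "l \<noteq> 0" "A\<^sup>2 - g * B\<^sup>2 = smult l (root_prod U c)"
    and "\<And>u. u \<in> U \<Longrightarrow> c u > 0 \<Longrightarrow> poly A u \<noteq> 0" and "u0 \<in> U" "c u0 = 0"
  shows "\<forall>u\<in>U. c u = 0"
  using assms(6-8,10)
proof (induction "\<Sum>u\<in>U. c u" arbitrary: c A B l rule: less_induct)
  case less
  have gprime: "prime_elem g" using g(1) by (rule field_poly_irreducible_imp_prime)
  have g0: "g \<noteq> 0" using g(2) by auto
  have even: "\<forall>u\<in>U. even (c u)"
    using parity[OF less.prems(1,2)] less.prems(4) assms(9) by fastforce
  define c' where "c' = (\<lambda>u. c u div 2)"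
  have c': "c u = 2 * c' u" if "u \<in> U" for u using even that by (simp add: c'_def)
  define H where "H = root_prod U c'"
  have HW: "root_prod U c = H\<^sup>2" unfolding H_def by (rule root_prod_square[OF c'])
  have H0: "H \<noteq> 0" "lead_coeff H = 1" by (simp_all add: H_def)
  have AB: "A \<noteq> 0 \<or> B \<noteq> 0" using less.prems(1,2) by auto
  define a where "a = lead_coeff A"
  \<comment> \<open>Even degree means that A^2 dominates, so that l is the square of the leading
    coefficient of A. Dividing by it turns the equation into A'^2 - g B'^2 = H^2.\<close>
  have "even (degree (A\<^sup>2 - g * B\<^sup>2))"
    unfolding less.prems(2) HW using less.prems(1) H0 by (simp add: degree_power_eq)
  from degree_norm(4)[OF g(2) AB this] have "A \<noteq> 0" "lead_coeff (smult l (H\<^sup>2)) = a\<^sup>2"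
    unfolding less.prems(2) HW a_def by blast+
  moreover have "lead_coeff (smult l (H\<^sup>2)) = l"
    unfolding lead_coeff_smult lead_coeff_power H0 by simp
  ultimately have a: "a \<noteq> 0" "l = a\<^sup>2" by (auto simp: a_def)
  define A' B' where "A' = smult (1 / a) A" and "B' = smult (1 / a) B"
  have "A'\<^sup>2 - g * B'\<^sup>2 = smult (1 / a\<^sup>2) (A\<^sup>2 - g * B\<^sup>2)"
    by (simp add: A'_def B'_def power2_eq_square smult_diff_right)
  also have "\<dots> = H\<^sup>2" using a by (simp add: less.prems(2) HW)
  finally have eq: "A'\<^sup>2 - g * B'\<^sup>2 = H\<^sup>2" .
  have Au: "poly A' u \<noteq> 0" if "u \<in> U" "c' u > 0" for u
    using less.prems(3)[of u] that a c' by (simp add: A'_def)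
  have Hu: "poly H u = 0 \<longleftrightarrow> u \<in> U \<and> c' u > 0" for u
    unfolding H_def by (rule poly_root_prod_eq_0_iff[OF U(1)])
  have fact: "(A' - H) * (A' + H) = g * B'\<^sup>2"
    using eq by (simp add: algebra_simps power2_eq_square)
  show ?case
  \<comment> \<open>If B' = 0, then A' is H up to sign, and a root of H would be a root of A', which
    \<open>Au\<close> forbids; so H has no roots at all.\<close>
  proof (cases "B' = 0")
    case True
    then have "A' = H \<or> A' = - H" using fact by (auto simp: eq_neg_iff_add_eq_0)
    then have AH: "poly A' u = 0 \<longleftrightarrow> poly H u = 0" for u by auto
    have "c' u = 0" if "u \<in> U" for u using Au[OF that] Hu[of u] AH[of u] that by auto
    then show ?thesis using c' by simp
  next
    case False
    \<comment> \<open>The sign of H1 is chosen so that g divides A' - H1, with cofactor P; then P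
      and A' + H1 multiply to the square B'^2.\<close>
    have "g dvd A' - H \<or> g dvd A' - (- H)"
      using prime_elem_dvd_multD[OF gprime, of "A' - H" "A' + H"] unfolding fact by simp
    then obtain H1 where H1: "H1 = H \<or> H1 = - H" and "g dvd A' - H1" by blast
    then obtain P where P: "A' - H1 = g * P" by (elim dvdE)
    have "(A' - H1) * (A' + H1) = (A' - H) * (A' + H)"
      using H1 by (auto simp: algebra_simps)
    then have "g * (P * (A' + H1)) = g * B'\<^sup>2"
      by (simp only: P fact mult.assoc)
    then have PQ: "P * (A' + H1) = B'\<^sup>2" using g0 by (metis mult_left_cancel)
    \<comment> \<open>A common factor would divide both 2 H1 and 2 A'. A factor of H has a root u
      with c' u > 0, and there A' does not vanish.\<close>
    have cop: "\<not> q dvd A' + H1" if irr: "Factorial_Ring.irreducible q" "q dvd P" for q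
    proof
      assume q: "q dvd A' + H1"
      have "q dvd A' - H1" using irr(2) P by simp
      then have "q dvd (A' + H1) - (A' - H1)" "q dvd (A' + H1) + (A' - H1)"
        using q by (blast intro: dvd_add dvd_diff)+
      moreover have "(A' + H1) - (A' - H1) = smult 2 H1" "(A' + H1) + (A' - H1) = smult 2 A'"
        by (rule poly_eqI, simp only: coeff_add coeff_diff coeff_smult, simp)+
      ultimately have "q dvd smult 2 H1" "q dvd smult 2 A'" by simp_all
      then have "q dvd H1" "q dvd A'"
        using dvd_smult_iff[of "2 :: 'a" q] by (auto simp del: dvd_smult_iff)
      then have "q dvd H" using H1 by auto
      then obtain u where "u \<in> U" "c' u > 0" "poly q u = 0"
        using irreducible_common_root[OF irr(1) _ U(1)] unfolding H_def by blast
      then show False using Au \<open>q dvd A'\<close> by (auto elim!: dvdE)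
    qed
    then have cop': "\<not> q dvd P" if "Factorial_Ring.irreducible q" "q dvd A' + H1" for q
      using that by blast
    obtain \<alpha> s where \<alpha>: "\<alpha> \<noteq> 0" "P = smult \<alpha> (s\<^sup>2)"
      using coprime_factor_of_square[OF PQ False] cop by blast
    obtain \<beta> t where \<beta>: "\<beta> \<noteq> 0" "A' + H1 = smult \<beta> (t\<^sup>2)"
      using coprime_factor_of_square[of "A' + H1" P, OF _ False] PQ cop' by (metis mult.commute)
    have st: "smult (\<alpha> * \<beta>) ((s * t)\<^sup>2) = B'\<^sup>2"
      using PQ by (simp add: \<alpha> \<beta> power_mult_distrib mult.commute)
    then have "s * t \<noteq> 0" using False by auto
    define \<gamma> where "\<gamma> = lead_coeff B' / lead_coeff (s * t)"
    have "\<alpha> * \<beta> * lead_coeff (s * t) ^ 2 = lead_coeff B' ^ 2"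
      using arg_cong[OF st, of lead_coeff] unfolding lead_coeff_smult lead_coeff_power .
    then have \<gamma>: "\<alpha> * \<beta> = \<gamma>\<^sup>2"
      using \<open>s * t \<noteq> 0\<close> by (simp add: \<gamma>_def power_divide field_simps del: mult_eq_0_iff)
    \<comment> \<open>The scaling absorbs \<alpha> and \<beta>, whose product is the square of
      \<gamma>: it makes \<beta> (t^2 - g s'^2) equal to (A' + H1) - (A' - H1) = 2 H1, a norm
      equation for H in place of H^2.\<close>
    define s' where "s' = smult (\<gamma> / \<beta>) s"
    define \<epsilon> where "\<epsilon> = (if H1 = H then 1 else - 1 :: 'a)"
    have H1': "H1 = smult \<epsilon> H" "\<epsilon> \<noteq> 0" using H1 by (auto simp: \<epsilon>_def)
    have "smult \<beta> (t\<^sup>2 - g * s'\<^sup>2) = smult \<beta> (t\<^sup>2) - g * smult (\<beta> * (\<gamma> / \<beta>)\<^sup>2) (s\<^sup>2)"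
      by (simp add: s'_def smult_diff_right power2_eq_square mult_ac)
    also have "\<beta> * (\<gamma> / \<beta>)\<^sup>2 = \<alpha>"
      using \<beta>(1) \<gamma> by (simp add: power_divide field_simps power2_eq_square)
    also have "smult \<beta> (t\<^sup>2) - g * smult \<alpha> (s\<^sup>2) = (A' + H1) - (A' - H1)"
      by (simp only: P \<alpha>(2) \<beta>(2))
    also have "\<dots> = smult (2 * \<epsilon>) H" unfolding H1'(1)
      by (rule poly_eqI, simp only: coeff_add coeff_diff coeff_smult, simp)
    finally have "smult (1 / \<beta>) (smult \<beta> (t\<^sup>2 - g * s'\<^sup>2)) = smult (1 / \<beta>) (smult (2 * \<epsilon>) H)"
      by (rule arg_cong)
    then have new: "t\<^sup>2 - g * s'\<^sup>2 = smult (2 * \<epsilon> / \<beta>) (root_prod U c')"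
      using \<beta>(1) by (simp add: H_def)
    have tu: "poly t u \<noteq> 0" if "u \<in> U" "c' u > 0" for u
    proof
      assume "poly t u = 0"
      then have "poly (A' + H1) u = 0" by (simp add: \<beta>)
      moreover have "poly H1 u = 0" using that Hu H1' by simp
      ultimately show False using Au that by simp
    qed
    show ?thesis
    proof (rule ccontr)
      assume "\<not> ?thesis"
      then obtain v where "v \<in> U" "c v \<noteq> 0" by blast
      then have "(\<Sum>u\<in>U. c' u) < (\<Sum>u\<in>U. c u)"
        using c' U(1) by (intro sum_strict_mono_ex1) (auto intro!: bexI[of _ v])
      moreover have "2 * \<epsilon> / \<beta> \<noteq> 0" using \<beta>(1) H1'(2) by simp
      moreover have "c' u0 = 0" using less.prems(4) by (simp add: c'_def)
      ultimately have "\<forall>u\<in>U. c' u = 0" using less.hyps[OF _ _ new tu] by blast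
      then show False using c' \<open>v \<in> U\<close> \<open>c v \<noteq> 0\<close> by simp
    qed
  qed
qed

section \<open>Descending the base field\<close>

context field_hom
begin

lemma map_poly_plus: "map_poly hom (p + q) = map_poly hom p + map_poly hom q"
  by (rule poly_eqI) (simp add: coeff_map_poly hom_add)

lemma map_poly_diff: "map_poly hom (p - q) = map_poly hom p - map_poly hom q"
  by (rule poly_eqI) (simp add: coeff_map_poly hom_minus)

lemma map_poly_times: "map_poly hom (p * q) = map_poly hom p * map_poly hom q"
  by (rule poly_eqI) (simp add: coeff_map_poly coeff_mult hom_sum hom_mult)

lemma map_poly_smult': "map_poly hom (smult c p) = smult (hom c) (map_poly hom p)"
  by (rule poly_eqI) (simp add: coeff_map_poly hom_mult)

lemma map_poly_one: "map_poly hom 1 = 1"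
  by (simp add: one_pCons map_poly_pCons)

lemma map_poly_pow: "map_poly hom (p ^ k) = map_poly hom p ^ k"
  by (induction k) (simp_all add: map_poly_one map_poly_times)

lemma map_poly_prod: "map_poly hom (prod f A) = (\<Prod>i\<in>A. map_poly hom (f i))"
  by (induction A rule: infinite_finite_induct) (simp_all add: map_poly_one map_poly_times)

lemma map_poly_linear: "map_poly hom [:- u, 1:] = [:- hom u, 1:]"
  by (simp add: map_poly_pCons hom_uminus)

lemma poly_map_poly_hom: "poly (map_poly hom p) (hom x) = hom (poly p x)"
  by (induction p) (simp_all add: map_poly_pCons hom_add hom_mult)

lemma map_poly_root_prod:
  assumes "inj hom"
  shows "map_poly hom (root_prod U c) = root_prod (hom ` U) (\<lambda>z. c (inv_into UNIV hom z))"
  unfolding root_prod_def map_poly_prod map_poly_pow map_poly_linear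
  using assms by (simp add: prod.reindex inj_on_subset[OF assms] inv_f_f)

lemma degree_map_poly_hom: "degree (map_poly hom p) = degree p"
  by (rule degree_map_poly) simp

lemma map_poly_hom_eq_0_iff: "map_poly hom p = 0 \<longleftrightarrow> p = 0"
  by (simp add: map_poly_eq_0_iff)

lemma map_poly_hom_inject: "map_poly hom p = map_poly hom q \<longleftrightarrow> p = q"
  using map_poly_hom_eq_0_iff[of "p - q"] by (simp add: map_poly_diff)

lemma map_poly_dvd: "p dvd q \<Longrightarrow> map_poly hom p dvd map_poly hom q"
  by (auto simp: dvd_def map_poly_times)

end

interpretation to_ac: field_hom to_ac
  by unfold_locales simp_all

text \<open>Hensel lifting combined with interpolation, one linear factor at a time; it works
  because 2 and all e u are invertible. Prescribing the value e u at u selects one of the two points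
  over u.\<close>

lemma sqrt_mod_root_prod:
  fixes g :: "'a::field_char_0 poly"
  assumes U: "finite U" and e: "\<And>u. u \<in> U \<Longrightarrow> e u ^ 2 = poly g u" "\<And>u. u \<in> U \<Longrightarrow> e u \<noteq> 0"
  shows "\<exists>y. root_prod U c dvd y\<^sup>2 - g \<and> (\<forall>u\<in>U. c u > 0 \<longrightarrow> poly y u = e u)"
  using U
proof (induction c rule: multiplicity_induct)
  case (zero c)
  then show ?case by (intro exI[of _ 0]) (simp add: root_prod_0)
next
  case (add c u)
  define W where "W = root_prod U c"
  obtain y Q where y: "y\<^sup>2 - g = W * Q" "\<And>v. v \<in> U \<Longrightarrow> c v > 0 \<Longrightarrow> poly y v = e v"
    using add.IH unfolding W_def by (auto elim!: dvdE)
  have "root_prod U (c(u := Suc (c u))) = [:- u, 1:] ^ 1 * root_prod U ((c(u := Suc (c u)))(u := (c(u := Suc (c u))) u - 1))"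
    by (rule root_prod_update[OF U add.hyps]) simp
  then have W': "root_prod U (c(u := Suc (c u))) = [:- u, 1:] * W"
    by (simp only: W_def power_one_right fun_upd_upd fun_upd_same diff_Suc_1 fun_upd_triv)
  have Wv: "poly W v = 0 \<longleftrightarrow> v \<in> U \<and> c v > 0" for v
    unfolding W_def by (rule poly_root_prod_eq_0_iff[OF U])
  \<comment> \<open>If u is already a root of W, this is Newton's correction: z solves Q(u) + 2 z
    e(u) = 0. Otherwise z is chosen so that y + z W takes the value e(u) at u.\<close>
  define z where "z = (if c u > 0 then - poly Q u / (2 * e u) else (e u - poly y u) / poly W u)"
  define Z where "Z = [:z:]"
  have Z: "poly Z v = z" for v by (simp add: Z_def)
  define y' where "y' = y + Z * W"
  have "y'\<^sup>2 - g = (y\<^sup>2 - g) + W * (Z * y + Z * y + Z * Z * W)"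
    by (simp add: y'_def algebra_simps power2_eq_square)
  then have sq: "y'\<^sup>2 - g = W * (Q + (Z * y + Z * y + Z * Z * W))"
    by (simp only: y(1) distrib_left)
  have yu: "poly y' u = e u"
    using y(2)[OF add.hyps] Wv[of u] add.hyps by (auto simp: y'_def z_def Z)
  have "poly (Q + (Z * y + Z * y + Z * Z * W)) u = 0"
  proof (cases "c u > 0")
    case True
    then have "poly W u = 0" "poly y u = e u" using Wv y(2) add.hyps by auto
    then show ?thesis using True e(2)[OF add.hyps] by (simp add: z_def Z)
  next
    case False
    then have "poly W u \<noteq> 0" using Wv by simp
    moreover have "poly (y'\<^sup>2 - g) u = 0" using yu e(1)[OF add.hyps] by simp
    ultimately show ?thesis unfolding sq by simp
  qed
  then have "[:- u, 1:] dvd Q + (Z * y + Z * y + Z * Z * W)"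
    by (simp only: poly_eq_0_iff_dvd)
  then have "root_prod U (c(u := Suc (c u))) dvd y'\<^sup>2 - g"
    unfolding W' sq by (subst mult.commute) (rule mult_dvd_mono[OF dvd_refl])
  moreover have "poly y' v = e v" if "v \<in> U" "(c(u := Suc (c u))) v > 0" for v
  proof (cases "v = u")
    case False
    then have "c v > 0" using that by simp
    then show ?thesis using y(2)[OF that(1)] Wv[of v] that(1) by (simp add: y'_def Z)
  qed (use yu in simp)
  ultimately show ?case by blast
qed

lemma root_prod_dvd_cancel:
  fixes P Q :: "'a::field poly"
  assumes "finite U" "root_prod U c dvd P * Q" "\<And>u. u \<in> U \<Longrightarrow> c u > 0 \<Longrightarrow> poly Q u \<noteq> 0"
  shows "root_prod U c dvd P"
  using assms
proof (induction c arbitrary: P rule: multiplicity_induct)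
  case (zero c)
  then show ?case by (simp add: root_prod_0)
next
  case (add c u)
  define W where "W = root_prod U c"
  have "root_prod U (c(u := Suc (c u))) = [:- u, 1:] ^ 1 * root_prod U ((c(u := Suc (c u)))(u := (c(u := Suc (c u))) u - 1))"
    by (rule root_prod_update[OF assms(1) add.hyps]) simp
  then have W': "root_prod U (c(u := Suc (c u))) = [:- u, 1:] * W"
    by (simp only: W_def power_one_right fun_upd_upd fun_upd_same diff_Suc_1 fun_upd_triv)
  have "[:- u, 1:] dvd P * Q" using add.prems(1) W' by (metis dvd_mult_left)
  then have "poly (P * Q) u = 0" by (simp only: poly_eq_0_iff_dvd)
  then have "poly P u = 0" using add.prems(2)[of u] add.hyps by simp
  then obtain P1 where P1: "P = [:- u, 1:] * P1" unfolding poly_eq_0_iff_dvd by (elim dvdE)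
  have "[:- u, 1:] * W dvd [:- u, 1:] * (P1 * Q)"
    using add.prems(1) unfolding W' P1 by (simp only: mult.assoc)
  moreover have "[:- u, 1:] \<noteq> 0" by simp
  ultimately have "W dvd P1 * Q" by (simp only: dvd_mult_cancel_left) simp
  moreover have "poly Q v \<noteq> 0" if "v \<in> U" "c v > 0" for v
    using add.prems(2)[of v] that by auto
  ultimately have "W dvd P1" using add.IH unfolding W_def by blast
  then show ?case unfolding W' P1 by (rule mult_dvd_mono[OF dvd_refl])
qed

text \<open>Linear over the base field, not multiplicative. Applied to coefficients it commutes with
  multiplication by polynomials over the base field, and so preserves divisibility conditions that
  are linear in the unknown polynomials.\<close>

lemma exists_linear_retraction:
  obtains \<phi> :: "'k::field alg_closure \<Rightarrow> 'k"
  where "\<And>x y. \<phi> (x + y) = \<phi> x + \<phi> y" "\<And>c x. \<phi> (to_ac c * x) = c * \<phi> x" "\<And>c. \<phi> (to_ac c) = c"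
proof -
  interpret vs1: vector_space "(*) :: 'k \<Rightarrow> 'k \<Rightarrow> 'k"
    by unfold_locales (simp_all add: algebra_simps)
  interpret vs2: vector_space "\<lambda>(c::'k) (x::'k alg_closure). to_ac c * x"
    by unfold_locales (simp_all add: algebra_simps)
  interpret vector_space_pair "(*) :: 'k \<Rightarrow> 'k \<Rightarrow> 'k" "\<lambda>(c::'k) (x::'k alg_closure). to_ac c * x" ..
  have "Vector_Spaces.linear (*) (\<lambda>(c::'k) (x::'k alg_closure). to_ac c * x) to_ac"
    by unfold_locales simp_all
  then obtain \<phi> where \<phi>: "Vector_Spaces.linear (\<lambda>(c::'k) (x::'k alg_closure). to_ac c * x) (*) \<phi>" "\<phi> \<circ> to_ac = id"
    using linear_injective_left_inverse[of to_ac] inj_to_ac by blast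
  interpret \<phi>: Vector_Spaces.linear "\<lambda>(c::'k) (x::'k alg_closure). to_ac c * x" "(*)" \<phi>
    by (rule \<phi>(1))
  show ?thesis
    using that[of \<phi>] \<phi>.add \<phi>.scale \<phi>(2) by (metis comp_apply id_apply)
qed

text \<open>The pairs \<open>(A, B)\<close> with \<open>W\<close> dividing \<open>A + B y\<close>, where \<open>y\<^sup>2\<close> is \<open>g\<close> modulo \<open>W\<close>, form a space defined over
  the base field. With a leading coefficient normalised to \<open>1\<close>, the one whose norm has the degree of \<open>W\<close>
  is unique, hence fixed by a linear retraction onto the base field.\<close>

theorem norm_equation_descends:
  fixes g :: "'k::field_char_0 poly" and A B :: "'k alg_closure poly"
  assumes g: "odd (degree g)" and U: "finite U" and e: "\<And>u. u \<in> U \<Longrightarrow> e u ^ 2 = poly g u" "\<And>u. u \<in> U \<Longrightarrow> e u \<noteq> 0"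
    and l: "l \<noteq> 0" and eq: "A\<^sup>2 - map_poly to_ac g * B\<^sup>2 = smult l (map_poly to_ac (root_prod U c))"
    and vanish: "\<And>u. u \<in> U \<Longrightarrow> c u > 0 \<Longrightarrow> poly A (to_ac u) + poly B (to_ac u) * to_ac (e u) = 0"
    and nonvanish: "\<And>u. u \<in> U \<Longrightarrow> c u > 0 \<Longrightarrow> poly A (to_ac u) - poly B (to_ac u) * to_ac (e u) \<noteq> 0"
  obtains A0 B0 l0 where "l0 \<noteq> 0" "A0\<^sup>2 - g * B0\<^sup>2 = smult l0 (root_prod U c)"
    "\<And>u. u \<in> U \<Longrightarrow> c u > 0 \<Longrightarrow> poly A0 u \<noteq> 0"
proof -
  let ?m = "map_poly to_ac"
  define W where "W = root_prod U c"
  have W0: "W \<noteq> 0" "lead_coeff W = 1" unfolding W_def by (rule root_prod_nonzero, rule lead_coeff_root_prod)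
  have odd: "odd (degree (?m g))" using g by (simp add: to_ac.degree_map_poly_hom)
  obtain y where y: "W dvd y\<^sup>2 - g" "\<And>u. u \<in> U \<Longrightarrow> c u > 0 \<Longrightarrow> poly y u = e u"
    using sqrt_mod_root_prod[OF U e, of c] unfolding W_def by blast
  have yW: "?m W dvd (?m y)\<^sup>2 - ?m g"
    using to_ac.map_poly_dvd[OF y(1)] by (simp add: to_ac.map_poly_diff to_ac.map_poly_pow)
  have norm_dvd: "?m W dvd P\<^sup>2 - ?m g * Q\<^sup>2" if "?m W dvd P + Q * ?m y" for P Q
  proof -
    have "P\<^sup>2 - ?m g * Q\<^sup>2 = (P + Q * ?m y) * (P - Q * ?m y) + Q\<^sup>2 * ((?m y)\<^sup>2 - ?m g)"
      by (simp add: algebra_simps power2_eq_square)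
    then show ?thesis using that yW by (metis dvd_add dvd_mult dvd_mult2)
  qed
  have AB: "A \<noteq> 0 \<or> B \<noteq> 0" using eq l W0 by (auto simp: W_def to_ac.map_poly_hom_eq_0_iff)
  have WAB: "?m W dvd A + B * ?m y"
  proof -
    have Wm: "?m W = root_prod (to_ac ` U) (\<lambda>z. c (inv_into UNIV to_ac z))"
      unfolding W_def by (rule to_ac.map_poly_root_prod[OF inj_to_ac])
    \<comment> \<open>Modulo W the norm factors in this way. By \<open>nonvanish\<close> the factor
      A - B y has no zero in common with W, so all of W divides A + B y.\<close>
    have "(A + B * ?m y) * (A - B * ?m y) = (A\<^sup>2 - ?m g * B\<^sup>2) - B\<^sup>2 * ((?m y)\<^sup>2 - ?m g)"
      by (simp add: algebra_simps power2_eq_square)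
    moreover have "?m W dvd A\<^sup>2 - ?m g * B\<^sup>2" unfolding eq W_def by (rule dvd_smult) simp
    ultimately have "?m W dvd (A + B * ?m y) * (A - B * ?m y)"
      using yW by (metis dvd_diff dvd_mult)
    then show ?thesis unfolding Wm
    proof (rule root_prod_dvd_cancel[rotated])
      show "finite (to_ac ` U)" using U by simp
      fix z assume "z \<in> to_ac ` U" "c (inv_into UNIV to_ac z) > 0"
      then obtain u where u: "z = to_ac u" "u \<in> U" "c u > 0" by (auto simp: inv_f_f[OF inj_to_ac])
      show "poly (A - B * ?m y) z \<noteq> 0"
        using nonvanish[OF u(2,3)] y(2)[OF u(2,3)] by (simp add: u(1) to_ac.poly_map_poly_hom)
    qed
  qed
  have degW: "degree (A\<^sup>2 - ?m g * B\<^sup>2) = degree W"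
    unfolding eq using l by (simp add: W_def to_ac.degree_map_poly_hom)
  \<comment> \<open>The leading coefficient of A or of B, according to which of A^2 and g B^2
    attains the degree of the norm; the parity of \<open>degree W\<close> decides. Division by s
    makes it 1, a value that \<phi> fixes.\<close>
  define s where "s = (if even (degree W) then lead_coeff A else lead_coeff B)"
  have s0: "s \<noteq> 0"
    using degree_norm(4,5)[OF odd AB] unfolding degW s_def by auto
  define A1 B1 where "A1 = smult (1 / s) A" and "B1 = smult (1 / s) B"
  have AB1: "A1 \<noteq> 0 \<or> B1 \<noteq> 0" using AB s0 by (auto simp: A1_def B1_def)
  have norm1: "A1\<^sup>2 - ?m g * B1\<^sup>2 = smult (l / s\<^sup>2) (?m W)"
  proof -
    have "A1\<^sup>2 - ?m g * B1\<^sup>2 = smult (1 / s\<^sup>2) (A\<^sup>2 - ?m g * B\<^sup>2)"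
      by (simp add: A1_def B1_def power2_eq_square smult_diff_right)
    then show ?thesis by (simp add: eq W_def)
  qed
  have W1: "?m W dvd A1 + B1 * ?m y"
  proof -
    have "A1 + B1 * ?m y = smult (1 / s) (A + B * ?m y)"
      by (simp add: A1_def B1_def smult_add_right)
    then show ?thesis using WAB by (metis dvd_smult)
  qed
  have degW1: "degree (A1\<^sup>2 - ?m g * B1\<^sup>2) = degree W"
    unfolding norm1 using l s0 by (simp add: to_ac.degree_map_poly_hom)
  obtain \<phi> :: "'k alg_closure \<Rightarrow> 'k" where \<phi>: "\<And>x y. \<phi> (x + y) = \<phi> x + \<phi> y"
    "\<And>c x. \<phi> (to_ac c * x) = c * \<phi> x" "\<And>c. \<phi> (to_ac c) = c"
    using exists_linear_retraction by blast
  have \<phi>0: "\<phi> 0 = 0" using \<phi>(3)[of 0] by simp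
  have \<phi>1: "\<phi> 1 = 1" using \<phi>(3)[of 1] by simp
  have \<phi>sum: "\<phi> (sum f I) = (\<Sum>i\<in>I. \<phi> (f i))" for f and I :: "nat set"
    by (induction I rule: infinite_finite_induct) (simp_all add: \<phi>0 \<phi>(1))
  have \<phi>plus: "map_poly \<phi> (P + Q) = map_poly \<phi> P + map_poly \<phi> Q" for P Q
    by (rule poly_eqI) (simp add: coeff_map_poly \<phi>0 \<phi>(1))
  have \<phi>mult_right: "\<phi> (x * to_ac c) = \<phi> x * c" for x c
    using \<phi>(2)[of c x] by (simp only: mult.commute)
  have \<phi>mult: "map_poly \<phi> (P * ?m q) = map_poly \<phi> P * q" for P q
    by (rule poly_eqI) (simp add: coeff_map_poly coeff_mult \<phi>0 \<phi>sum \<phi>mult_right)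
  define A0 B0 where "A0 = map_poly \<phi> A1" and "B0 = map_poly \<phi> B1"
  obtain Q where "A1 + B1 * ?m y = Q * ?m W" using W1 by (metis dvdE mult.commute)
  then have "map_poly \<phi> (A1 + B1 * ?m y) = map_poly \<phi> (Q * ?m W)" by simp
  then have "A0 + B0 * y = map_poly \<phi> Q * W" by (simp only: \<phi>plus \<phi>mult A0_def B0_def)
  then have "?m A0 + ?m B0 * ?m y = ?m (map_poly \<phi> Q) * ?m W"
    by (metis to_ac.map_poly_plus to_ac.map_poly_times)
  then have W2: "?m W dvd ?m A0 + ?m B0 * ?m y" by simp
  \<comment> \<open>Both pairs have the coefficient 1 at the normalised place. Their difference, if
    nonzero, would have a norm of smaller degree than W that is still divisible by W.\<close>
  define A2 B2 where "A2 = A1 - ?m A0" and "B2 = B1 - ?m B0"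
  have "A2 + B2 * ?m y = (A1 + B1 * ?m y) - (?m A0 + ?m B0 * ?m y)"
    by (simp add: A2_def B2_def algebra_simps)
  then have "?m W dvd A2 + B2 * ?m y" using W1 W2 by (metis dvd_diff)
  then have W3: "?m W dvd A2\<^sup>2 - ?m g * B2\<^sup>2" by (rule norm_dvd)
  have degA2: "degree A2 \<le> degree A1"
    unfolding A2_def A0_def
    by (rule degree_diff_le) (auto intro!: degree_le simp: coeff_map_poly \<phi>0 coeff_eq_0)
  have degB2: "degree B2 \<le> degree B1"
    unfolding B2_def B0_def
    by (rule degree_diff_le) (auto intro!: degree_le simp: coeff_map_poly \<phi>0 coeff_eq_0)
  have "A2 = 0 \<and> B2 = 0"
  proof (rule ccontr)
    assume "\<not> ?thesis"
    then have AB2: "A2 \<noteq> 0 \<or> B2 \<noteq> 0" by blast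
    note n2 = degree_norm[OF odd AB2]
    note n1 = degree_norm[OF odd AB1]
    have "degree W \<le> degree (A2\<^sup>2 - ?m g * B2\<^sup>2)"
      using dvd_imp_degree_le[OF W3 n2(1)] by (simp add: to_ac.degree_map_poly_hom)
    moreover have "degree (A2\<^sup>2 - ?m g * B2\<^sup>2) < degree W"
    proof (cases "even (degree W)")
      case True
      then have "degree W = 2 * degree A1" "A1 \<noteq> 0" using n1(4) degW1 by auto
      have "coeff A1 (degree A1) = 1"
        using True s0 by (simp add: A1_def s_def)
      then have c: "coeff A2 (degree A1) = 0" by (simp add: A2_def A0_def coeff_map_poly \<phi>0 \<phi>1)
      have dA: "degree A2 < degree A1" if "A2 \<noteq> 0"
        using that c degA2 by (metis le_neq_implies_less leading_coeff_0_iff)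
      have dB: "2 * degree B2 + degree (?m g) < degree W" if "B2 \<noteq> 0"
      proof -
        have "B1 \<noteq> 0" using that by (auto simp: B2_def B0_def)
        then have "2 * degree B1 + degree (?m g) \<le> degree W" using n1(3) degW1 by simp
        moreover have "2 * degree B1 + degree (?m g) \<noteq> degree W" using True odd by (metis even_add even_mult_iff even_numeral)
        ultimately show ?thesis using degB2 by simp
      qed
      show ?thesis
        using n2(4,5) dA dB \<open>degree W = 2 * degree A1\<close> by (cases "even (degree (A2\<^sup>2 - ?m g * B2\<^sup>2))") auto
    next
      case False
      then have dW: "degree W = 2 * degree B1 + degree (?m g)" "B1 \<noteq> 0" using n1(5) degW1 by auto
      have "coeff B1 (degree B1) = 1"
        using False s0 by (simp add: B1_def s_def)
      then have c: "coeff B2 (degree B1) = 0" by (simp add: B2_def B0_def coeff_map_poly \<phi>0 \<phi>1)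
      have dB: "degree B2 < degree B1" if "B2 \<noteq> 0"
        using that c degB2 by (metis le_neq_implies_less leading_coeff_0_iff)
      have dA: "2 * degree A2 < degree W" if "A2 \<noteq> 0"
      proof -
        have "A1 \<noteq> 0" using that by (auto simp: A2_def A0_def)
        then have "2 * degree A1 \<le> degree W" using n1(2) degW1 by simp
        moreover have "2 * degree A1 \<noteq> degree W" using False by (metis even_mult_iff even_numeral)
        ultimately show ?thesis using degA2 by simp
      qed
      show ?thesis
        using n2(4,5) dA dB dW by (cases "even (degree (A2\<^sup>2 - ?m g * B2\<^sup>2))") auto
    qed
    ultimately show False by simp
  qed
  then have A1: "A1 = ?m A0" and B1: "B1 = ?m B0" by (auto simp: A2_def B2_def)
  define l0 where "l0 = lead_coeff (A0\<^sup>2 - g * B0\<^sup>2)"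
  have n0: "?m (A0\<^sup>2 - g * B0\<^sup>2) = smult (l / s\<^sup>2) (?m W)"
    using norm1 unfolding A1 B1 by (simp add: to_ac.map_poly_diff to_ac.map_poly_times to_ac.map_poly_pow)
  have "lead_coeff (?m (A0\<^sup>2 - g * B0\<^sup>2)) = to_ac l0"
    by (simp add: l0_def to_ac.degree_map_poly_hom coeff_map_poly)
  moreover have "lead_coeff (smult (l / s\<^sup>2) (?m W)) = l / s\<^sup>2"
    unfolding lead_coeff_smult using W0(2) by (simp add: to_ac.degree_map_poly_hom coeff_map_poly)
  ultimately have l0: "to_ac l0 = l / s\<^sup>2" using n0 by simp
  show ?thesis
  proof (rule that[of l0 A0 B0])
    show "l0 \<noteq> 0" using l0 l s0 by auto
    have "?m (A0\<^sup>2 - g * B0\<^sup>2) = ?m (smult l0 W)"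
      unfolding n0 to_ac.map_poly_smult' l0 ..
    then show "A0\<^sup>2 - g * B0\<^sup>2 = smult l0 (root_prod U c)"
      by (simp only: to_ac.map_poly_hom_inject W_def)
    fix u assume u: "u \<in> U" "c u > 0"
    show "poly A0 u \<noteq> 0"
    proof
      assume "poly A0 u = 0"
      then have "poly A1 (to_ac u) = 0" by (simp add: A1 to_ac.poly_map_poly_hom)
      then have "poly A (to_ac u) = 0" using s0 by (simp add: A1_def)
      then show False using vanish[OF u] nonvanish[OF u] by simp
    qed
  qed
qed

section \<open>Reduction of algebraic integers modulo a prime\<close>

lemma ring_of_integers_simps:
  "carrier ring_of_integers = {x. algebraic_int x}"
  "x \<otimes>\<^bsub>ring_of_integers\<^esub> y = x * y" "x \<oplus>\<^bsub>ring_of_integers\<^esub> y = x + y"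
  "\<zero>\<^bsub>ring_of_integers\<^esub> = 0" "\<one>\<^bsub>ring_of_integers\<^esub> = 1"
  by (simp_all add: ring_of_integers_def ring_of_type_algebra_def)

section \<open>Nonzero prime ideals of the ring of integers are maximal\<close>

locale integer_prime =
  fixes \<pp> :: "'k::field_char_0 set"
  assumes prime: "primeideal \<pp> ring_of_integers" and nonzero: "\<pp> \<noteq> {0}"
begin

sublocale P: primeideal \<pp> ring_of_integers
  by (rule prime)

sublocale subring_ideal "{x. algebraic_int x}" \<pp>
proof
  note s = ring_of_integers_simps
  show "\<pp> \<subseteq> {x. algebraic_int x}" using P.a_subset by (simp add: s)
  show "0 \<in> \<pp>" using additive_subgroup.zero_closed[OF P.is_additive_subgroup] by (simp add: s)
  show "1 \<notin> \<pp>"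
  proof
    assume "1 \<in> \<pp>"
    then have "carrier ring_of_integers \<subseteq> \<pp>"
      using P.I_l_closed[of 1] by (auto simp: s)
    then show False using P.I_notcarr P.a_subset by blast
  qed
  fix x y
  show "x + y \<in> \<pp>" if "x \<in> \<pp>" "y \<in> \<pp>" using additive_subgroup.a_closed[OF P.is_additive_subgroup that] by (simp add: s)
  show "x * y \<in> \<pp>" if "x \<in> {x. algebraic_int x}" "y \<in> \<pp>" using P.I_l_closed[of y x] that by (simp add: s)
  show "x * y \<in> {x. algebraic_int x}" if "x \<in> {x. algebraic_int x}" "y \<in> {x. algebraic_int x}"
    using P.m_closed[of x y] that by (simp add: s)
  show "x - y \<in> {x. algebraic_int x}" if "x \<in> {x. algebraic_int x}" "y \<in> {x. algebraic_int x}"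
    using P.a_closed P.add.m_closed[of x "- y"] that by (simp add: s algebraic_int_minus)
qed simp

lemma int_in: "of_int a \<in> {x. algebraic_int x}"
  by simp

lemma poly_int_in:
  fixes q :: "'k poly"
  assumes "\<forall>i. coeff q i \<in> \<int>" "algebraic_int x"
  shows "algebraic_int (poly q x)"
proof -
  have "coeffs_in {x. algebraic_int x} q"
    using assms(1) unfolding coeffs_in_def by (metis Ints_cases algebraic_int_of_int mem_Collect_eq)
  then show ?thesis using poly_in[of q x] assms(2) by simp
qed

text \<open>Minimality of the degree keeps the constant coefficient of the relation outside the prime \<open>J\<close>.\<close>

lemma integral_relation:
  fixes J :: "'k set"
  assumes J: "J \<subseteq> {x. algebraic_int x}" "0 \<in> J" "1 \<notin> J"
      "\<And>a b. algebraic_int a \<Longrightarrow> algebraic_int b \<Longrightarrow> a * b \<in> J \<Longrightarrow> a \<in> J \<or> b \<in> J"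
    and x: "algebraic_int x" "x \<notin> J"
    and add: "\<And>a b. a \<in> J \<Longrightarrow> b \<in> J \<Longrightarrow> b - a \<in> J"
  obtains c q where "\<forall>i. coeff q i \<in> \<int>" "of_int c \<notin> J" "of_int c + x * poly q x \<in> J"
proof -
  define Q where "Q = (\<lambda>q. lead_coeff q = 1 \<and> (\<forall>i. coeff q i \<in> \<int>) \<and> poly q x \<in> J)"
  from x(1) obtain q0 where "lead_coeff q0 = 1" "\<forall>i. coeff q0 i \<in> \<int>" "poly q0 x = 0"
    by (auto elim: algebraic_int.cases)
  then have "Q q0" using J(2) by (simp add: Q_def)
  then obtain q where q: "Q q" and min: "\<And>r. Q r \<Longrightarrow> degree q \<le> degree r"
    using ex_has_least_nat[of Q q0 degree] by blast
  have dq: "degree q > 0"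
  proof (rule ccontr)
    assume "\<not> degree q > 0"
    then obtain a where "q = [:a:]" by (meson degree_eq_zeroE neq0_conv)
    then show False using q J(3) by (auto simp: Q_def)
  qed
  obtain a r where qr: "q = pCons a r" by (cases q)
  have r0: "r \<noteq> 0" using dq qr by auto
  have coeffs: "coeff r i \<in> \<int>" for i using q qr by (metis Q_def coeff_pCons_Suc)
  have "a \<in> \<int>" using q qr by (metis Q_def coeff_pCons_0)
  then obtain c where c: "a = of_int c" by (elim Ints_cases)
  have rel: "of_int c + x * poly r x \<in> J" using q by (simp add: Q_def qr c)
  have "of_int c \<notin> J"
  proof
    assume "of_int c \<in> J"
    from add[OF this rel] have "x * poly r x \<in> J" by simp
    then have "poly r x \<in> J" using J(4)[OF x(1) poly_int_in] coeffs x by blast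
    then have "Q r" using q coeffs r0 by (simp add: Q_def qr)
    then show False using min[of r] r0 by (simp add: qr)
  qed
  then show ?thesis using that coeffs rel by blast
qed

text \<open>Taking {0} for the prime in \<open>integral_relation\<close>, with a nonzero x in
  \<open>\<pp>\<close>, gives a nonzero integer that is a multiple of x and hence lies in
  \<open>\<pp>\<close>. The least positive one will play the role of the residue
  characteristic.\<close>

lemma exists_int_mem:
  obtains m where "m > 0" "of_int m \<in> \<pp>" "\<And>m'. m' > 0 \<Longrightarrow> of_int m' \<in> \<pp> \<Longrightarrow> m \<le> m'"
proof -
  obtain x where x: "x \<in> \<pp>" "x \<noteq> 0" using nonzero ideal_zero by blast
  have ax: "algebraic_int x" using ideal_in[OF x(1)] by simp
  have "\<exists>q c. (\<forall>i. coeff q i \<in> \<int>) \<and> of_int c \<notin> {0::'k} \<and> of_int c + x * poly q x \<in> {0}"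
    by (rule integral_relation[of "{0}" x]) (use ax x(2) in auto)
  then obtain q c where q: "\<forall>i. coeff q i \<in> \<int>" "of_int c \<noteq> (0 :: 'k)" "of_int c + x * poly q x = 0"
    by auto
  have "x * poly q x \<in> \<pp>" using poly_int_in[OF q(1) ax] x(1) by (intro ideal_mult_right) auto
  then have "- (x * poly q x) \<in> \<pp>" by (rule ideal_uminus)
  then have c: "of_int c \<in> \<pp>" using q(3) by (metis eq_neg_iff_add_eq_0)
  then have c': "of_int \<bar>c\<bar> \<in> \<pp>" using ideal_uminus[OF c] by (cases "c \<ge> 0") auto
  define R where "R = (\<lambda>k::nat. k > 0 \<and> of_int (int k) \<in> \<pp>)"
  have "c \<noteq> 0" using q(2) by auto
  then have "R (nat \<bar>c\<bar>)" using c' by (simp add: R_def)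
  then have least1: "R (LEAST k. R k)" by (rule LeastI)
  have least2: "(LEAST k. R k) \<le> k" if "R k" for k using that by (rule Least_le)
  show ?thesis
  proof (rule that[of "int (LEAST k. R k)"])
    show "int (LEAST k. R k) > 0" "of_int (int (LEAST k. R k)) \<in> \<pp>"
      using least1 by (auto simp: R_def)
    fix m' :: int assume "m' > 0" "of_int m' \<in> \<pp>"
    then have "R (nat m')" by (simp add: R_def)
    from least2[OF this] show "int (LEAST k. R k) \<le> m'" using \<open>m' > 0\<close> by simp
  qed
qed

text \<open>Let h = gcd c m and m = h k, so that h or k lies in \<open>\<pp>\<close>. It cannot be
  h, of which c is a multiple; and k in \<open>\<pp>\<close> forces h = 1 by the minimality of m.
  Bezout's identity then yields the inverse.\<close>

lemma int_inverse_mod: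
  assumes "of_int c \<notin> \<pp>"
  obtains b :: int where "of_int (b * c - 1) \<in> \<pp>"
proof -
  obtain m where m: "m > 0" "of_int m \<in> \<pp>" "\<And>m'. m' > 0 \<Longrightarrow> of_int m' \<in> \<pp> \<Longrightarrow> m \<le> m'"
    using exists_int_mem by blast
  define h where "h = gcd c m"
  have hpos: "h > 0" using m(1) by (simp add: h_def)
  obtain s t where st: "s * c + t * m = h" unfolding h_def using bezout_int by blast
  obtain k where k: "m = h * k" unfolding h_def by (metis dvdE gcd_dvd2)
  have kpos: "k > 0" using m(1) hpos k by (metis zero_less_mult_pos)
  have "of_int h * of_int k \<in> \<pp>" using m(2) k by simp
  then have "(of_int h :: 'k) \<in> \<pp> \<or> (of_int k :: 'k) \<in> \<pp>"
    using P.I_prime[of "of_int h" "of_int k"] by (simp add: ring_of_integers_simps)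
  then have "h = 1"
  proof
    assume "(of_int h :: 'k) \<in> \<pp>"
    then have "of_int (c div h) * (of_int h :: 'k) \<in> \<pp>" by (intro ideal_mult) auto
    moreover have "c div h * h = c" by (simp add: h_def)
    ultimately show ?thesis using assms by (metis of_int_mult)
  next
    assume "(of_int k :: 'k) \<in> \<pp>"
    then have "h * k \<le> k" using m(3)[OF kpos] k by simp
    then show ?thesis using hpos kpos by simp
  qed
  then have "s * c - 1 = - t * m" using st by simp
  then have "of_int (s * c - 1) = (of_int (- t) * of_int m :: 'k)" by (metis of_int_mult)
  then have "(of_int (s * c - 1) :: 'k) \<in> \<pp>"
    using ideal_mult[OF int_in m(2)] by metis
  then show ?thesis by (rule that)
qed

text \<open>Being integral, x divides modulo \<open>\<pp>\<close> an integer c outside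
  \<open>\<pp>\<close>, and such integers are already known to be invertible modulo
  \<open>\<pp>\<close>.\<close>

lemma inverse_mod:
  assumes "algebraic_int x" "x \<notin> \<pp>"
  obtains y where "algebraic_int y" "x * y - 1 \<in> \<pp>"
proof -
  have "\<exists>q c. (\<forall>i. coeff q i \<in> \<int>) \<and> of_int c \<notin> \<pp> \<and> of_int c + x * poly q x \<in> \<pp>"
    using P.I_prime
    by (rule_tac integral_relation[of \<pp> x])
       (use assms ideal_in ideal_zero ideal_proper ideal_diff in \<open>auto simp: ring_of_integers_simps\<close>)
  then obtain q c where q: "\<forall>i. coeff q i \<in> \<int>" "of_int c \<notin> \<pp>" "of_int c + x * poly q x \<in> \<pp>"
    by auto
  obtain b where b: "of_int (b * c - 1) \<in> \<pp>" using int_inverse_mod[OF q(2)] .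
  define y where "y = of_int (- b) * poly q x"
  have y: "algebraic_int y"
    using mult_in[of "of_int (- b)" "poly q x"] poly_int_in[OF q(1) assms(1)] by (simp add: y_def)
  have "x * y - 1 = of_int (b * c - 1) - of_int b * (of_int c + x * poly q x)"
    by (simp add: y_def algebra_simps)
  also have "\<dots> \<in> \<pp>" by (intro ideal_diff b ideal_mult int_in q(3))
  finally show ?thesis using that y by blast
qed

lemma maximal: "maximalideal \<pp> ring_of_integers"
proof (rule maximalidealI)
  show "ideal \<pp> ring_of_integers" by (rule P.is_ideal)
  show "carrier ring_of_integers \<noteq> \<pp>" by (rule P.I_notcarr)
  fix J assume J: "ideal J ring_of_integers" "\<pp> \<subseteq> J" "J \<subseteq> carrier ring_of_integers"
  interpret J: ideal J ring_of_integers by (rule J(1))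
  show "J = \<pp> \<or> J = carrier ring_of_integers"
  proof (rule disjCI)
    assume "J \<noteq> carrier ring_of_integers"
    have "x \<in> \<pp>" if "x \<in> J" for x
    proof (rule ccontr)
      assume "x \<notin> \<pp>"
      have ax: "algebraic_int x" using J(3) that by (auto simp: ring_of_integers_simps)
      obtain y where y: "algebraic_int y" "x * y - 1 \<in> \<pp>" using inverse_mod[OF ax \<open>x \<notin> \<pp>\<close>] .
      have "x * y \<in> J" using J.I_r_closed[OF that, of y] y(1) by (simp add: ring_of_integers_simps)
      moreover have "- (x * y - 1) \<in> J" using ideal_uminus[OF y(2)] J(2) by blast
      ultimately have "x * y + - (x * y - 1) \<in> J"
        using additive_subgroup.a_closed[OF J.is_additive_subgroup] by (simp only: ring_of_integers_simps)
      then have "1 \<in> J" by simp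
      then have "carrier ring_of_integers \<subseteq> J"
        using J.I_l_closed[of 1] by (auto simp: ring_of_integers_simps)
      then show False using J(3) \<open>J \<noteq> carrier ring_of_integers\<close> by blast
    qed
    then show "J = \<pp>" using J(2) by blast
  qed
qed

sublocale k: field "ring_of_integers Quot \<pp>"
  by (rule maximalideal.quotient_is_field[OF maximal P.is_cring])

sublocale L: field "residue_closure \<pp>"
  unfolding residue_closure_def by (rule algebraic_closure.axioms(1)[OF k.alg_closureE(1)])

section \<open>Roots of reduced polynomials in the algebraic closure of the residue field\<close>

definition red :: "'k \<Rightarrow> ('k set list \<times> nat) multiset \<Rightarrow> 'k set" where
  "red c = k.indexed_const (\<pp> +>\<^bsub>ring_of_integers\<^esub> c)"

lemma red_hom: "red \<in> Ring.ring_hom ring_of_integers (residue_closure \<pp>)"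
  unfolding red_def residue_closure_def
  using ring_hom_trans[OF P.rcos_ring_hom k.alg_closureE(2)] by (simp add: comp_def)

lemma red_closed: "algebraic_int a \<Longrightarrow> red a \<in> carrier (residue_closure \<pp>)"
  and red_add: "algebraic_int a \<Longrightarrow> algebraic_int b \<Longrightarrow> red (a + b) = red a \<oplus>\<^bsub>residue_closure \<pp>\<^esub> red b"
  and red_mult: "algebraic_int a \<Longrightarrow> algebraic_int b \<Longrightarrow> red (a * b) = red a \<otimes>\<^bsub>residue_closure \<pp>\<^esub> red b"
  and red_1: "red 1 = \<one>\<^bsub>residue_closure \<pp>\<^esub>"
  using ring_hom_memE[OF red_hom] by (simp_all add: ring_of_integers_simps)

lemma red_0: "red 0 = \<zero>\<^bsub>residue_closure \<pp>\<^esub>"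
  using Ring.ring_hom_zero[OF red_hom P.ring_axioms L.ring_axioms] by (simp add: ring_of_integers_simps)

lemma red_uminus: "algebraic_int a \<Longrightarrow> red (- a) = \<ominus>\<^bsub>residue_closure \<pp>\<^esub> red a"
  using red_add[of "- a" a] red_0 L.minus_equality[of "red (- a)" "red a"]
  by (simp add: red_closed algebraic_int_minus)

lemma red_eq_iff:
  assumes "algebraic_int a" "algebraic_int b"
  shows "red a = red b \<longleftrightarrow> a - b \<in> \<pp>"
proof -
  have "red a = red b \<longleftrightarrow> \<pp> +>\<^bsub>ring_of_integers\<^esub> a = \<pp> +>\<^bsub>ring_of_integers\<^esub> b"
    unfolding red_def by simp
  also have "\<dots> \<longleftrightarrow> a - b \<in> \<pp>"
  proof
    assume "\<pp> +>\<^bsub>ring_of_integers\<^esub> a = \<pp> +>\<^bsub>ring_of_integers\<^esub> b"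
    moreover have "a \<in> \<pp> +>\<^bsub>ring_of_integers\<^esub> a"
      using P.a_rcos_self[of a] assms by (simp add: ring_of_integers_simps)
    ultimately obtain h where "h \<in> \<pp>" "a = h + b"
      by (auto simp: a_r_coset_def' ring_of_integers_simps)
    then show "a - b \<in> \<pp>" by simp
  next
    assume *: "a - b \<in> \<pp>"
    have "\<pp> +>\<^bsub>ring_of_integers\<^esub> a = {h + a | h. h \<in> \<pp>}" "\<pp> +>\<^bsub>ring_of_integers\<^esub> b = {h + b | h. h \<in> \<pp>}"
      by (auto simp: a_r_coset_def' ring_of_integers_simps)
    moreover have "{h + a | h. h \<in> \<pp>} = {h + b | h. h \<in> \<pp>}"
    proof (intro subset_antisym subsetI)
      fix z assume "z \<in> {h + a | h. h \<in> \<pp>}"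
      then obtain h where "h \<in> \<pp>" "z = h + a" by blast
      then have "h + (a - b) \<in> \<pp>" "z = (h + (a - b)) + b" using ideal_add[OF _ *] by simp_all
      then show "z \<in> {h + b | h. h \<in> \<pp>}" by blast
    next
      fix z assume "z \<in> {h + b | h. h \<in> \<pp>}"
      then obtain h where "h \<in> \<pp>" "z = h + b" by blast
      then have "h - (a - b) \<in> \<pp>" "z = (h - (a - b)) + a" using ideal_diff[OF _ *] by simp_all
      then show "z \<in> {h + a | h. h \<in> \<pp>}" by blast
    qed
    ultimately show "\<pp> +>\<^bsub>ring_of_integers\<^esub> a = \<pp> +>\<^bsub>ring_of_integers\<^esub> b" by simp
  qed
  finally show ?thesis .
qed

definition eval_red :: "'k poly \<Rightarrow> (('k set list \<times> nat) multiset \<Rightarrow> 'k set) \<Rightarrow> ('k set list \<times> nat) multiset \<Rightarrow> 'k set" where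
  "eval_red q x = L.eval (reduce_poly \<pp> q) x"

context
  fixes x assumes x: "x \<in> carrier (residue_closure \<pp>)"
begin

lemma eval_red_0: "eval_red 0 x = \<zero>\<^bsub>residue_closure \<pp>\<^esub>"
  by (simp add: eval_red_def reduce_poly_def)

lemma coeffs_in_pCons_integers: "coeffs_in {x. algebraic_int x} (pCons (a :: 'k) q) \<longleftrightarrow> algebraic_int a \<and> coeffs_in {x. algebraic_int x} q"
  by (simp add: coeffs_in_pCons)

text \<open>Horner's rule. Coefficient lists in HOL-Algebra start with the leading coefficient, so
  \<open>pCons\<close> appends at the end; the zero polynomial is treated apart because
  \<open>pCons 0 0\<close> is 0 and has the empty list.\<close>

lemma eval_red_pCons:
  assumes "algebraic_int a" "coeffs_in {x. algebraic_int x} q"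
  shows "eval_red (pCons a q) x = eval_red q x \<otimes>\<^bsub>residue_closure \<pp>\<^esub> x \<oplus>\<^bsub>residue_closure \<pp>\<^esub> red a"
proof (cases "a = 0 \<and> q = 0")
  case True
  then show ?thesis using x by (simp add: eval_red_0 red_0)
next
  case False
  then have "reduce_poly \<pp> (pCons a q) = reduce_poly \<pp> q @ [red a]"
    by (auto simp: reduce_poly_def red_def cCons_def)
  moreover have "algebraic_int z" if z: "z \<in> set (coeffs q)" for z
  proof -
    obtain i where "i < length (coeffs q)" "z = coeffs q ! i"
      using z by (auto simp: in_set_conv_nth)
    then have "z = coeff q i" by (simp add: nth_default_nth flip: nth_default_coeffs_eq)
    then show ?thesis using coeffs_inD[OF assms(2), of i] by simp
  qed
  then have "set (reduce_poly \<pp> q) \<subseteq> carrier (residue_closure \<pp>)"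
    using red_closed by (auto simp: reduce_poly_def red_def [symmetric])
  ultimately show ?thesis
    using L.eval_append_aux[OF _ red_closed[OF assms(1)] x] by (simp add: eval_red_def)
qed

lemma eval_red_closed:
  "coeffs_in {x. algebraic_int x} q \<Longrightarrow> eval_red q x \<in> carrier (residue_closure \<pp>)"
proof (induction q)
  case (pCons a q)
  then show ?case using x by (simp add: coeffs_in_pCons_integers eval_red_pCons red_closed)
qed (simp add: eval_red_0)

lemma eval_red_add:
  "coeffs_in {x. algebraic_int x} p \<Longrightarrow> coeffs_in {x. algebraic_int x} q \<Longrightarrow>
     eval_red (p + q) x = eval_red p x \<oplus>\<^bsub>residue_closure \<pp>\<^esub> eval_red q x"
proof (induction p q rule: poly_induct2)
  case (pCons a p b q)
  let ?L = "residue_closure \<pp>"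
  have c: "algebraic_int a" "algebraic_int b" "coeffs_in {x. algebraic_int x} p" "coeffs_in {x. algebraic_int x} q"
    using pCons.prems by (simp_all add: coeffs_in_pCons_integers)
  have ab: "algebraic_int (a + b)" using add_in[of a b] c by simp
  note cl = red_closed[OF c(1)] red_closed[OF c(2)] eval_red_closed[OF c(3)] eval_red_closed[OF c(4)] x
  have "eval_red (pCons a p + pCons b q) x
      = (eval_red p x \<oplus>\<^bsub>?L\<^esub> eval_red q x) \<otimes>\<^bsub>?L\<^esub> x \<oplus>\<^bsub>?L\<^esub> (red a \<oplus>\<^bsub>?L\<^esub> red b)"
    using pCons.IH c ab coeffs_in_add[OF c(3,4)] by (simp add: eval_red_pCons red_add)
  also have "\<dots> = (eval_red p x \<otimes>\<^bsub>?L\<^esub> x \<oplus>\<^bsub>?L\<^esub> red a) \<oplus>\<^bsub>?L\<^esub> (eval_red q x \<otimes>\<^bsub>?L\<^esub> x \<oplus>\<^bsub>?L\<^esub> red b)"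
    using cl by (simp add: L.l_distr L.a_ac)
  finally show ?case using c by (simp add: eval_red_pCons)
qed (simp add: eval_red_0)

lemma eval_red_smult:
  "algebraic_int c \<Longrightarrow> coeffs_in {x. algebraic_int x} q \<Longrightarrow>
     eval_red (smult c q) x = red c \<otimes>\<^bsub>residue_closure \<pp>\<^esub> eval_red q x"
proof (induction q)
  case (pCons a q)
  let ?L = "residue_closure \<pp>"
  have c: "algebraic_int a" "coeffs_in {x. algebraic_int x} q" "algebraic_int (c * a)" "coeffs_in {x. algebraic_int x} (smult c q)"
    using pCons.prems mult_in[of c a] coeffs_in_smult[of c q] by (simp_all add: coeffs_in_pCons_integers)
  note cl = red_closed[OF c(1)] red_closed[OF pCons.prems(1)] eval_red_closed[OF c(2)] x
  have "eval_red (smult c (pCons a q)) x = (red c \<otimes>\<^bsub>?L\<^esub> eval_red q x) \<otimes>\<^bsub>?L\<^esub> x \<oplus>\<^bsub>?L\<^esub> red c \<otimes>\<^bsub>?L\<^esub> red a"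
    using pCons c by (simp add: eval_red_pCons red_mult)
  also have "\<dots> = red c \<otimes>\<^bsub>?L\<^esub> (eval_red q x \<otimes>\<^bsub>?L\<^esub> x \<oplus>\<^bsub>?L\<^esub> red a)"
    using cl by (simp add: L.r_distr L.m_assoc)
  finally show ?case using c by (simp add: eval_red_pCons)
qed (simp add: eval_red_0 red_closed)

lemma eval_red_linear:
  assumes "algebraic_int u" "coeffs_in {x. algebraic_int x} q"
  shows "eval_red ([:- u, 1:] * q) x = (x \<ominus>\<^bsub>residue_closure \<pp>\<^esub> red u) \<otimes>\<^bsub>residue_closure \<pp>\<^esub> eval_red q x"
proof -
  let ?L = "residue_closure \<pp>"
  have u: "algebraic_int (- u)" using assms(1) by (rule algebraic_int_minus)
  have c: "coeffs_in {x. algebraic_int x} (smult (- u) q)" "coeffs_in {x. algebraic_int x} (pCons 0 q)"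
    using assms u coeffs_in_smult[of "- u" q] by (simp_all add: coeffs_in_pCons_integers)
  note cl = red_closed[OF assms(1)] eval_red_closed[OF assms(2)] x
  have "[:- u, 1:] * q = smult (- u) q + pCons 0 q" by simp
  then have "eval_red ([:- u, 1:] * q) x = eval_red (smult (- u) q) x \<oplus>\<^bsub>?L\<^esub> eval_red (pCons 0 q) x"
    using eval_red_add[OF c] by (simp only:)
  also have "\<dots> = (\<ominus>\<^bsub>?L\<^esub> red u) \<otimes>\<^bsub>?L\<^esub> eval_red q x \<oplus>\<^bsub>?L\<^esub> eval_red q x \<otimes>\<^bsub>?L\<^esub> x"
    using assms u cl by (simp only: eval_red_smult eval_red_pCons red_uminus red_0 L.r_zero L.m_closed algebraic_int_0)
  also have "\<dots> = (x \<ominus>\<^bsub>?L\<^esub> red u) \<otimes>\<^bsub>?L\<^esub> eval_red q x"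
    using cl by (simp add: a_minus_def L.l_distr L.a_comm L.m_comm[of "eval_red q x" x])
  finally show ?thesis .
qed

lemma eval_red_prod_linear:
  assumes "\<forall>u\<in>set us. algebraic_int u" "eval_red (\<Prod>u\<leftarrow>us. [:- u, 1:]) x = \<zero>\<^bsub>residue_closure \<pp>\<^esub>"
  shows "x \<in> red ` set us"
  using assms
proof (induction us)
  case Nil
  have "eval_red [:1:] x = \<one>\<^bsub>residue_closure \<pp>\<^esub>"
    using x by (simp only: eval_red_pCons[of 1 0] coeffs_in_0 algebraic_int_1 eval_red_0 red_1 L.l_null L.l_zero L.one_closed)
  then show ?case using Nil L.one_not_zero by (simp flip: one_pCons)
next
  case (Cons u us)
  have c: "coeffs_in {x. algebraic_int x} (\<Prod>u\<leftarrow>us. [:- u, 1:])"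
    using Cons.prems(1)
    by (induction us) (auto simp del: mult_pCons_left intro!: coeffs_in_mult coeffs_in_1 simp: coeffs_in_pCons_integers algebraic_int_minus coeffs_in_0)
  have u: "algebraic_int u" using Cons.prems(1) by simp
  note cl = red_closed[OF u] eval_red_closed[OF c] x
  have "(x \<ominus>\<^bsub>residue_closure \<pp>\<^esub> red u) \<otimes>\<^bsub>residue_closure \<pp>\<^esub> eval_red (\<Prod>u\<leftarrow>us. [:- u, 1:]) x = \<zero>\<^bsub>residue_closure \<pp>\<^esub>"
    using Cons.prems(2) eval_red_linear[OF u c] by (simp del: mult_pCons_left)
  then have "x \<ominus>\<^bsub>residue_closure \<pp>\<^esub> red u = \<zero>\<^bsub>residue_closure \<pp>\<^esub> \<or> eval_red (\<Prod>u\<leftarrow>us. [:- u, 1:]) x = \<zero>\<^bsub>residue_closure \<pp>\<^esub>"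
    using cl by (simp add: L.integral_iff)
  then show ?case
    using Cons.IH Cons.prems(1) L.r_right_minus_eq[OF x red_closed[OF u]] by auto
qed

end

text \<open>On the residue closure g and f take the same values, so every root of the reduced g is
  the residue of a root of f. There are as many such roots as the length of \<open>us\<close>, and
  counting forces the residues to be pairwise different. The constant called \<open>d\<close> here
  will be the square of the given d.\<close>

theorem distinct_roots_mod_split:
  assumes f: "f = (\<Prod>u\<leftarrow>us. [:- u, 1:])" and us: "\<forall>u\<in>set us. algebraic_int u"
    and d: "d \<in> \<pp>" and g: "g = f + [:d:]" and deg: "degree g = length us"
    and dist: "distinct_roots_mod \<pp> g"
  shows "distinct us" and "\<And>u v. u \<in> set us \<Longrightarrow> v \<in> set us \<Longrightarrow> u \<noteq> v \<Longrightarrow> u - v \<notin> \<pp>"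
proof -
  have c: "coeffs_in {x. algebraic_int x} f"
    unfolding f using us
    by (induction us) (auto simp del: mult_pCons_left intro!: coeffs_in_mult coeffs_in_1 simp: coeffs_in_pCons algebraic_int_minus coeffs_in_0)
  have cd: "coeffs_in {x. algebraic_int x} [:d:]" using coeffs_in_const[OF ideal_in[OF d]] .
  have ad: "algebraic_int d" using ideal_in[OF d] by simp
  have "red d = \<zero>\<^bsub>residue_closure \<pp>\<^esub>" using red_eq_iff[OF ad, of 0] d by (simp add: red_0)
  then have "eval_red [:d:] x = \<zero>\<^bsub>residue_closure \<pp>\<^esub>" if "x \<in> carrier (residue_closure \<pp>)" for x
    using that by (simp add: eval_red_pCons[OF that ad coeffs_in_0] eval_red_0)
  then have eq_f: "eval_red g x = eval_red f x" if "x \<in> carrier (residue_closure \<pp>)" for x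
    unfolding g using that eval_red_add[OF that c cd] eval_red_closed[OF that c] by simp
  have roots: "{x. L.is_root (reduce_poly \<pp> g) x} \<subseteq> red ` set us"
  proof
    fix x assume "x \<in> {x. L.is_root (reduce_poly \<pp> g) x}"
    then have x: "x \<in> carrier (residue_closure \<pp>)" "eval_red g x = \<zero>\<^bsub>residue_closure \<pp>\<^esub>"
      by (simp_all add: L.is_root_def eval_red_def)
    then have "eval_red f x = \<zero>\<^bsub>residue_closure \<pp>\<^esub>" using eq_f by simp
    then show "x \<in> red ` set us" using eval_red_prod_linear[OF x(1) us] unfolding f by blast
  qed
  have "Polynomials.degree (reduce_poly \<pp> g) = degree g"
    by (simp add: reduce_poly_def degree_eq_length_coeffs)
  then have "length us = card {x. L.is_root (reduce_poly \<pp> g) x}"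
    using dist deg unfolding distinct_roots_mod_def by simp
  also have "\<dots> \<le> card (red ` set us)" using roots by (intro card_mono) auto
  finally have "length us \<le> card (red ` set us)" .
  moreover have "card (red ` set us) \<le> card (set us)" by (rule card_image_le) simp
  moreover have "card (set us) \<le> length us" by (rule card_length)
  ultimately have eq: "card (set us) = length us" "card (red ` set us) = card (set us)" by linarith+
  then show "distinct us" by (simp add: card_distinct)
  have "inj_on red (set us)" using eq(2) by (simp add: eq_card_imp_inj_on)
  then show "u - v \<notin> \<pp>" if "u \<in> set us" "v \<in> set us" "u \<noteq> v" for u v
    using red_eq_iff[of u v] us that by (metis inj_onD)
qed

end

section \<open>The function field\<close>

definition poly_fun :: "'a::field poly \<Rightarrow> 'a poly \<Rightarrow> 'a curve_fun" where
  "poly_fun A B = (to_fract A, to_fract B)"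

lemma const_fun_eq: "const_fun c = poly_fun [:c:] 0"
  and X_fun_eq: "X_fun = poly_fun [:0, 1:] 0"
  and Y_fun_eq: "Y_fun = poly_fun 0 1"
  by (simp_all add: const_fun_def X_fun_def Y_fun_def poly_fun_def to_fract_def flip: Zero_fract_def One_fract_def)

lemma poly_fun_0 [simp]: "poly_fun 0 0 = 0"
  by (simp add: poly_fun_def zero_prod_def)

lemma poly_fun_eq_iff: "poly_fun A B = poly_fun C D \<longleftrightarrow> A = C \<and> B = D"
  by (simp add: poly_fun_def)

lemma poly_fun_eq_0_iff: "poly_fun A B = 0 \<longleftrightarrow> A = 0 \<and> B = 0"
  using poly_fun_eq_iff[of A B 0 0] by simp

lemma poly_fun_add: "poly_fun A B + poly_fun C D = poly_fun (A + C) (B + D)"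
  and poly_fun_diff: "poly_fun A B - poly_fun C D = poly_fun (A - C) (B - D)"
  by (simp_all add: poly_fun_def)

lemma fract_pair_cases:
  fixes F :: "'a::field curve_fun"
  obtains A B C where "C \<noteq> 0" "F = (to_fract A / to_fract C, to_fract B / to_fract C)"
proof -
  obtain a b where F: "F = (a, b)" by (cases F)
  obtain A1 C1 where a: "a = Fraction_Field.Fract A1 C1" "C1 \<noteq> 0" by (cases a)
  obtain B1 C2 where b: "b = Fraction_Field.Fract B1 C2" "C2 \<noteq> 0" by (cases b)
  have "a = to_fract (A1 * C2) / to_fract (C1 * C2)" "b = to_fract (B1 * C1) / to_fract (C1 * C2)"
    using a b by (simp_all add: Fract_conv_to_fract)
  then show ?thesis using that[of "C1 * C2" "A1 * C2" "B1 * C1"] a(2) b(2) by (simp add: F)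
qed

locale odd_curve =
  fixes g :: "'a::field_char_0 poly"
  assumes odd_degree: "odd (degree g)"
begin

definition fmul :: "'a curve_fun \<Rightarrow> 'a curve_fun \<Rightarrow> 'a curve_fun" where
  "fmul F H = F \<otimes>\<^bsub>function_field g\<^esub> H"

lemma fmul_pair: "fmul (a, b) (c, e) = (a * c + b * e * to_fract g, a * e + b * c)"
  by (simp add: fmul_def function_field_def to_fract_def)

lemma fmul_commute: "fmul F H = fmul H F"
  by (cases F; cases H) (simp add: fmul_pair algebra_simps)

lemma fmul_assoc: "fmul (fmul F H) G = fmul F (fmul H G)"
  by (cases F; cases H; cases G) (simp add: fmul_pair algebra_simps)

lemma fmul_add_right: "fmul F (H + G) = fmul F H + fmul F G"
  by (cases F; cases H; cases G) (simp add: fmul_pair algebra_simps)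

lemma fmul_add_left: "fmul (H + G) F = fmul H F + fmul G F"
  by (cases F; cases H; cases G) (simp add: fmul_pair algebra_simps)

lemma fmul_diff_right: "fmul F (H - G) = fmul F H - fmul F G"
  by (cases F; cases H; cases G) (simp add: fmul_pair algebra_simps)

lemma fmul_one [simp]: "fmul (poly_fun 1 0) F = F" "fmul F (poly_fun 1 0) = F"
  by (cases F; simp add: fmul_pair poly_fun_def)+

lemma fmul_zero [simp]: "fmul 0 F = 0" "fmul F 0 = 0"
  by (cases F; simp add: fmul_pair zero_prod_def)+

lemma fmul_poly_fun: "fmul (poly_fun A B) (poly_fun C D) = poly_fun (A * C + B * D * g) (A * D + B * C)"
  by (simp add: poly_fun_def fmul_pair)

lemma fmul_poly_left: "fmul (poly_fun C 0) (a, b) = (to_fract C * a, to_fract C * b)"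
  by (simp add: poly_fun_def fmul_pair)

text \<open>The inverse of A + B Y is its conjugate divided by the norm, and the norm is nonzero
  because g has odd degree. This is what makes the function field a field.\<close>

lemma exists_fmul_inverse:
  assumes "F \<noteq> 0"
  obtains H where "fmul F H = poly_fun 1 0" "H \<noteq> 0"
proof -
  obtain A B C where C: "C \<noteq> 0" "F = (to_fract A / to_fract C, to_fract B / to_fract C)"
    using fract_pair_cases .
  have "A \<noteq> 0 \<or> B \<noteq> 0" using assms C by (auto simp: zero_prod_def)
  define N where "N = A\<^sup>2 - g * B\<^sup>2"
  have N: "N \<noteq> 0" unfolding N_def by (rule degree_norm(1)[OF odd_degree \<open>A \<noteq> 0 \<or> B \<noteq> 0\<close>])
  define H where "H = (to_fract (A * C) / to_fract N, - to_fract (B * C) / to_fract N)"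
  have "fmul F H = poly_fun 1 0"
    using N C(1)
    by (simp add: C(2) H_def fmul_pair poly_fun_def field_simps)
       (simp add: N_def power2_eq_square algebra_simps flip: to_fract_mult to_fract_add)
  moreover have "H \<noteq> 0"
    using calculation by (auto simp: poly_fun_eq_0_iff)
  ultimately show ?thesis by (rule that)
qed

lemma fmul_eq_0_iff: "fmul F H = 0 \<longleftrightarrow> F = 0 \<or> H = 0"
proof
  assume *: "fmul F H = 0"
  show "F = 0 \<or> H = 0"
  proof (rule disjCI)
    assume "H \<noteq> 0"
    then obtain G where G: "fmul H G = poly_fun 1 0" by (rule exists_fmul_inverse)
    have "F = fmul F (fmul H G)" by (simp add: G)
    also have "\<dots> = fmul (fmul F H) G" by (simp add: fmul_assoc)
    finally show "F = 0" by (simp add: *)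
  qed
qed auto

lemma curve_fun_cases:
  obtains A B C where "C \<noteq> 0" "fmul (poly_fun C 0) F = poly_fun A B"
proof -
  obtain A B C where C: "C \<noteq> 0" "F = (to_fract A / to_fract C, to_fract B / to_fract C)"
    using fract_pair_cases .
  then have "fmul (poly_fun C 0) F = poly_fun A B"
    by (simp add: fmul_poly_left) (simp add: poly_fun_def)
  then show ?thesis using that C(1) by blast
qed

end

section \<open>Arithmetic of discrete valuations of the function field\<close>

locale curve_valuation = odd_curve +
  fixes v :: "'a curve_fun \<Rightarrow> int"
  assumes valuation: "discrete_valuation g v"
begin

text \<open>Since \<open>v 0 = 0\<close> by convention, a lower bound on values has to admit the
  zero function separately. With this built in, the rules for sums and products hold without side
  conditions.\<close>

definition vge :: "int \<Rightarrow> 'a curve_fun \<Rightarrow> bool" where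
  "vge k F \<longleftrightarrow> F = 0 \<or> v F \<ge> k"

lemma v_0 [simp]: "v 0 = 0"
  and v_surj: "surj v"
  and v_const: "c \<noteq> 0 \<Longrightarrow> v (poly_fun [:c:] 0) = 0"
  and v_mult: "F \<noteq> 0 \<Longrightarrow> H \<noteq> 0 \<Longrightarrow> v (fmul F H) = v F + v H"
  and v_add: "F \<noteq> 0 \<Longrightarrow> H \<noteq> 0 \<Longrightarrow> F + H \<noteq> 0 \<Longrightarrow> min (v F) (v H) \<le> v (F + H)"
  using valuation unfolding discrete_valuation_def fmul_def const_fun_eq by blast+

lemma v_uminus [simp]: "v (- F) = v F"
proof (cases "F = 0")
  case False
  have "[:- 1:] = (- 1 :: 'a poly)" by (simp add: one_pCons)
  then have "to_fract [:- 1:] = (- 1 :: 'a poly fract)" by simp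
  then have "- F = fmul (poly_fun [:- 1:] 0) F"
    by (cases F) (simp add: fmul_poly_left)
  then show ?thesis
    using v_mult[of "poly_fun [:- 1:] 0" F] v_const[of "- 1"] False by (simp add: poly_fun_eq_0_iff)
qed simp

lemma vge_0 [simp]: "vge k 0"
  by (simp add: vge_def)

lemma vge_add: "vge k F \<Longrightarrow> vge k H \<Longrightarrow> vge k (F + H)"
  using v_add[of F H] by (cases "F = 0"; cases "H = 0"; cases "F + H = 0") (auto simp: vge_def)

lemma vge_uminus: "vge k F \<Longrightarrow> vge k (- F)"
  by (auto simp: vge_def)

lemma vge_diff: "vge k F \<Longrightarrow> vge k H \<Longrightarrow> vge k (F - H)"
  using vge_add[of k F "- H"] vge_uminus[of k H] by simp

lemma vge_mult: "vge j F \<Longrightarrow> vge k H \<Longrightarrow> vge (j + k) (fmul F H)"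
  using v_mult[of F H] by (cases "F = 0 \<or> H = 0") (auto simp: vge_def)

lemma vge_const: "vge 0 (poly_fun [:c:] 0)"
  using v_const[of c] by (cases "c = 0") (auto simp: vge_def)

lemma v_dominated:
  assumes "H \<noteq> 0" "vge (v H + 1) (F - H)"
  shows "F \<noteq> 0 \<and> v F = v H"
proof
  show F: "F \<noteq> 0"
  proof
    assume "F = 0"
    then show False using assms by (simp add: vge_def)
  qed
  show "v F = v H"
  proof (cases "F - H = 0")
    case False
    then have d: "v (F - H) \<ge> v H + 1" using assms(2) by (simp add: vge_def)
    have "min (v (F - H)) (v H) \<le> v F" using v_add[of "F - H" H] False assms(1) F by simp
    moreover have "min (v F) (v (- (F - H))) \<le> v H"
      using v_add[of F "- (F - H)"] False assms(1) F by simp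
    ultimately show ?thesis using d v_uminus[of "F - H"] by simp
  qed simp
qed

lemma v_add_less:
  assumes "F \<noteq> 0" "H \<noteq> 0" "v F < v H"
  shows "F + H \<noteq> 0 \<and> v (F + H) = v F"
  using v_dominated[of F "F + H"] assms by (simp add: vge_def)

lemma v_add_distinct:
  assumes "F \<noteq> 0" "H \<noteq> 0" "v F \<noteq> v H"
  shows "v (F + H) = min (v F) (v H)"
proof (cases "v F < v H")
  case True
  then show ?thesis using v_add_less[of F H] assms by simp
next
  case False
  then show ?thesis using v_add_less[of H F] assms by (simp add: add.commute)
qed

lemma v_poly_power:
  assumes "p \<noteq> 0"
  shows "v (poly_fun (p ^ k) 0) = int k * v (poly_fun p 0)"
proof (induction k)
  case 0
  then show ?case using v_const[of 1] by (simp flip: one_pCons)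
next
  case (Suc k)
  have "poly_fun (p ^ Suc k) 0 = fmul (poly_fun p 0) (poly_fun (p ^ k) 0)"
    by (simp add: fmul_poly_fun)
  then show ?case using Suc assms v_mult by (simp add: poly_fun_eq_0_iff algebra_simps)
qed

lemma v_poly_mult: "p \<noteq> 0 \<Longrightarrow> q \<noteq> 0 \<Longrightarrow> v (poly_fun (p * q) 0) = v (poly_fun p 0) + v (poly_fun q 0)"
  using v_mult[of "poly_fun p 0" "poly_fun q 0"] by (simp add: fmul_poly_fun poly_fun_eq_0_iff)

lemma v_Y: "2 * v (poly_fun 0 1) = v (poly_fun g 0)"
  using v_mult[of "poly_fun 0 1" "poly_fun 0 1"] by (simp add: fmul_poly_fun poly_fun_eq_0_iff)

end

section \<open>Values of functions at an affine point\<close>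

locale affine_valuation = curve_valuation +
  fixes x0 y0 :: 'a
  assumes centred: "centred_at v (Aff x0 y0)"
begin

lemma v_linear: "v (poly_fun [:- x0, 1:] 0) > 0"
  using centred by (simp add: X_fun_eq const_fun_eq poly_fun_diff)

lemma v_Y_diff: "v (poly_fun [:- y0:] 1) > 0"
  using centred by (simp add: Y_fun_eq const_fun_eq poly_fun_diff)

lemma vge_poly_fun: "vge 0 (poly_fun A B)"
proof -
  have "poly_fun [:0, 1:] 0 = poly_fun [:- x0, 1:] 0 + poly_fun [:x0:] 0"
    "poly_fun 0 1 = poly_fun [:- y0:] 1 + poly_fun [:y0:] 0"
    by (simp_all add: poly_fun_add)
  then have vX: "vge 0 (poly_fun [:0, 1:] 0)" and vY: "vge 0 (poly_fun 0 1)"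
    using vge_add[OF _ vge_const] v_linear v_Y_diff by (metis less_imp_le vge_def)+
  have *: "vge 0 (poly_fun p 0)" for p
  proof (induction p)
    case (pCons a p)
    have "poly_fun (pCons a p) 0 = poly_fun [:a:] 0 + fmul (poly_fun [:0, 1:] 0) (poly_fun p 0)"
      by (simp add: fmul_poly_fun poly_fun_add)
    moreover have "vge 0 (fmul (poly_fun [:0, 1:] 0) (poly_fun p 0))" using vge_mult[OF vX pCons.IH] by simp
    ultimately show ?case using vge_add[OF vge_const] by simp
  qed simp
  have "poly_fun A B = poly_fun A 0 + fmul (poly_fun B 0) (poly_fun 0 1)"
    by (simp add: fmul_poly_fun poly_fun_add)
  moreover have "vge 0 (fmul (poly_fun B 0) (poly_fun 0 1))" using vge_mult[OF * vY] by simp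
  ultimately show ?thesis using vge_add[OF *] by simp
qed

text \<open>Division with remainder by X - x0 in both coefficients gives A + B Y = (X - x0) (A1 + B1
  Y) + B(x0) (Y - y0), so the ideal of functions vanishing at the point is generated by X - x0 and Y
  - y0.\<close>

lemma vge_poly_fun_root:
  assumes "poly A x0 + poly B x0 * y0 = 0"
  shows "vge 1 (poly_fun A B)"
proof -
  define A1 B1 where "A1 = synthetic_div A x0" and "B1 = synthetic_div B x0"
  have A: "A = [:- x0, 1:] * A1 + [:poly A x0:]" and B: "B = [:- x0, 1:] * B1 + [:poly B x0:]"
    unfolding A1_def B1_def by (rule synthetic_div_correct' [symmetric])+
  have pA: "poly A x0 = - (poly B x0 * y0)" using assms by (simp add: eq_neg_iff_add_eq_0)
  have "poly_fun A B = fmul (poly_fun [:- x0, 1:] 0) (poly_fun A1 B1)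
      + fmul (poly_fun [:poly B x0:] 0) (poly_fun [:- y0:] 1)"
    by (subst A, subst B, subst pA) (simp add: fmul_poly_fun poly_fun_add mult.commute)
  moreover have "vge (1 + 0) (fmul (poly_fun [:- x0, 1:] 0) (poly_fun A1 B1))"
    using v_linear by (intro vge_mult vge_poly_fun) (simp add: vge_def)
  moreover have "vge (0 + 1) (fmul (poly_fun [:poly B x0:] 0) (poly_fun [:- y0:] 1))"
    using v_Y_diff by (intro vge_mult vge_const) (simp add: vge_def)
  ultimately show ?thesis using vge_add by simp
qed

lemma v_poly_fun_nonroot:
  assumes "poly A x0 + poly B x0 * y0 \<noteq> 0"
  shows "v (poly_fun A B) = 0"
proof -
  define c where "c = poly A x0 + poly B x0 * y0"
  have "vge 1 (poly_fun (A - [:c:]) B)"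
    by (rule vge_poly_fun_root) (simp add: c_def)
  moreover have "poly_fun (A - [:c:]) B = poly_fun A B - poly_fun [:c:] 0"
    by (simp add: poly_fun_diff)
  ultimately show ?thesis
    using v_dominated[of "poly_fun [:c:] 0" "poly_fun A B"] v_const[of c] assms
    by (simp add: c_def poly_fun_eq_0_iff)
qed

lemma v_poly_fun_pos_iff:
  assumes "A \<noteq> 0 \<or> B \<noteq> 0"
  shows "v (poly_fun A B) > 0 \<longleftrightarrow> poly A x0 + poly B x0 * y0 = 0"
  using v_poly_fun_nonroot[of A B] vge_poly_fun_root[of A B] assms
  by (force simp: vge_def poly_fun_eq_0_iff)

lemma v_poly_fun_nonneg: "v (poly_fun A B) \<ge> 0"
  using vge_poly_fun[of A B] by (auto simp: vge_def)

lemma v_poly: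
  assumes "p \<noteq> 0"
  shows "v (poly_fun p 0) = int (order x0 p) * v (poly_fun [:- x0, 1:] 0)"
proof -
  define k where "k = order x0 p"
  obtain q where q: "p = [:- x0, 1:] ^ k * q" "\<not> [:- x0, 1:] dvd q"
    using order_decomp[OF assms] unfolding k_def by blast
  have "poly q x0 \<noteq> 0" using q(2) by (simp add: poly_eq_0_iff_dvd)
  then have "v (poly_fun q 0) = 0" by (intro v_poly_fun_nonroot) simp
  moreover have "v (poly_fun p 0) = v (poly_fun ([:- x0, 1:] ^ k) 0) + v (poly_fun q 0)"
    unfolding q(1)
    using \<open>poly q x0 \<noteq> 0\<close> by (intro v_poly_mult) auto
  ultimately show ?thesis using v_poly_power[of "[:- x0, 1:]" k] by (simp add: k_def)
qed

text \<open>The conjugate A - B Y has value 0: if both vanished at the point, then 2 B(x0) y0 = 0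
  and hence A(x0) = B(x0) = 0. So the whole value of the norm comes from A + B Y.\<close>

lemma v_norm_unramified:
  assumes "y0 \<noteq> 0" "poly A x0 \<noteq> 0 \<or> poly B x0 \<noteq> 0" "poly A x0 + poly B x0 * y0 = 0"
  shows "v (poly_fun A B) = v (poly_fun (A\<^sup>2 - g * B\<^sup>2) 0)"
proof -
  have "poly A x0 - poly B x0 * y0 \<noteq> 0"
  proof
    assume "poly A x0 - poly B x0 * y0 = 0"
    then have eq: "poly A x0 = poly B x0 * y0" by simp
    then have "2 * (poly B x0 * y0) = 0" using assms(3) by auto
    then show False using assms(1,2) eq by auto
  qed
  then have "v (poly_fun A (- B)) = 0" by (intro v_poly_fun_nonroot) simp
  moreover have "fmul (poly_fun A B) (poly_fun A (- B)) = poly_fun (A\<^sup>2 - g * B\<^sup>2) 0"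
    by (simp add: fmul_poly_fun power2_eq_square algebra_simps)
  moreover have "poly_fun A B \<noteq> 0" "poly_fun A (- B) \<noteq> 0"
    using assms(2) by (auto simp: poly_fun_eq_0_iff)
  ultimately show ?thesis using v_mult[of "poly_fun A B" "poly_fun A (- B)"] by simp
qed

end

section \<open>Uniqueness of the valuation at a point\<close>

context odd_curve
begin

text \<open>At infinity this is X^\<gamma> / Y with \<gamma> = \<open>degree g div 2\<close>,
  written as X^\<gamma> Y / g. As X has a pole of order 2 and Y one of order 2 \<gamma> + 1, its
  value is 1.\<close>

definition uniformizer :: "'a curve_point \<Rightarrow> 'a curve_fun" where
  "uniformizer P = (case P of
     Aff x y \<Rightarrow> if y = 0 then poly_fun 0 1 else poly_fun [:- x, 1:] 0
   | Infty \<Rightarrow> (0, to_fract (monom 1 (degree g div 2)) / to_fract g))"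

lemma uniformizer_nonzero: "uniformizer P \<noteq> 0"
proof -
  have "g \<noteq> 0" using odd_degree by auto
  then show ?thesis
    by (auto simp: uniformizer_def poly_fun_eq_0_iff split: curve_point.splits) (auto simp: zero_prod_def)
qed

text \<open>The multiplier k stands before v in the quantifiers: it depends only on A, B and the
  point, which is what uniqueness of the valuation rests on. Common factors X - x0 are removed by
  induction; without them the value is zero or that of the norm.\<close>

lemma poly_fun_valuation_unramified:
  assumes "y0 \<noteq> 0" "A \<noteq> 0 \<or> B \<noteq> 0"
  shows "\<exists>k. \<forall>v. affine_valuation g v x0 y0 \<longrightarrow> v (poly_fun A B) = k * v (poly_fun [:- x0, 1:] 0)"
  using assms(2)
proof (induction "degree A + degree B" arbitrary: A B rule: less_induct)
  case less
  consider "poly A x0 + poly B x0 * y0 \<noteq> 0"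
    | "poly A x0 + poly B x0 * y0 = 0" "poly A x0 \<noteq> 0 \<or> poly B x0 \<noteq> 0"
    | "poly A x0 = 0" "poly B x0 = 0" by blast
  then show ?case
  proof cases
    case 1
    then show ?thesis using affine_valuation.v_poly_fun_nonroot by (intro exI[of _ 0]) fastforce
  next
    case 2
    have N: "A\<^sup>2 - g * B\<^sup>2 \<noteq> 0" by (rule degree_norm(1)[OF odd_degree less.prems])
    show ?thesis
      using affine_valuation.v_norm_unramified[OF _ assms(1) 2(2,1)] affine_valuation.v_poly[OF _ N]
      by (intro exI[of _ "int (order x0 (A\<^sup>2 - g * B\<^sup>2))"]) simp
  next
    case 3
    then obtain A1 B1 where AB: "A = [:- x0, 1:] * A1" "B = [:- x0, 1:] * B1"
      unfolding poly_eq_0_iff_dvd by (elim dvdE)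
    have AB1: "A1 \<noteq> 0 \<or> B1 \<noteq> 0" using less.prems AB by auto
    have deg: "p \<noteq> 0 \<Longrightarrow> degree ([:- x0, 1:] * p) = Suc (degree p)" for p
      by (subst degree_mult_eq) auto
    have "degree A1 + degree B1 < degree A + degree B"
      using AB1 deg[of A1] deg[of B1] unfolding AB by (cases "A1 = 0"; cases "B1 = 0") auto
    from less.hyps[OF this AB1] obtain k where
      k: "\<And>v. affine_valuation g v x0 y0 \<Longrightarrow> v (poly_fun A1 B1) = k * v (poly_fun [:- x0, 1:] 0)" by blast
    have "v (poly_fun A B) = (k + 1) * v (poly_fun [:- x0, 1:] 0)" if "affine_valuation g v x0 y0" for v
    proof -
      interpret affine_valuation g v x0 y0 by (rule that)
      have "poly_fun A B = fmul (poly_fun [:- x0, 1:] 0) (poly_fun A1 B1)"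
        by (simp only: AB fmul_poly_fun mult_zero_left add_0_right)
      then show ?thesis
        using v_mult[of "poly_fun [:- x0, 1:] 0" "poly_fun A1 B1"] AB1 k[OF that]
        by (simp add: poly_fun_eq_0_iff algebra_simps)
    qed
    then show ?thesis by blast
  qed
qed

lemma poly_fun_split: "poly_fun A B = poly_fun A 0 + fmul (poly_fun B 0) (poly_fun 0 1)"
  by (simp add: fmul_poly_fun poly_fun_add)

text \<open>At a simple root of g the function X - x0 has twice the value of Y. So A and B Y have an
  even and an odd multiple of that value, and the value of the sum is the smaller one.\<close>

lemma poly_fun_valuation_ramified:
  assumes "poly g x0 = 0" "order x0 g = 1" "A \<noteq> 0 \<or> B \<noteq> 0"
  shows "\<exists>k. \<forall>v. affine_valuation g v x0 0 \<longrightarrow> v (poly_fun A B) = k * v (poly_fun 0 1)"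
proof -
  define k where "k = (if B = 0 then 2 * int (order x0 A) else if A = 0 then 2 * int (order x0 B) + 1
     else min (2 * int (order x0 A)) (2 * int (order x0 B) + 1))"
  have "v (poly_fun A B) = k * v (poly_fun 0 1)" if "affine_valuation g v x0 0" for v
  proof -
    interpret affine_valuation g v x0 0 by (rule that)
    have "g \<noteq> 0" using odd_degree by auto
    then have lin: "v (poly_fun [:- x0, 1:] 0) = 2 * v (poly_fun 0 1)"
      using v_Y v_poly[of g] assms(2) by simp
    then have pos: "v (poly_fun 0 1) > 0" using v_linear by simp
    have vA: "A \<noteq> 0 \<Longrightarrow> v (poly_fun A 0) = 2 * int (order x0 A) * v (poly_fun 0 1)"
      using v_poly[of A] lin by simp
    have vB: "v (fmul (poly_fun B 0) (poly_fun 0 1)) = (2 * int (order x0 B) + 1) * v (poly_fun 0 1)" if "B \<noteq> 0"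
      using v_mult[of "poly_fun B 0" "poly_fun 0 1"] v_poly[of B] lin that
      by (simp add: poly_fun_eq_0_iff algebra_simps)
    show ?thesis
    proof (cases "A = 0 \<or> B = 0")
      case True
      then show ?thesis using vA vB assms(3) poly_fun_split[of A B] by (auto simp: k_def)
    next
      case False
      have "2 * int (order x0 A) \<noteq> 2 * int (order x0 B) + 1" by presburger
      then have "v (poly_fun A 0) \<noteq> v (fmul (poly_fun B 0) (poly_fun 0 1))"
        using vA vB False pos by simp
      then have "v (poly_fun A B) = min (v (poly_fun A 0)) (v (fmul (poly_fun B 0) (poly_fun 0 1)))"
        unfolding poly_fun_split[of A B] using False
        by (intro v_add_distinct) (auto simp: fmul_eq_0_iff poly_fun_eq_0_iff)
      then show ?thesis using vA vB False pos by (simp add: k_def min_def)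
    qed
  qed
  then show ?thesis by blast
qed

lemma (in curve_valuation) v_poly_infinity:
  assumes "centred_at v Infty" "p \<noteq> 0"
  shows "v (poly_fun p 0) = int (degree p) * v (poly_fun [:0, 1:] 0)"
  using assms(2)
proof (induction p)
  case (pCons a p)
  have neg: "v (poly_fun [:0, 1:] 0) < 0" using assms(1) by (simp add: X_fun_eq)
  show ?case
  proof (cases "p = 0")
    case True
    then show ?thesis using v_const[of a] pCons by simp
  next
    case False
    have split: "poly_fun (pCons a p) 0 = fmul (poly_fun [:0, 1:] 0) (poly_fun p 0) + poly_fun [:a:] 0"
      by (simp add: fmul_poly_fun poly_fun_add)
    have vm: "v (fmul (poly_fun [:0, 1:] 0) (poly_fun p 0)) = int (degree (pCons a p)) * v (poly_fun [:0, 1:] 0)"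
      using pCons.IH False v_mult[of "poly_fun [:0, 1:] 0" "poly_fun p 0"]
      by (simp add: poly_fun_eq_0_iff algebra_simps)
    show ?thesis
    proof (cases "a = 0")
      case True
      then show ?thesis using vm split by simp
    next
      case a: False
      have "v (fmul (poly_fun [:0, 1:] 0) (poly_fun p 0)) < v (poly_fun [:a:] 0)"
        unfolding vm v_const[OF a] using neg False by (simp add: mult_pos_neg)
      then show ?thesis
        using v_add_less[of "fmul (poly_fun [:0, 1:] 0) (poly_fun p 0)" "poly_fun [:a:] 0"] vm split False a
        by (simp add: fmul_eq_0_iff poly_fun_eq_0_iff)
    qed
  qed
qed simp

text \<open>With T the uniformizer, X^\<gamma> Y = g T and 2 v(Y) = v(g) = (2 \<gamma> + 1) v(X)
  give v(X) = - 2 v(T). That v(T) is 1 comes out only later, so it stays in the formulas as a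
  factor.\<close>

lemma (in curve_valuation) v_infinity:
  assumes "centred_at v Infty"
  shows "v (uniformizer Infty) > 0"
    and "p \<noteq> 0 \<Longrightarrow> v (poly_fun p 0) = - 2 * int (degree p) * v (uniformizer Infty)"
    and "p \<noteq> 0 \<Longrightarrow> v (fmul (poly_fun p 0) (poly_fun 0 1)) = - (2 * int (degree p) + int (degree g)) * v (uniformizer Infty)"
proof -
  define \<gamma> where "\<gamma> = degree g div 2"
  have n: "degree g = 2 * \<gamma> + 1" using odd_degree by (simp add: \<gamma>_def)
  have g0: "g \<noteq> 0" using odd_degree by auto
  have neg: "v (poly_fun [:0, 1:] 0) < 0" using assms(1) by (simp add: X_fun_eq)
  define t where "t = v (uniformizer Infty)"
  have "fmul (poly_fun g 0) (uniformizer Infty) = fmul (poly_fun (monom 1 \<gamma>) 0) (poly_fun 0 1)"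
    using g0 by (simp add: uniformizer_def \<gamma>_def poly_fun_def fmul_pair)
  then have "v (poly_fun g 0) + t = v (poly_fun (monom 1 \<gamma>) 0) + v (poly_fun 0 1)"
    using v_mult[of "poly_fun g 0" "uniformizer Infty"] v_mult[of "poly_fun (monom 1 \<gamma>) 0" "poly_fun 0 1"]
      g0 uniformizer_nonzero by (simp add: poly_fun_eq_0_iff t_def)
  moreover have vg: "v (poly_fun g 0) = int (degree g) * v (poly_fun [:0, 1:] 0)"
    by (rule v_poly_infinity[OF assms g0])
  moreover have "v (poly_fun (monom 1 \<gamma>) 0) = int \<gamma> * v (poly_fun [:0, 1:] 0)"
    using v_poly_infinity[OF assms, of "monom 1 \<gamma>"] by (simp add: degree_monom_eq)
  ultimately have "2 * (int (degree g) * v (poly_fun [:0, 1:] 0)) + 2 * t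
      = 2 * (int \<gamma> * v (poly_fun [:0, 1:] 0)) + int (degree g) * v (poly_fun [:0, 1:] 0)"
    using v_Y by simp
  then have X: "v (poly_fun [:0, 1:] 0) = - 2 * t" by (simp add: n algebra_simps)
  then show "v (uniformizer Infty) > 0" using neg by (simp add: t_def)
  have vY: "v (poly_fun 0 1) = - int (degree g) * t"
    using v_Y vg X by simp
  show *: "v (poly_fun p 0) = - 2 * int (degree p) * v (uniformizer Infty)" if "p \<noteq> 0" for p
    using v_poly_infinity[OF assms that] X by (simp add: t_def)
  show "v (fmul (poly_fun p 0) (poly_fun 0 1)) = - (2 * int (degree p) + int (degree g)) * v (uniformizer Infty)" if "p \<noteq> 0"
    using v_mult[of "poly_fun p 0" "poly_fun 0 1"] *[OF that] vY that
    by (simp add: poly_fun_eq_0_iff t_def algebra_simps)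
qed

lemma (in curve_valuation) v_poly_fun_infinity:
  assumes "centred_at v Infty" "A \<noteq> 0 \<or> B \<noteq> 0"
  shows "v (poly_fun A B) = - (if B = 0 then 2 * int (degree A) else if A = 0 then 2 * int (degree B) + int (degree g)
     else max (2 * int (degree A)) (2 * int (degree B) + int (degree g))) * v (uniformizer Infty)"
proof (cases "A = 0 \<or> B = 0")
  case True
  then show ?thesis using v_infinity[OF assms(1)] assms(2) poly_fun_split[of A B] by (auto simp: algebra_simps)
next
  case False
  note v = v_infinity[OF assms(1)]
  define a b t where "a = 2 * int (degree A)" and "b = 2 * int (degree B) + int (degree g)" and "t = v (uniformizer Infty)"
  have t: "t > 0" and vA: "v (poly_fun A 0) = - a * t" and vB: "v (fmul (poly_fun B 0) (poly_fun 0 1)) = - b * t"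
    using v(1) v(2)[of A] v(3)[of B] False by (simp_all add: a_def b_def t_def)
  have "a \<noteq> b" using odd_degree unfolding a_def b_def by presburger
  then have "- a * t \<noteq> - b * t" using t by simp
  then have "v (poly_fun A B) = min (v (poly_fun A 0)) (v (fmul (poly_fun B 0) (poly_fun 0 1)))"
    unfolding poly_fun_split[of A B] vA [symmetric] vB [symmetric] using False
    by (intro v_add_distinct) (auto simp: fmul_eq_0_iff poly_fun_eq_0_iff)
  also have "\<dots> = - max a b * t"
    unfolding vA vB using t by (cases "a \<le> b") (simp_all add: min_def max_def)
  finally show ?thesis using False by (simp add: a_def b_def t_def)
qed

end

locale squarefree_odd_curve = odd_curve +
  assumes simple_roots: "\<And>x. poly g x = 0 \<Longrightarrow> order x g = 1"
begin

lemma valuation_determined: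
  assumes "P \<in> curve_points g" "F \<noteq> 0"
  shows "\<exists>k. \<forall>v. discrete_valuation g v \<and> centred_at v P \<longrightarrow> v F = k * v (uniformizer P) \<and> v (uniformizer P) > 0"
proof -
  obtain A B C where C: "C \<noteq> 0" "fmul (poly_fun C 0) F = poly_fun A B"
    using curve_fun_cases .
  then have AB: "A \<noteq> 0 \<or> B \<noteq> 0" using assms(2) by (metis fmul_eq_0_iff poly_fun_eq_0_iff)
  have *: "\<exists>k. \<forall>v. discrete_valuation g v \<and> centred_at v P \<longrightarrow>
      v (poly_fun A B) = k * v (uniformizer P) \<and> v (uniformizer P) > 0" if "A \<noteq> 0 \<or> B \<noteq> 0" for A B
  proof (cases P)
    case Infty
    have cv: "curve_valuation g v" if "discrete_valuation g v" for v
      using that by unfold_locales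
    show ?thesis unfolding Infty
      using curve_valuation.v_poly_fun_infinity[OF cv _ that] curve_valuation.v_infinity(1)[OF cv] by blast
  next
    case (Aff x y)
    then have y: "y\<^sup>2 = poly g x" using assms(1) by (auto simp: curve_points_def)
    have av: "affine_valuation g v x y" if "discrete_valuation g v \<and> centred_at v P" for v
      using that y Aff by unfold_locales auto
    show ?thesis
    proof (cases "y = 0")
      case True
      then have root: "poly g x = 0" using y by simp
      have "v (poly_fun 0 1) > 0" if "affine_valuation g v x 0" for v
        using affine_valuation.v_Y_diff[OF that] by simp
      then show ?thesis
        using poly_fun_valuation_ramified[OF root simple_roots[OF root] that] av True
        by (simp add: Aff uniformizer_def) blast
    next
      case False
      then show ?thesis
        using poly_fun_valuation_unramified[OF False that, of x] av affine_valuation.v_linear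
        by (simp add: Aff uniformizer_def) blast
    qed
  qed
  obtain k where k: "\<And>v. discrete_valuation g v \<Longrightarrow> centred_at v P \<Longrightarrow>
      v (poly_fun A B) = k * v (uniformizer P) \<and> v (uniformizer P) > 0"
    using *[OF AB] by blast
  obtain j where j: "\<And>v. discrete_valuation g v \<Longrightarrow> centred_at v P \<Longrightarrow> v (poly_fun C 0) = j * v (uniformizer P)"
    using *[of C 0] C(1) by blast
  have "v F = (k - j) * v (uniformizer P) \<and> v (uniformizer P) > 0"
    if "discrete_valuation g v" "centred_at v P" for v
  proof -
    interpret curve_valuation g v using that(1) by unfold_locales
    have "v (poly_fun A B) = v (poly_fun C 0) + v F"
      using v_mult[of "poly_fun C 0" F] C assms(2) by (simp add: poly_fun_eq_0_iff)
    then show ?thesis using k[OF that] j[OF that] by (simp add: algebra_simps)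
  qed
  then show ?thesis by blast
qed

text \<open>All values are multiples of the positive integer v(uniformizer), and 1 is among them
  because v is surjective.\<close>

lemma valuation_uniformizer:
  assumes "P \<in> curve_points g" "discrete_valuation g v" "centred_at v P"
  shows "v (uniformizer P) = 1"
proof -
  interpret curve_valuation g v using assms(2) by unfold_locales
  obtain F where F: "v F = 1" using v_surj by (metis surjD)
  then have "F \<noteq> 0" by auto
  then obtain k where "v F = k * v (uniformizer P)" "v (uniformizer P) > 0"
    using valuation_determined[OF assms(1)] assms(2,3) by blast
  then show ?thesis using F by (metis mult.commute pos_zmult_eq_1_iff)
qed

theorem valuation_unique:
  assumes "P \<in> curve_points g" "discrete_valuation g v" "centred_at v P" "discrete_valuation g w" "centred_at w P"
  shows "v = w"
proof
  fix F
  show "v F = w F"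
  proof (cases "F = 0")
    case True
    then show ?thesis using assms(2,4) by (simp add: discrete_valuation_def)
  next
    case False
    then show ?thesis
      using valuation_determined[OF assms(1) False] valuation_uniformizer[OF assms(1)] assms(2-) by (metis mult_1_right)
  qed
qed

end

section \<open>Existence of the valuation at a point\<close>

definition fract_lift :: "('a::idom \<Rightarrow> 'b::field) \<Rightarrow> 'a fract \<Rightarrow> 'b" where
  "fract_lift h z = (THE w. \<exists>p q. q \<noteq> 0 \<and> z = to_fract p / to_fract q \<and> w = h p / h q)"

lemma fract_cases:
  obtains p q where "q \<noteq> 0" "z = to_fract p / to_fract q"
  by (cases z) (auto simp: Fract_conv_to_fract)

locale inj_hom_into_field = inj_idom_hom hom
  for hom :: "'a::idom \<Rightarrow> 'b::field"
begin

lemma fract_lift_divide: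
  assumes "q \<noteq> 0"
  shows "fract_lift hom (to_fract p / to_fract q) = hom p / hom q"
  unfolding fract_lift_def
proof (rule the_equality)
  show "\<exists>p' q'. q' \<noteq> 0 \<and> to_fract p / to_fract q = to_fract p' / to_fract q' \<and> hom p / hom q = hom p' / hom q'"
    using assms by blast
next
  fix w assume "\<exists>p' q'. q' \<noteq> 0 \<and> to_fract p / to_fract q = to_fract p' / to_fract q' \<and> w = hom p' / hom q'"
  then obtain p' q' where *: "q' \<noteq> 0" "to_fract p / to_fract q = to_fract p' / to_fract q'" "w = hom p' / hom q'"
    by blast
  have "to_fract (p * q') = to_fract (p' * q)"
    using *(2) assms *(1) by (simp add: field_simps)
  then have "p * q' = p' * q" by (simp only: to_fract_eq_iff)
  then have "hom p * hom q' = hom p' * hom q" by (metis hom_mult)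
  then show "w = hom p / hom q" using assms *(1) by (simp add: *(3) field_simps)
qed

lemma fract_lift_to_fract [simp]: "fract_lift hom (to_fract p) = hom p"
  using fract_lift_divide[of 1 p] by simp

lemma fract_lift_0 [simp]: "fract_lift hom 0 = 0"
  using fract_lift_to_fract[of 0] by simp

lemma fract_lift_add: "fract_lift hom (x + y) = fract_lift hom x + fract_lift hom y"
proof -
  obtain p q where x: "q \<noteq> 0" "x = to_fract p / to_fract q" by (rule fract_cases)
  obtain r s where y: "s \<noteq> 0" "y = to_fract r / to_fract s" by (rule fract_cases)
  have "x + y = to_fract (p * s + r * q) / to_fract (q * s)"
    using x y by (simp add: field_simps)
  then show ?thesis
    using x y by (simp only: fract_lift_divide mult_eq_0_iff simp_thms hom_add hom_mult) (simp add: field_simps)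
qed

lemma fract_lift_mult: "fract_lift hom (x * y) = fract_lift hom x * fract_lift hom y"
proof -
  obtain p q where x: "q \<noteq> 0" "x = to_fract p / to_fract q" by (rule fract_cases)
  obtain r s where y: "s \<noteq> 0" "y = to_fract r / to_fract s" by (rule fract_cases)
  have "x * y = to_fract (p * r) / to_fract (q * s)"
    using x y by simp
  then show ?thesis
    using x y by (simp only: fract_lift_divide mult_eq_0_iff simp_thms hom_mult) simp
qed

end

interpretation fls_const: field_hom fls_const
  by unfold_locales (simp_all add: fls_plus_const)

text \<open>An even power of the variable splits off. The remaining power series has a nonzero
  constant term; a square root of that exists by algebraic closedness and extends to the series. The
  index \<open>Suc 1\<close> of \<open>fps_radical\<close> is 2, and r chooses the roots of
  constants.\<close>

lemma fls_sqrt_exists: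
  fixes f :: "'a::{alg_closed_field,field_char_0} fls"
  assumes "f \<noteq> 0" "even (fls_subdegree f)"
  obtains h where "h\<^sup>2 = f"
proof -
  define F where "F = fls_base_factor_to_fps f"
  have f: "f = fls_shift (- fls_subdegree f) (fps_to_fls F)"
    unfolding F_def by (rule fls_conv_base_factor_to_fps_shift_subdegree)
  have "F \<noteq> 0" using f assms(1) by auto
  moreover have "subdegree F = 0" unfolding F_def by (rule fls_base_factor_to_fps_subdegree)
  ultimately have F0: "F $ 0 \<noteq> 0" by (metis nth_subdegree_nonzero)
  define r where "r = (\<lambda>(k::nat) (x::'a). SOME y. y ^ k = x)"
  have "r (Suc 1) (F $ 0) ^ Suc 1 = F $ 0"
    unfolding r_def by (rule someI_ex) (rule nth_root_exists, simp)
  then have R: "fps_radical r (Suc 1) F ^ Suc 1 = F"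
    using power_radical[OF F0, of r 1] by blast
  obtain k where k: "fls_subdegree f = 2 * k" using assms(2) by (elim evenE)
  define h where "h = fls_shift (- k) (fps_to_fls (fps_radical r (Suc 1) F))"
  have "h * h = fls_shift (- k + - k) (fps_to_fls (fps_radical r (Suc 1) F * fps_radical r (Suc 1) F))"
    unfolding h_def fls_times_both_shifted_simp fls_times_fps_to_fls ..
  also have "fps_radical r (Suc 1) F * fps_radical r (Suc 1) F = F"
    using R by (simp add: power2_eq_square)
  finally have "h\<^sup>2 = f" using f k by (simp add: power2_eq_square)
  then show ?thesis by (rule that)
qed

text \<open>A pair of Laurent series on the curve with non-constant \<open>\<xi>\<close> embeds the function field into
  the field of Laurent series, whose subdegree then restricts to a valuation.\<close>

locale curve_parametrization = odd_curve g for g :: "'a::{alg_closed_field,field_char_0} poly" +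
  fixes \<xi> \<eta> :: "'a fls"
  assumes eta: "\<eta>\<^sup>2 = poly (map_poly fls_const g) \<xi>" and xi: "\<xi> \<notin> range fls_const"
begin

definition ev :: "'a poly \<Rightarrow> 'a fls" where
  "ev p = poly (map_poly fls_const p) \<xi>"

lemma ev_pCons: "ev (pCons a p) = fls_const a + \<xi> * ev p"
  by (simp add: ev_def map_poly_pCons)

lemma ev_0 [simp]: "ev 0 = 0"
  by (simp add: ev_def)

lemma ev_add: "ev (p + q) = ev p + ev q"
  and ev_mult: "ev (p * q) = ev p * ev q"
  and ev_1: "ev 1 = 1"
  by (simp_all add: ev_def fls_const.map_poly_plus fls_const.map_poly_times fls_const.map_poly_one)

text \<open>Over algebraically closed constants p splits into linear factors, and none of them
  vanishes at the non-constant \<xi>; so \<xi> is transcendental.\<close>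

lemma ev_nonzero: "p \<noteq> 0 \<Longrightarrow> ev p \<noteq> 0"
proof (induction "degree p" arbitrary: p rule: less_induct)
  case less
  show ?case
  proof (cases "degree p = 0")
    case True
    then obtain a where "p = [:a:]" by (meson degree_eq_zeroE)
    then show ?thesis using less.prems by (simp add: ev_pCons)
  next
    case False
    then obtain x where "poly p x = 0" using alg_closed_imp_poly_has_root by blast
    then obtain q where q: "p = [:- x, 1:] * q" unfolding poly_eq_0_iff_dvd by (elim dvdE)
    have q0: "q \<noteq> 0" using less.prems q by auto
    have "degree p = degree [:- x, 1:] + degree q" unfolding q using q0 by (subst degree_mult_eq) auto
    then have "ev q \<noteq> 0" using q0 by (intro less.hyps) simp_all
    moreover have "ev [:- x, 1:] \<noteq> 0"
    proof
      assume "ev [:- x, 1:] = 0"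
      then have "\<xi> = fls_const x" by (simp add: ev_pCons)
      then show False using xi by simp
    qed
    ultimately show ?thesis unfolding q ev_mult by simp
  qed
qed

sublocale ev: inj_hom_into_field ev
  by unfold_locales (use ev_nonzero in \<open>auto simp: ev_add ev_mult ev_1\<close>)

definition expand :: "'a curve_fun \<Rightarrow> 'a fls" where
  "expand F = fract_lift ev (fst F) + fract_lift ev (snd F) * \<eta>"

lemma expand_poly_fun: "expand (poly_fun A B) = ev A + ev B * \<eta>"
  by (simp add: expand_def poly_fun_def)

lemma expand_0 [simp]: "expand 0 = 0"
  by (simp add: expand_def)

lemma expand_add: "expand (F + H) = expand F + expand H"
  by (simp add: expand_def ev.fract_lift_add algebra_simps)

lemma expand_mult: "expand (fmul F H) = expand F * expand H"
proof -
  have "ev g = \<eta> * \<eta>" using eta by (simp add: ev_def power2_eq_square)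
  then show ?thesis
    by (cases F; cases H) (simp add: fmul_pair expand_def ev.fract_lift_add ev.fract_lift_mult algebra_simps)
qed

lemma expand_eq_0_iff: "expand F = 0 \<longleftrightarrow> F = 0"
proof
  assume *: "expand F = 0"
  show "F = 0"
  proof (rule ccontr)
    assume "F \<noteq> 0"
    then obtain H where "fmul F H = poly_fun 1 0" by (rule exists_fmul_inverse)
    then have "expand F * expand H = 1" by (metis expand_mult expand_poly_fun ev_0 ev_1 add_0_right mult_zero_left)
    then show False using * by simp
  qed
qed simp

definition place :: "'a curve_fun \<Rightarrow> int" where
  "place F = fls_subdegree (expand F)"

lemma place_mult: "F \<noteq> 0 \<Longrightarrow> H \<noteq> 0 \<Longrightarrow> place (fmul F H) = place F + place H"
  by (simp add: place_def expand_mult expand_eq_0_iff)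

text \<open>Products with T and with its inverse reach every integer, which gives surjectivity; the
  other laws are those of the subdegree.\<close>

lemma discrete_valuation_place:
  assumes "place T = 1"
  shows "discrete_valuation g place"
  unfolding discrete_valuation_def const_fun_eq
proof (intro conjI allI impI)
  show "place 0 = 0" by (simp add: place_def)
  have T0: "T \<noteq> 0" using assms by (auto simp: place_def)
  then obtain T' where T': "fmul T T' = poly_fun 1 0" "T' \<noteq> 0" by (rule exists_fmul_inverse)
  have one: "place (poly_fun 1 0) = 0" by (simp add: place_def expand_poly_fun ev_1)
  then have pT': "place T' = - 1" using place_mult[OF T0 T'(2)] T'(1) assms by simp
  have "\<exists>F. F \<noteq> 0 \<and> place F = k" for k
  proof (induction k rule: int_induct[of _ 0])
    case base
    then show ?case using one by (intro exI[of _ "poly_fun 1 0"]) (simp add: poly_fun_eq_0_iff)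
  next
    case (step1 i)
    then obtain F where "F \<noteq> 0" "place F = i" by blast
    then show ?case using place_mult[OF T0] assms T0 by (intro exI[of _ "fmul T F"]) (simp add: fmul_eq_0_iff)
  next
    case (step2 i)
    then obtain F where "F \<noteq> 0" "place F = i" by blast
    then show ?case using place_mult[OF T'(2)] pT' T'(2) by (intro exI[of _ "fmul T' F"]) (simp add: fmul_eq_0_iff)
  qed
  then show "surj place" by (metis surjI)
  fix c :: 'a assume "c \<noteq> 0"
  then show "place (poly_fun [:c:] 0) = 0" by (simp add: place_def expand_poly_fun ev_pCons)
next
  fix F H :: "'a curve_fun" assume "F \<noteq> 0" "H \<noteq> 0"
  then show "place (F \<otimes>\<^bsub>function_field g\<^esub> H) = place F + place H"
    using place_mult by (simp add: fmul_def)
  assume "F + H \<noteq> 0"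
  then have "expand F + expand H \<noteq> 0" using expand_eq_0_iff[of "F + H"] by (simp add: expand_add)
  then show "min (place F) (place H) \<le> place (F + H)"
    unfolding place_def expand_add by (rule fls_plus_subdegree)
qed

lemma place_pos_iff: "F \<noteq> 0 \<Longrightarrow> place F > 0 \<longleftrightarrow> (\<forall>k\<le>0. fls_nth (expand F) k = 0)"
  using fls_subdegree_greaterI[of "expand F" 0] nth_fls_subdegree_zero_iff[of "expand F"]
  by (auto simp: place_def expand_eq_0_iff)

text \<open>The constant is the coefficient at 0 of the Laurent series. So the residue field of the
  place is the field of constants, which will bound the effect of a single point on a Riemann-Roch
  space.\<close>

lemma place_residue:
  assumes "F = 0 \<or> place F \<ge> 0"
  shows "\<exists>c. F - poly_fun [:c:] 0 = 0 \<or> place (F - poly_fun [:c:] 0) > 0"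
proof (intro exI disjCI)
  define c where "c = fls_nth (expand F) 0"
  assume n: "\<not> place (F - poly_fun [:c:] 0) > 0"
  show "F - poly_fun [:c:] 0 = 0"
  proof (rule ccontr)
    assume nz: "F - poly_fun [:c:] 0 \<noteq> 0"
    have "expand F = expand (F - poly_fun [:c:] 0) + expand (poly_fun [:c:] 0)"
      by (simp flip: expand_add)
    then have "expand (F - poly_fun [:c:] 0) = expand F - fls_const c"
      by (simp add: expand_poly_fun ev_pCons)
    moreover have "fls_nth (expand F) k = 0" if "k < 0" for k
      using assms that by (auto simp: place_def)
    ultimately have "\<forall>k\<le>0. fls_nth (expand (F - poly_fun [:c:] 0)) k = 0" by (simp add: c_def)
    then show False using place_pos_iff[OF nz] n by simp
  qed
qed

end

context
  fixes g :: "'a::{alg_closed_field,field_char_0} poly"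
begin

text \<open>The last clause, that residues are constants, is recorded together with existence
  because it is read off the Laurent expansion.\<close>

definition good_valuation :: "'a curve_point \<Rightarrow> ('a curve_fun \<Rightarrow> int) \<Rightarrow> bool" where
  "good_valuation P v \<longleftrightarrow> discrete_valuation g v \<and> centred_at v P \<and>
     (\<forall>F. F = 0 \<or> v F \<ge> 0 \<longrightarrow> (\<exists>c. F - poly_fun [:c:] 0 = 0 \<or> v (F - poly_fun [:c:] 0) > 0))"

end

section \<open>Laurent expansions at the three kinds of points\<close>

locale closed_curve = squarefree_odd_curve g for g :: "'a::{alg_closed_field,field_char_0} poly"
begin

lemma fls_const_image_subdegree: "\<xi> \<in> range fls_const \<Longrightarrow> fls_subdegree (\<xi> - fls_const x) = 0"
  by (auto simp: fls_minus_const)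

lemma ev_regular:
  fixes \<zeta> :: "'a fls"
  assumes "fls_subdegree \<zeta> > 0"
  shows "\<exists>r. poly (map_poly fls_const p) (fls_const x0 + \<zeta>) = fls_const (poly p x0) + \<zeta> * r \<and> fls_subdegree r \<ge> 0"
proof -
  have nn: "fls_subdegree (poly (map_poly fls_const q) (fls_const x0 + \<zeta>)) \<ge> 0" for q :: "'a poly"
  proof (induction q)
    case (pCons a q)
    let ?s = "poly (map_poly fls_const q) (fls_const x0 + \<zeta>)"
    have z: "fls_nth \<zeta> k = 0" if "k < 0" for k using assms that by simp
    have "fls_subdegree (fls_const x0 + \<zeta>) \<ge> 0" by (intro fls_subdegree_ge0I) (simp add: z)
    then have "fls_subdegree ((fls_const x0 + \<zeta>) * ?s) \<ge> 0"
      using pCons.IH by (rule fls_mult_subdegree_ge_0)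
    then have "fls_subdegree (fls_const a + (fls_const x0 + \<zeta>) * ?s) \<ge> 0"
      by (intro fls_subdegree_ge0I) simp
    then show ?case by (simp add: map_poly_pCons)
  qed simp
  define q where "q = synthetic_div p x0"
  have p: "p = [:- x0, 1:] * q + [:poly p x0:]" unfolding q_def by (rule synthetic_div_correct' [symmetric])
  have "poly (map_poly fls_const p) (fls_const x0 + \<zeta>)
      = poly (map_poly fls_const ([:- x0, 1:] * q + [:poly p x0:])) (fls_const x0 + \<zeta>)"
    using p by simp
  also have "\<dots> = fls_const (poly p x0) + \<zeta> * poly (map_poly fls_const q) (fls_const x0 + \<zeta>)"
    unfolding fls_const.map_poly_plus fls_const.map_poly_times
    by (simp add: map_poly_pCons distrib_right)
  finally show ?thesis using nn by blast
qed

lemma subdegree_ev_nonroot: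
  fixes \<zeta> :: "'a fls"
  assumes "fls_subdegree \<zeta> > 0" "poly p x0 \<noteq> 0"
  shows "fls_subdegree (poly (map_poly fls_const p) (fls_const x0 + \<zeta>)) = 0"
    and "fls_nth (poly (map_poly fls_const p) (fls_const x0 + \<zeta>)) 0 = poly p x0"
proof -
  obtain r where r: "poly (map_poly fls_const p) (fls_const x0 + \<zeta>) = fls_const (poly p x0) + \<zeta> * r" "fls_subdegree r \<ge> 0"
    using ev_regular[OF assms(1)] by blast
  have z: "fls_nth (\<zeta> * r) k = 0" if "k \<le> 0" for k
    using fls_times_nth_eq0[of k \<zeta> r] that assms(1) r(2) by simp
  show c: "fls_nth (poly (map_poly fls_const p) (fls_const x0 + \<zeta>)) 0 = poly p x0" by (simp add: r(1) z)
  show "fls_subdegree (poly (map_poly fls_const p) (fls_const x0 + \<zeta>)) = 0"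
    by (rule fls_subdegree_eqI) (use c assms(2) in \<open>auto simp: r(1) z\<close>)
qed

lemma exists_good_valuation_unramified:
  assumes "y0\<^sup>2 = poly g x0" "y0 \<noteq> 0"
  shows "\<exists>v. good_valuation g (Aff x0 y0) v"
proof -
  define \<xi> where "\<xi> = fls_const x0 + (fls_X :: 'a fls)"
  define f where "f = poly (map_poly fls_const g) \<xi>"
  have "poly g x0 \<noteq> 0" using assms by auto
  then have f: "fls_subdegree f = 0" "fls_nth f 0 = y0\<^sup>2" "f \<noteq> 0"
    unfolding f_def \<xi>_def using subdegree_ev_nonroot[of fls_X g x0] assms by auto
  obtain h where h: "h\<^sup>2 = f" using fls_sqrt_exists[OF f(3)] f(1) by auto
  have "h \<noteq> 0" using h f(3) by auto
  then have sh: "fls_subdegree h = 0" using h f(1) by (simp add: power2_eq_square flip: h)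
  have "fls_nth (h * h) 0 = fls_nth h 0 * fls_nth h 0" using fls_times_nth(1)[of h h 0] sh by simp
  then have "(fls_nth h 0)\<^sup>2 = y0\<^sup>2" using h f(2) by (simp add: power2_eq_square)
  then have "fls_nth h 0 = y0 \<or> fls_nth h 0 = - y0" by (simp add: power2_eq_iff)
  \<comment> \<open>Of the two square roots the one with constant term y0 is taken; the other one
    belongs to the conjugate point (x0, - y0).\<close>
  then obtain \<eta> where \<eta>: "\<eta>\<^sup>2 = f" "fls_nth \<eta> 0 = y0" "fls_subdegree \<eta> = 0"
    using h sh by (metis fls_uminus_nth fls_uminus_subdegree minus_minus power2_minus)
  have "\<xi> \<notin> range fls_const"
    using fls_const_image_subdegree[of \<xi> x0] by (auto simp: \<xi>_def)
  then interpret curve_parametrization g \<xi> \<eta>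
    using \<eta>(1) by unfold_locales (simp_all add: f_def)
  have "expand (poly_fun [:- x0, 1:] 0) = \<xi> - fls_const x0"
    by (simp add: expand_poly_fun ev_pCons)
  also have "\<dots> = fls_X" by (simp add: \<xi>_def)
  finally have X: "place (poly_fun [:- x0, 1:] 0) = 1" by (simp add: place_def)
  have "expand (poly_fun [:- y0:] 1) = \<eta> - fls_const y0"
    by (simp add: expand_poly_fun ev_pCons ev_1)
  moreover have "fls_nth \<eta> k = 0" if "k < 0" for k using that \<eta>(3) by simp
  ultimately have "\<forall>k\<le>0. fls_nth (expand (poly_fun [:- y0:] 1)) k = 0"
    using \<eta>(2) by simp
  then have "place (poly_fun [:- y0:] 1) > 0"
    by (subst place_pos_iff) (simp_all add: poly_fun_eq_0_iff)
  then show ?thesis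
    using discrete_valuation_place[OF X] place_residue X
    by (intro exI[of _ place]) (simp add: good_valuation_def X_fun_eq Y_fun_eq const_fun_eq poly_fun_diff)
qed

text \<open>The local parameter t satisfies X - x0 = t^2. As x0 is a simple root, g has order 2 in
  t, which is even, so that a square root exists and Y has order 1.\<close>

lemma exists_good_valuation_ramified:
  assumes "poly g x0 = 0"
  shows "\<exists>v. good_valuation g (Aff x0 0) v"
proof -
  define \<zeta> where "\<zeta> = (fls_X :: 'a fls) * fls_X"
  have \<zeta>: "fls_subdegree \<zeta> = 2" by (simp add: \<zeta>_def)
  define \<xi> where "\<xi> = fls_const x0 + \<zeta>"
  define f where "f = poly (map_poly fls_const g) \<xi>"
  have g0: "g \<noteq> 0" using odd_degree by auto
  obtain h where gh: "g = [:- x0, 1:] ^ 1 * h" "\<not> [:- x0, 1:] dvd h"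
    using order_decomp[OF g0, of x0] simple_roots[OF assms] by metis
  have "poly h x0 \<noteq> 0" using gh(2) by (simp add: poly_eq_0_iff_dvd)
  then have sh: "fls_subdegree (poly (map_poly fls_const h) \<xi>) = 0" "poly (map_poly fls_const h) \<xi> \<noteq> 0"
    unfolding \<xi>_def using subdegree_ev_nonroot[of \<zeta> h x0] \<zeta> by auto
  have f: "f = \<zeta> * poly (map_poly fls_const h) \<xi>"
    unfolding f_def gh(1) fls_const.map_poly_times by (simp add: map_poly_pCons \<xi>_def distrib_right)
  have "\<zeta> \<noteq> 0" using \<zeta> by auto
  then have sf: "fls_subdegree f = 2" "f \<noteq> 0" using sh \<zeta> by (simp_all add: f)
  obtain \<eta> where \<eta>: "\<eta>\<^sup>2 = f" using fls_sqrt_exists[OF sf(2)] sf(1) by auto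
  have "\<eta> \<noteq> 0" using \<eta> sf(2) by auto
  then have s\<eta>: "fls_subdegree \<eta> = 1" using sf(1) by (simp add: power2_eq_square flip: \<eta>)
  have "\<xi> \<notin> range fls_const"
    using fls_const_image_subdegree[of \<xi> x0] \<zeta> by (auto simp: \<xi>_def)
  then interpret curve_parametrization g \<xi> \<eta>
    using \<eta> by unfold_locales (simp_all add: f_def)
  have "expand (poly_fun [:- x0, 1:] 0) = \<xi> - fls_const x0"
    by (simp add: expand_poly_fun ev_pCons)
  also have "\<dots> = \<zeta>" by (simp add: \<xi>_def)
  finally have X: "place (poly_fun [:- x0, 1:] 0) = 2" by (simp add: place_def \<zeta>)
  have Y: "place (poly_fun 0 1) = 1"
    by (simp add: place_def expand_poly_fun ev_1 s\<eta>)
  show ?thesis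
    using discrete_valuation_place[OF Y] place_residue X Y
    by (intro exI[of _ place]) (simp add: good_valuation_def X_fun_eq Y_fun_eq const_fun_eq poly_fun_diff)
qed

text \<open>With X = t^(-2) the order of g in t is - 2 deg g, hence even although deg g is odd, and
  Y gets the order - deg g.\<close>

lemma exists_good_valuation_infinity: "\<exists>v. good_valuation g Infty v"
proof -
  define \<xi> where "\<xi> = (fls_X_inv :: 'a fls) * fls_X_inv"
  have \<xi>: "fls_subdegree \<xi> = - 2" "\<xi> \<noteq> 0" by (simp_all add: \<xi>_def)
  have deg: "fls_subdegree (poly (map_poly fls_const p) \<xi>) = - 2 * int (degree p) \<and> poly (map_poly fls_const p) \<xi> \<noteq> 0"
    if "p \<noteq> 0" for p :: "'a poly"
    using that
  proof (induction p)
    case (pCons a p)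
    show ?case
    proof (cases "p = 0")
      case True
      then show ?thesis using pCons by (simp add: map_poly_pCons)
    next
      case False
      let ?s = "poly (map_poly fls_const p) \<xi>"
      have s: "\<xi> * ?s \<noteq> 0" "fls_subdegree (\<xi> * ?s) = - 2 * int (degree (pCons a p))"
        using pCons.IH False \<xi> by simp_all
      then have "fls_subdegree (\<xi> * ?s) < fls_subdegree (fls_const a)" using False by simp
      from fls_subdegree_add_eq2[OF s(1) this] s have *: "fls_subdegree (fls_const a + \<xi> * ?s) = - 2 * int (degree (pCons a p))"
        by simp
      then have "fls_const a + \<xi> * ?s \<noteq> 0" using False by auto
      then show ?thesis using * by (simp add: map_poly_pCons)
    qed
  qed simp
  have g0: "g \<noteq> 0" using odd_degree by auto
  define f where "f = poly (map_poly fls_const g) \<xi>"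
  have sf: "fls_subdegree f = - 2 * int (degree g)" "f \<noteq> 0" unfolding f_def using deg[OF g0] by blast+
  obtain \<eta> where \<eta>: "\<eta>\<^sup>2 = f" using fls_sqrt_exists[OF sf(2)] sf(1) by auto
  have "\<eta> \<noteq> 0" using \<eta> sf(2) by auto
  then have s\<eta>: "fls_subdegree \<eta> = - int (degree g)" using sf(1) by (simp add: power2_eq_square flip: \<eta>)
  have "\<xi> \<notin> range fls_const" using \<xi> by auto
  then interpret curve_parametrization g \<xi> \<eta>
    using \<eta> by unfold_locales (simp_all add: f_def)
  have pl: "place (poly_fun p 0) = - 2 * int (degree p)" if "p \<noteq> 0" for p
    using deg[OF that] by (simp add: place_def expand_poly_fun ev_def)
  define \<gamma> where "\<gamma> = degree g div 2"
  have n: "degree g = 2 * \<gamma> + 1" using odd_degree by (simp add: \<gamma>_def)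
  have "fmul (poly_fun g 0) (uniformizer Infty) = fmul (poly_fun (monom 1 \<gamma>) 0) (poly_fun 0 1)"
    using g0 by (simp add: uniformizer_def \<gamma>_def poly_fun_def fmul_pair)
  moreover have "place (fmul (poly_fun g 0) (uniformizer Infty)) = place (poly_fun g 0) + place (uniformizer Infty)"
    using g0 uniformizer_nonzero by (intro place_mult) (simp_all add: poly_fun_eq_0_iff)
  moreover have "place (fmul (poly_fun (monom 1 \<gamma>) 0) (poly_fun 0 1)) = place (poly_fun (monom 1 \<gamma>) 0) + place (poly_fun 0 1)"
    by (intro place_mult) (simp_all add: poly_fun_eq_0_iff)
  moreover have "place (poly_fun 0 1) = - int (degree g)"
    by (simp add: place_def expand_poly_fun ev_1 s\<eta>)
  ultimately have T: "place (uniformizer Infty) = 1"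
    using pl[OF g0] pl[of "monom 1 \<gamma>"] by (simp add: degree_monom_eq n)
  show ?thesis
    using discrete_valuation_place[OF T] place_residue pl[of "[:0, 1:]"]
    by (intro exI[of _ place]) (simp add: good_valuation_def X_fun_eq)
qed

lemma exists_good_valuation:
  assumes "P \<in> curve_points g"
  shows "\<exists>v. good_valuation g P v"
proof (cases P)
  case Infty
  then show ?thesis using exists_good_valuation_infinity by simp
next
  case (Aff x y)
  then have "y\<^sup>2 = poly g x" using assms by (auto simp: curve_points_def)
  then show ?thesis
    using exists_good_valuation_unramified[of y x] exists_good_valuation_ramified[of x] Aff by (cases "y = 0") auto
qed

lemma ord_at_eqI:
  assumes "P \<in> curve_points g" "discrete_valuation g v" "centred_at v P"
  shows "ord_at g P = v"
  unfolding ord_at_def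
  by (rule the_equality) (use assms valuation_unique in blast)+

lemma good_valuation_ord_at:
  assumes "P \<in> curve_points g"
  shows "good_valuation g P (ord_at g P)"
  using exists_good_valuation[OF assms] ord_at_eqI[OF assms] by (auto simp: good_valuation_def)

lemma ord_at_uniformizer: "P \<in> curve_points g \<Longrightarrow> ord_at g P (uniformizer P) = 1"
  using valuation_uniformizer good_valuation_ord_at by (auto simp: good_valuation_def)

lemma curve_valuation_ord_at: "P \<in> curve_points g \<Longrightarrow> curve_valuation g (ord_at g P)"
  using good_valuation_ord_at by unfold_locales (auto simp: good_valuation_def)

lemma affine_valuation_ord_at: "Aff x y \<in> curve_points g \<Longrightarrow> affine_valuation g (ord_at g (Aff x y)) x y"
  using good_valuation_ord_at[of "Aff x y"]
  by unfold_locales (auto simp: good_valuation_def curve_points_def)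

end

section \<open>Equivariance of the valuations\<close>

locale curve_automorphism = closed_curve +
  fixes \<sigma> :: "'a \<Rightarrow> 'a"
  assumes hom: "field_hom \<sigma>" and bij: "bij \<sigma>" and fixes_g: "map_poly \<sigma> g = g"
begin

sublocale sigma: field_hom \<sigma>
  by (rule hom)

sublocale lift: inj_hom_into_field "\<lambda>p. to_fract (map_poly \<sigma> p)"
  by unfold_locales
     (simp_all add: sigma.map_poly_plus sigma.map_poly_times sigma.map_poly_one sigma.map_poly_hom_eq_0_iff)

definition act_fun :: "'a curve_fun \<Rightarrow> 'a curve_fun" where
  "act_fun F = (fract_lift (\<lambda>p. to_fract (map_poly \<sigma> p)) (fst F), fract_lift (\<lambda>p. to_fract (map_poly \<sigma> p)) (snd F))"

lemma act_fun_poly_fun: "act_fun (poly_fun A B) = poly_fun (map_poly \<sigma> A) (map_poly \<sigma> B)"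
  by (simp add: act_fun_def poly_fun_def)

lemma act_fun_0 [simp]: "act_fun 0 = 0"
  by (simp add: act_fun_def zero_prod_def)

lemma act_fun_add: "act_fun (F + H) = act_fun F + act_fun H"
  by (simp add: act_fun_def lift.fract_lift_add)

lemma act_fun_mult: "act_fun (fmul F H) = fmul (act_fun F) (act_fun H)"
  by (cases F; cases H)
     (simp add: act_fun_def fmul_pair lift.fract_lift_add lift.fract_lift_mult fixes_g)

lemma act_fun_eq_0_iff: "act_fun F = 0 \<longleftrightarrow> F = 0"
proof
  assume *: "act_fun F = 0"
  show "F = 0"
  proof (rule ccontr)
    assume "F \<noteq> 0"
    then obtain H where "fmul F H = poly_fun 1 0" by (rule exists_fmul_inverse)
    then have "fmul (act_fun F) (act_fun H) = poly_fun 1 0"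
      using act_fun_mult[of F H] by (simp add: act_fun_poly_fun sigma.map_poly_one)
    then show False using * by (simp add: poly_fun_eq_0_iff)
  qed
qed simp

lemma map_poly_surj: "\<exists>q. map_poly \<sigma> q = p"
proof (intro exI poly_eqI)
  fix i
  have "inv_into UNIV \<sigma> 0 = 0" using bij by (metis bij_inv_eq_iff sigma.hom_zero)
  then show "coeff (map_poly \<sigma> (map_poly (inv_into UNIV \<sigma>) p)) i = coeff p i"
    using bij by (simp add: coeff_map_poly bij_is_surj surj_f_inv_f)
qed

lemma act_fun_surj: "surj act_fun"
  unfolding surj_def
proof
  fix F :: "'a curve_fun"
  obtain A B C where C: "C \<noteq> 0" "F = (to_fract A / to_fract C, to_fract B / to_fract C)"
    using fract_pair_cases .
  obtain A' B' C' where ABC: "map_poly \<sigma> A' = A" "map_poly \<sigma> B' = B" "map_poly \<sigma> C' = C"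
    using map_poly_surj by metis
  have "C' \<noteq> 0" using ABC(3) C(1) by auto
  then have "act_fun (to_fract A' / to_fract C', to_fract B' / to_fract C') = F"
    by (simp add: act_fun_def lift.fract_lift_divide ABC C(2))
  then show "\<exists>H. F = act_fun H" by metis
qed

lemma map_curve_point_in: "P \<in> curve_points g \<Longrightarrow> map_curve_point \<sigma> P \<in> curve_points g"
  using sigma.poly_map_poly_hom[of g] unfolding fixes_g curve_points_def by (auto simp flip: sigma.hom_power)

text \<open>The order at the image point, pulled back along the automorphism, is again a normalised
  valuation and is centred at P. By uniqueness it is the order at P.\<close>

lemma ord_at_act:
  assumes "P \<in> curve_points g"
  shows "ord_at g (map_curve_point \<sigma> P) (act_fun F) = ord_at g P F"
proof -
  define Q where "Q = map_curve_point \<sigma> P"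
  have Q: "Q \<in> curve_points g" unfolding Q_def by (rule map_curve_point_in[OF assms])
  interpret w: curve_valuation g "ord_at g Q" by (rule curve_valuation_ord_at[OF Q])
  have cen: "centred_at (ord_at g Q) Q" using good_valuation_ord_at[OF Q] by (simp add: good_valuation_def)
  define v where "v = (\<lambda>F. ord_at g Q (act_fun F))"
  have "discrete_valuation g v"
    unfolding discrete_valuation_def const_fun_eq fmul_def [symmetric]
  proof (intro conjI allI impI)
    show "v 0 = 0" by (simp add: v_def)
    show "surj v" using comp_surj[OF act_fun_surj w.v_surj] by (simp add: v_def comp_def)
    show "v (poly_fun [:c:] 0) = 0" if "c \<noteq> 0" for c
      using w.v_const[of "\<sigma> c"] that by (simp add: v_def act_fun_poly_fun map_poly_pCons)
    show "v (fmul F H) = v F + v H" if "F \<noteq> 0" "H \<noteq> 0" for F H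
      using that by (simp add: v_def act_fun_mult w.v_mult act_fun_eq_0_iff)
    show "min (v F) (v H) \<le> v (F + H)" if "F \<noteq> 0" "H \<noteq> 0" "F + H \<noteq> 0" for F H
      using w.v_add[of "act_fun F" "act_fun H"] that act_fun_eq_0_iff[of "F + H"]
      by (simp add: v_def act_fun_add act_fun_eq_0_iff)
  qed
  moreover have "centred_at v P"
    using cen by (cases P) (auto simp: Q_def v_def X_fun_eq Y_fun_eq const_fun_eq poly_fun_diff act_fun_poly_fun
        map_poly_pCons sigma.hom_uminus sigma.map_poly_one)
  ultimately have "ord_at g P = v" by (rule ord_at_eqI[OF assms])
  then show ?thesis by (simp add: v_def Q_def)
qed

end

section \<open>Principal divisors\<close>

abbreviation coef :: "('b \<Rightarrow>\<^sub>0 int) \<Rightarrow> 'b \<Rightarrow> int" where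
  "coef \<equiv> Poly_Mapping.lookup"

section \<open>Degrees of divisors\<close>

lemma div_degree_superset:
  assumes "finite S" "Poly_Mapping.keys D \<subseteq> S"
  shows "div_degree D = (\<Sum>P\<in>S. coef D P)"
  unfolding div_degree_def
  by (rule sum.mono_neutral_left) (use assms in \<open>auto simp: in_keys_iff\<close>)

lemma div_degree_add: "div_degree (D + E) = div_degree D + div_degree E"
proof -
  define S where "S = Poly_Mapping.keys D \<union> Poly_Mapping.keys E"
  have S: "finite S" "Poly_Mapping.keys D \<subseteq> S" "Poly_Mapping.keys E \<subseteq> S" "Poly_Mapping.keys (D + E) \<subseteq> S"
    using Poly_Mapping.keys_add[of D E] by (auto simp: S_def)
  then show ?thesis
    using div_degree_superset[OF S(1)] by (simp add: lookup_add sum.distrib)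
qed

lemma div_degree_uminus: "div_degree (- D) = - div_degree D"
  by (simp add: div_degree_def sum_negf)

lemma div_degree_diff: "div_degree (D - E) = div_degree D - div_degree E"
  using div_degree_add[of D "- E"] div_degree_uminus[of E] by simp

lemma div_degree_0 [simp]: "div_degree 0 = 0"
  by (simp add: div_degree_def)

lemma div_degree_frag_of [simp]: "div_degree (frag_of P) = 1"
  by (simp add: div_degree_def)

lemma div_degree_cmul: "div_degree (frag_cmul k D) = k * div_degree D"
proof (cases "k = 0")
  case False
  then have "Poly_Mapping.keys (frag_cmul k D) = Poly_Mapping.keys D" by auto
  then show ?thesis by (simp add: div_degree_def sum_distrib_left)
qed simp

section \<open>Orders of polynomial functions, and functions without affine poles\<close>

context closed_curve
begin

lemma valuation_at: "P \<in> curve_points g \<Longrightarrow> curve_valuation g (ord_at g P)"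
  by (rule curve_valuation_ord_at)

lemma Aff_minus: "Aff x y \<in> curve_points g \<Longrightarrow> Aff x (- y) \<in> curve_points g"
  by (auto simp: curve_points_def)

lemma exists_point_over: "\<exists>y. Aff x y \<in> curve_points g"
  using nth_root_exists[of 2 "poly g x"] by (auto simp: curve_points_def)

lemma Infty_in: "Infty \<in> curve_points g"
  by (simp add: curve_points_def)

lemma centred_at_ord_at: "P \<in> curve_points g \<Longrightarrow> centred_at (ord_at g P) P"
  using good_valuation_ord_at by (auto simp: good_valuation_def)

lemma ord_mult: "P \<in> curve_points g \<Longrightarrow> F \<noteq> 0 \<Longrightarrow> H \<noteq> 0 \<Longrightarrow> ord_at g P (fmul F H) = ord_at g P F + ord_at g P H"
  using curve_valuation.v_mult[OF valuation_at] by blast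

lemma ord_at_linear:
  assumes "Aff x y \<in> curve_points g"
  shows "ord_at g (Aff x y) (poly_fun [:- a, 1:] 0) = (if x = a then if y = 0 then 2 else 1 else 0)"
proof -
  interpret v: affine_valuation g "ord_at g (Aff x y)" x y by (rule affine_valuation_ord_at[OF assms])
  show ?thesis
  proof (cases "x = a")
    case False
    then show ?thesis using v.v_poly_fun_nonroot[of "[:- a, 1:]" 0] by simp
  next
    case True
    show ?thesis
    proof (cases "y = 0")
      case False
      then show ?thesis using ord_at_uniformizer[OF assms] True by (simp add: uniformizer_def)
    next
      case y: True
      have "poly g x = 0" using assms y by (simp add: curve_points_def)
      then have "order x g = 1" by (rule simple_roots)
      moreover have "g \<noteq> 0" using odd_degree by auto
      ultimately have "ord_at g (Aff x y) (poly_fun [:- x, 1:] 0) = 2 * ord_at g (Aff x y) (poly_fun 0 1)"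
        using v.v_Y v.v_poly[of g] by simp
      moreover have "ord_at g (Aff x y) (poly_fun 0 1) = 1"
        using ord_at_uniformizer[OF assms] y by (simp add: uniformizer_def)
      ultimately show ?thesis using y True by simp
    qed
  qed
qed

lemma ord_at_infinity_poly: "p \<noteq> 0 \<Longrightarrow> ord_at g Infty (poly_fun p 0) = - 2 * int (degree p)"
  using curve_valuation.v_infinity(2)[OF valuation_at[OF Infty_in] centred_at_ord_at[OF Infty_in]]
    ord_at_uniformizer[OF Infty_in] by simp

lemma ord_at_infinity_poly_fun:
  assumes "A \<noteq> 0 \<or> B \<noteq> 0"
  shows "ord_at g Infty (poly_fun A B) = - (if B = 0 then 2 * int (degree A) else if A = 0 then 2 * int (degree B) + int (degree g)
     else max (2 * int (degree A)) (2 * int (degree B) + int (degree g)))"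
  using curve_valuation.v_poly_fun_infinity[OF valuation_at[OF Infty_in] centred_at_ord_at[OF Infty_in] assms]
    ord_at_uniformizer[OF Infty_in] by simp

text \<open>The divisor of X - a is that of a vertical line. For b = 0 the two affine points
  coincide and the coefficient becomes 2, so ramification points are covered as well.\<close>

lemma ord_at_linear_coef:
  assumes "Aff a b \<in> curve_points g" "P \<in> curve_points g"
  shows "ord_at g P (poly_fun [:- a, 1:] 0)
    = coef (frag_of (Aff a b) + frag_of (Aff a (- b)) - frag_cmul 2 (frag_of Infty)) P"
proof (cases P)
  case Infty
  then show ?thesis using ord_at_infinity_poly[of "[:- a, 1:]"] by (simp add: lookup_add lookup_minus)
next
  case (Aff x y)
  have "y = b \<or> y = - b" if "x = a"
  proof -
    have "y\<^sup>2 = b\<^sup>2" using that assms Aff by (simp add: curve_points_def)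
    then show ?thesis by (simp add: power2_eq_iff)
  qed
  then show ?thesis
    using ord_at_linear[of x y a] assms Aff by (auto simp: lookup_add lookup_minus)
qed

text \<open>The affine coordinate ring is integrally closed. With a denominator C of least degree,
  at a root x of C the numerator A + B Y vanishes at all points over x; hence A and B vanish at x,
  and a factor X - x can be cancelled.\<close>

lemma regular_affine:
  assumes "\<And>x y. Aff x y \<in> curve_points g \<Longrightarrow> F = 0 \<or> ord_at g (Aff x y) F \<ge> 0"
  obtains A B where "F = poly_fun A B"
proof (cases "F = 0")
  case True
  then show ?thesis using that[of 0 0] by simp
next
  case F0: False
  define Q where "Q = (\<lambda>C. C \<noteq> 0 \<and> (\<exists>A B. fmul (poly_fun C 0) F = poly_fun A B))"
  obtain C0 where "Q C0" using curve_fun_cases[of F] unfolding Q_def by metis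
  then obtain C where C: "Q C" and min: "\<And>C'. Q C' \<Longrightarrow> degree C \<le> degree C'"
    using ex_has_least_nat[of Q C0 degree] by blast
  then obtain A B where AB: "C \<noteq> 0" "fmul (poly_fun C 0) F = poly_fun A B" by (auto simp: Q_def)
  have AB0: "A \<noteq> 0 \<or> B \<noteq> 0" using AB F0 by (metis fmul_eq_0_iff poly_fun_eq_0_iff)
  have "degree C = 0"
  proof (rule ccontr)
    assume "degree C \<noteq> 0"
    then obtain x where x: "poly C x = 0" using alg_closed_imp_poly_has_root by blast
    obtain y where y: "Aff x y \<in> curve_points g" using exists_point_over by blast
    have ord: "ord_at g P (poly_fun A B) \<ge> ord_at g P (poly_fun C 0)" if "P = Aff x y \<or> P = Aff x (- y)" for P
    proof -
      have P: "P \<in> curve_points g" using that y Aff_minus by auto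
      have "ord_at g P F \<ge> 0" using assms[of x y] assms[of x "- y"] that y Aff_minus F0 by auto
      then show ?thesis using ord_mult[OF P, of "poly_fun C 0" F] AB F0 by (simp add: poly_fun_eq_0_iff)
    qed
    have root: "poly A x + poly B x * z = 0" if "z = y \<or> z = - y" for z
    proof -
      have P: "Aff x z \<in> curve_points g" using that y Aff_minus by auto
      interpret v: affine_valuation g "ord_at g (Aff x z)" x z by (rule affine_valuation_ord_at[OF P])
      have "ord_at g (Aff x z) (poly_fun C 0) > 0" using v.v_poly_fun_pos_iff[of C 0] AB(1) x by simp
      then have "ord_at g (Aff x z) (poly_fun A B) > 0" using ord[of "Aff x z"] that by auto
      then show ?thesis using v.v_poly_fun_pos_iff[OF AB0] by simp
    qed
    have "poly A x = 0 \<and> poly B x = 0"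
    proof (cases "y = 0")
      case False
      have 1: "poly A x + poly B x * y = 0" and 2: "poly A x - poly B x * y = 0" using root[of y] root[of "- y"] by simp_all
      then have "poly A x = poly B x * y" by simp
      then have "2 * (poly B x * y) = 0" using 1 by auto
      then show ?thesis using False 2 by auto
    next
      case True
      have A0: "poly A x = 0" using root[of y] True by simp
      interpret v: affine_valuation g "ord_at g (Aff x y)" x y by (rule affine_valuation_ord_at[OF y])
      have lin: "ord_at g (Aff x y) (poly_fun [:- x, 1:] 0) = 2" using ord_at_linear[OF y] True by simp
      have ge2: "v.vge 2 (poly_fun p 0)" if "poly p x = 0" for p
      proof (cases "p = 0")
        case False
        then have "order x p \<ge> 1" using that by (simp add: order_root Suc_leI)
        then show ?thesis using v.v_poly[OF False] lin by (simp add: v.vge_def)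
      qed simp
      \<comment> \<open>At a ramification point there is only one point over x, so the second
        condition comes from orders: X - x has order 2 and Y order 1, and B Y of order at least 2
        forces B to vanish at x.\<close>
      have "v.vge 2 (poly_fun A B)"
        using ge2[OF x] ord[of "Aff x y"] AB(1) by (auto simp: v.vge_def poly_fun_eq_0_iff)
      then have "v.vge 2 (poly_fun A B - poly_fun A 0)" using ge2[OF A0] by (rule v.vge_diff)
      moreover have "poly_fun A B - poly_fun A 0 = fmul (poly_fun B 0) (poly_fun 0 1)"
        by (simp add: poly_fun_diff fmul_poly_fun)
      moreover have "ord_at g (Aff x y) (poly_fun 0 1) = 1"
        using ord_at_uniformizer[OF y] True by (simp add: uniformizer_def)
      ultimately have "B = 0 \<or> ord_at g (Aff x y) (poly_fun B 0) > 0"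
        using v.v_mult[of "poly_fun B 0" "poly_fun 0 1"] by (cases "B = 0") (auto simp: v.vge_def fmul_eq_0_iff poly_fun_eq_0_iff)
      then have "poly B x = 0" using v.v_poly_fun_pos_iff[of B 0] by (cases "B = 0") auto
      then show ?thesis using A0 by simp
    qed
    then obtain A1 B1 C1 where f: "A = [:- x, 1:] * A1" "B = [:- x, 1:] * B1" "C = [:- x, 1:] * C1"
      using x unfolding poly_eq_0_iff_dvd by (elim conjE dvdE)
    have C1: "C1 \<noteq> 0" using AB(1) f by auto
    have "fmul (poly_fun [:- x, 1:] 0) (fmul (poly_fun C1 0) F - poly_fun A1 B1) = 0"
    proof -
      have "fmul (poly_fun [:- x, 1:] 0) (poly_fun A1 B1) = poly_fun A B"
        "fmul (poly_fun [:- x, 1:] 0) (poly_fun C1 0) = poly_fun C 0"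
        by (simp_all only: f fmul_poly_fun mult_zero_left mult_zero_right add_0_right)
      then show ?thesis by (simp only: fmul_diff_right fmul_assoc [symmetric] AB(2) diff_self)
    qed
    then have "fmul (poly_fun C1 0) F = poly_fun A1 B1" by (simp add: fmul_eq_0_iff poly_fun_eq_0_iff)
    then have "Q C1" using C1 by (auto simp: Q_def)
    moreover have "degree C = degree [:- x, 1:] + degree C1" unfolding f(3) using C1 by (subst degree_mult_eq) auto
    ultimately show False using min[of C1] by simp
  qed
  then obtain c where c: "C = [:c:]" by (meson degree_eq_zeroE)
  then have c0: "c \<noteq> 0" using AB(1) by auto
  have "F = fmul (fmul (poly_fun [:1 / c:] 0) (poly_fun [:c:] 0)) F"
    using c0 by (simp add: fmul_poly_fun flip: one_pCons)
  also have "\<dots> = fmul (poly_fun [:1 / c:] 0) (poly_fun A B)" using AB(2) c by (simp only: fmul_assoc)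
  also have "\<dots> = poly_fun (smult (1 / c) A) (smult (1 / c) B)" by (simp add: fmul_poly_fun)
  finally show ?thesis by (rule that)
qed

text \<open>Adding up divisors of X - x over the affine points of D bounds D, away from infinity, by
  a principal divisor. The absolute value serves the induction, which passes to differences of
  divisors.\<close>

lemma exists_dominating_poly:
  assumes "Poly_Mapping.keys D \<subseteq> curve_points g"
  shows "\<exists>h E. h \<noteq> 0 \<and> Poly_Mapping.keys E \<subseteq> curve_points g \<and> div_degree E = 0
     \<and> (\<forall>P\<in>curve_points g. coef E P = ord_at g P (poly_fun h 0)) \<and> (\<forall>x y. \<bar>coef D (Aff x y)\<bar> \<le> coef E (Aff x y))"
  using assms
proof (induction rule: frag_induction)
  case zero
  have "coef 0 P = ord_at g P (poly_fun 1 0)" if "P \<in> curve_points g" for P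
    using curve_valuation.v_const[OF valuation_at[OF that], of 1] by (simp flip: one_pCons)
  then show ?case by (intro exI[of _ 1] exI[of _ 0]) simp
next
  case (one P)
  show ?case
  proof (cases P)
    case Infty
    have "coef 0 P = ord_at g P (poly_fun 1 0)" if "P \<in> curve_points g" for P
      using curve_valuation.v_const[OF valuation_at[OF that], of 1] by (simp flip: one_pCons)
    then show ?thesis using Infty by (intro exI[of _ 1] exI[of _ 0]) simp
  next
    case (Aff x y)
    define E where "E = frag_of (Aff x y) + frag_of (Aff x (- y)) - frag_cmul 2 (frag_of Infty)"
    have xy: "Aff x y \<in> curve_points g" using one Aff by simp
    have "Poly_Mapping.keys E \<subseteq> {Aff x y, Aff x (- y), Infty}"
      unfolding E_def by (auto simp: in_keys_iff lookup_add lookup_minus split: if_splits)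
    then have "Poly_Mapping.keys E \<subseteq> curve_points g" using xy Aff_minus Infty_in by auto
    moreover have "div_degree E = 0" by (simp add: E_def div_degree_add div_degree_diff div_degree_cmul)
    moreover have "\<bar>coef (frag_of P) (Aff x' y')\<bar> \<le> coef E (Aff x' y')" for x' y'
      by (simp add: Aff E_def lookup_add lookup_minus)
    ultimately show ?thesis
      using ord_at_linear_coef[OF xy] by (intro exI[of _ "[:- x, 1:]"] exI[of _ E]) (simp add: E_def)
  qed
next
  case (diff D1 D2)
  then obtain h1 E1 h2 E2 where
    1: "h1 \<noteq> 0" "Poly_Mapping.keys E1 \<subseteq> curve_points g" "div_degree E1 = 0"
      "\<And>P. P \<in> curve_points g \<Longrightarrow> coef E1 P = ord_at g P (poly_fun h1 0)" "\<And>x y. \<bar>coef D1 (Aff x y)\<bar> \<le> coef E1 (Aff x y)"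
    and 2: "h2 \<noteq> 0" "Poly_Mapping.keys E2 \<subseteq> curve_points g" "div_degree E2 = 0"
      "\<And>P. P \<in> curve_points g \<Longrightarrow> coef E2 P = ord_at g P (poly_fun h2 0)" "\<And>x y. \<bar>coef D2 (Aff x y)\<bar> \<le> coef E2 (Aff x y)"
    by blast
  have "Poly_Mapping.keys (E1 + E2) \<subseteq> curve_points g" using Poly_Mapping.keys_add[of E1 E2] 1(2) 2(2) by blast
  moreover have "coef (E1 + E2) P = ord_at g P (poly_fun (h1 * h2) 0)" if "P \<in> curve_points g" for P
    using curve_valuation.v_poly_mult[OF valuation_at[OF that] 1(1) 2(1)] 1(4)[OF that] 2(4)[OF that]
    by (simp add: lookup_add)
  moreover have "\<bar>coef (D1 - D2) (Aff x y)\<bar> \<le> coef (E1 + E2) (Aff x y)" for x y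
    using 1(5)[of x y] 2(5)[of x y] by (simp add: lookup_add lookup_minus)
  ultimately show ?case
    using 1(1,3) 2(1,3) by (intro exI[of _ "h1 * h2"] exI[of _ "E1 + E2"]) (simp add: div_degree_add)
qed

section \<open>The genus\<close>

lemma scale_fun_eq: "scale_fun c F = fmul (poly_fun [:c:] 0) F"
  by (cases F) (simp add: scale_fun_def fmul_poly_left to_fract_def)

sublocale fs: vector_space "scale_fun :: 'a \<Rightarrow> 'a curve_fun \<Rightarrow> 'a curve_fun"
proof
  fix a b :: 'a and F H :: "'a curve_fun"
  show "scale_fun a (F + H) = scale_fun a F + scale_fun a H"
    by (simp add: scale_fun_eq fmul_add_right)
  show "scale_fun (a + b) F = scale_fun a F + scale_fun b F"
    by (simp add: scale_fun_eq poly_fun_add flip: fmul_add_left)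
  show "scale_fun a (scale_fun b F) = scale_fun (a * b) F"
    by (simp add: scale_fun_eq fmul_poly_fun mult.commute flip: fmul_assoc)
  show "scale_fun 1 F = F"
    by (simp add: scale_fun_eq flip: one_pCons)
qed

section \<open>Dimensions of Riemann-Roch spaces\<close>

lemma riemann_roch_iff:
  "F \<in> riemann_roch_space g D \<longleftrightarrow> (\<forall>P\<in>curve_points g. F = 0 \<or> ord_at g P F \<ge> - coef D P)"
  using Infty_in by (auto simp: riemann_roch_space_def)

lemma subspace_riemann_roch: "fs.subspace (riemann_roch_space g D)"
proof (rule fs.subspaceI)
  show "0 \<in> riemann_roch_space g D" by (simp add: riemann_roch_iff)
  fix F H c assume F: "F \<in> riemann_roch_space g D"
  show "scale_fun c F \<in> riemann_roch_space g D"
    unfolding riemann_roch_iff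
  proof
    fix P assume P: "P \<in> curve_points g"
    interpret v: curve_valuation g "ord_at g P" by (rule valuation_at[OF P])
    have "v.vge (0 + - coef D P) (fmul (poly_fun [:c:] 0) F)"
      using F P by (intro v.vge_mult v.vge_const) (auto simp: riemann_roch_iff v.vge_def)
    then show "scale_fun c F = 0 \<or> - coef D P \<le> ord_at g P (scale_fun c F)"
      by (simp add: scale_fun_eq v.vge_def)
  qed
  assume H: "H \<in> riemann_roch_space g D"
  show "F + H \<in> riemann_roch_space g D"
    unfolding riemann_roch_iff
  proof
    fix P assume P: "P \<in> curve_points g"
    interpret v: curve_valuation g "ord_at g P" by (rule valuation_at[OF P])
    have "v.vge (- coef D P) (F + H)"
      using F H P by (intro v.vge_add) (auto simp: riemann_roch_iff v.vge_def)
    then show "F + H = 0 \<or> - coef D P \<le> ord_at g P (F + H)" by (simp add: v.vge_def)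
  qed
qed

text \<open>A basis of U together with one element H outside U spans V. The finite set S keeps the
  dimensions meaningful, as \<open>fs.dim\<close> is 0 on infinite-dimensional spaces.\<close>

lemma dim_codim_1:
  assumes "fs.subspace U" "U \<subseteq> V" "finite S" "V \<subseteq> fs.span S"
    and "\<And>F H. F \<in> V \<Longrightarrow> H \<in> V \<Longrightarrow> H \<notin> U \<Longrightarrow> \<exists>c. F - scale_fun c H \<in> U"
  shows "fs.dim V \<le> fs.dim U + 1"
proof -
  obtain B where B: "B \<subseteq> U" "fs.independent B" "U \<subseteq> fs.span B" "card B = fs.dim U"
    using fs.basis_exists by blast
  have fin: "finite B" using fs.independent_span_bound[OF assms(3) B(2)] B(1) assms(2,4) by blast
  show ?thesis
  proof (cases "V \<subseteq> U")
    case True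
    then have "V = U" using assms(2) by blast
    then show ?thesis by simp
  next
    case False
    then obtain H where H: "H \<in> V" "H \<notin> U" by blast
    have "V \<subseteq> fs.span (insert H B)"
    proof
      fix F assume "F \<in> V"
      then obtain c where "F - scale_fun c H \<in> U" using assms(5) H by blast
      then show "F \<in> fs.span (insert H B)" using B(3) fs.span_breakdown_eq by blast
    qed
    then have "fs.dim V \<le> card (insert H B)" using fin by (intro fs.dim_le_card) auto
    also have "\<dots> \<le> card B + 1" using fin by (simp add: card_insert_if)
    finally show ?thesis using B(4) by simp
  qed
qed

text \<open>H attains at Q exactly the order - \<open>coef E Q\<close>, so the quotient F / H has no
  pole at Q. With c its residue there, F - c H has gained one order at Q.\<close>

lemma riemann_roch_step:
  assumes Q: "Q \<in> curve_points g" and "F \<in> riemann_roch_space g E"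
    and "H \<in> riemann_roch_space g E" "H \<notin> riemann_roch_space g (E - frag_of Q)"
  shows "\<exists>c. F - scale_fun c H \<in> riemann_roch_space g (E - frag_of Q)"
proof -
  interpret v: curve_valuation g "ord_at g Q" by (rule valuation_at[OF Q])
  obtain P where P: "P \<in> curve_points g" "H \<noteq> 0" "ord_at g P H < - coef (E - frag_of Q) P"
    using assms(4) unfolding riemann_roch_iff by force
  moreover have "ord_at g P H \<ge> - coef E P" using assms(3) P unfolding riemann_roch_iff by blast
  ultimately have "P = Q" "ord_at g Q H = - coef E Q"
    by (auto simp: lookup_minus split: if_splits)
  then have oH: "ord_at g Q H = - coef E Q" by simp
  obtain H' where H': "fmul H H' = poly_fun 1 0" "H' \<noteq> 0" using exists_fmul_inverse[OF P(2)] .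
  define G where "G = fmul F H'"
  have FG: "F = fmul G H"
  proof -
    have "fmul G H = fmul F (fmul H H')" by (simp only: G_def fmul_assoc fmul_commute[of H' H])
    then show ?thesis using H'(1) by simp
  qed
  have "ord_at g Q G \<ge> 0" if "G \<noteq> 0"
  proof -
    from that have "F \<noteq> 0" using FG P(2) by (simp add: fmul_eq_0_iff)
    then have "ord_at g Q F \<ge> - coef E Q" using assms(2) Q unfolding riemann_roch_iff by blast
    then show ?thesis using FG v.v_mult[OF that P(2)] oH by simp
  qed
  then have "G = 0 \<or> ord_at g Q G \<ge> 0" by blast
  then obtain c where c: "G - poly_fun [:c:] 0 = 0 \<or> ord_at g Q (G - poly_fun [:c:] 0) > 0"
    using good_valuation_ord_at[OF Q] unfolding good_valuation_def by blast
  have eq: "F - scale_fun c H = fmul (G - poly_fun [:c:] 0) H"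
    by (simp only: FG scale_fun_eq fmul_diff_right fmul_commute[of _ H])
  have "v.vge (1 + - coef E Q) (fmul (G - poly_fun [:c:] 0) H)"
    using c oH by (intro v.vge_mult) (auto simp: v.vge_def)
  then have "F - scale_fun c H = 0 \<or> ord_at g Q (F - scale_fun c H) \<ge> - coef (E - frag_of Q) Q"
    by (simp add: eq v.vge_def lookup_minus)
  moreover have "F - scale_fun c H \<in> riemann_roch_space g E"
    using assms(2,3) by (intro fs.subspace_diff[OF subspace_riemann_roch] fs.subspace_scale[OF subspace_riemann_roch])
  ultimately have "F - scale_fun c H \<in> riemann_roch_space g (E - frag_of Q)"
    unfolding riemann_roch_iff by (auto simp: lookup_minus)
  then show ?thesis by blast
qed

lemma riemann_roch_mono:
  assumes "\<And>P. P \<in> curve_points g \<Longrightarrow> coef D P \<le> coef E P"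
  shows "riemann_roch_space g D \<subseteq> riemann_roch_space g E"
  using assms unfolding riemann_roch_iff subset_iff by force

text \<open>Taking away one point lowers the dimension by at most 1. So deg D - l(D) does not
  decrease when the divisor grows, and the genus can be bounded on divisors large enough to be
  computed.\<close>

lemma dim_riemann_roch_lower:
  assumes "Poly_Mapping.keys D \<subseteq> curve_points g" "Poly_Mapping.keys E \<subseteq> curve_points g"
    and "\<And>P. P \<in> curve_points g \<Longrightarrow> coef D P \<le> coef E P" and "finite S" "riemann_roch_space g E \<subseteq> fs.span S"
  shows "int (fs.dim (riemann_roch_space g E)) \<le> int (fs.dim (riemann_roch_space g D)) + (div_degree E - div_degree D)"
  using assms(2,3,5)
proof (induction "nat (div_degree (E - D))" arbitrary: E rule: less_induct)
  case less
  have kED: "Poly_Mapping.keys (E - D) \<subseteq> curve_points g"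
    using Poly_Mapping.keys_diff[of E D] less.prems(1) assms(1) by blast
  have nonneg: "coef (E - D) P \<ge> 0" for P
  proof (cases "P \<in> curve_points g")
    case False
    then show ?thesis using kED by (metis in_keys_iff subsetD order_refl)
  qed (use less.prems(2) in \<open>simp add: lookup_minus\<close>)
  show ?case
  proof (cases "E - D = 0")
    case False
    then obtain Q where Q: "Q \<in> Poly_Mapping.keys (E - D)" by (metis all_not_in_conv keys_eq_empty)
    then have QC: "Q \<in> curve_points g" using kED by blast
    have pos: "coef (E - D) Q \<ge> 1" using Q nonneg[of Q] by (simp add: in_keys_iff)
    have "coef (E - D) Q \<le> div_degree (E - D)"
      unfolding div_degree_def using Q nonneg by (intro member_le_sum) auto
    then have deg: "div_degree (E - D) \<ge> 1" using pos by simp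
    define E' where "E' = E - frag_of Q"
    have "E' - D = (E - D) - frag_of Q" by (simp add: E'_def)
    then have "div_degree (E' - D) = div_degree (E - D) - 1" by (simp add: div_degree_diff)
    then have less': "nat (div_degree (E' - D)) < nat (div_degree (E - D))" using deg by simp
    have keys': "Poly_Mapping.keys E' \<subseteq> curve_points g"
      unfolding E'_def using Poly_Mapping.keys_diff[of E "frag_of Q"] less.prems(1) QC by auto
    have le': "coef D P \<le> coef E' P" if "P \<in> curve_points g" for P
      using less.prems(2)[OF that] pos by (auto simp: E'_def lookup_minus)
    have sub: "riemann_roch_space g E' \<subseteq> riemann_roch_space g E"
      by (rule riemann_roch_mono) (simp add: E'_def lookup_minus)
    have "int (fs.dim (riemann_roch_space g E')) \<le> int (fs.dim (riemann_roch_space g D)) + (div_degree E' - div_degree D)"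
      using sub less.prems(3) by (intro less.hyps[OF less' keys' le']) auto
    moreover have "fs.dim (riemann_roch_space g E) \<le> fs.dim (riemann_roch_space g E') + 1"
      by (rule dim_codim_1[OF subspace_riemann_roch sub assms(4) less.prems(3)])
        (rule riemann_roch_step[OF QC, of _ E, folded E'_def])
    moreover have "div_degree E' = div_degree E - 1" by (simp add: E'_def div_degree_diff)
    ultimately show ?thesis by simp
  qed simp
qed

text \<open>Multiplication by h turns the space into that of the functions A + B Y whose pole at
  infinity has order at most 2 M. For B this reads 2 deg B + 2 \<gamma> + 1 \<le> 2 M with \<gamma>
  = \<open>degree g div 2\<close>, that is, deg B < M - \<gamma>.\<close>

lemma riemann_roch_explicit:
  assumes h: "h \<noteq> 0" "fmul (poly_fun h 0) hi = poly_fun 1 0"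
    and E: "\<And>P. P \<in> curve_points g \<Longrightarrow> coef E P = ord_at g P (poly_fun h 0)"
    and M: "degree g \<le> M"
  defines "K \<equiv> M - degree g div 2"
  defines "L \<equiv> riemann_roch_space g (E + frag_cmul (2 * int M) (frag_of Infty))"
  shows "L = {fmul hi (poly_fun A B) | A B. degree A \<le> M \<and> (B = 0 \<or> degree B < K)}"
proof -
  have hi0: "hi \<noteq> 0" using h by (auto simp: poly_fun_eq_0_iff)
  have iff: "fmul hi (poly_fun A B) \<in> L \<longleftrightarrow> degree A \<le> M \<and> (B = 0 \<or> degree B < K)" for A B
  proof (cases "A = 0 \<and> B = 0")
    case True
    then show ?thesis by (simp add: L_def fs.subspace_0[OF subspace_riemann_roch])
  next
    case False
    then have AB: "A \<noteq> 0 \<or> B \<noteq> 0" and p0: "poly_fun A B \<noteq> 0" by (auto simp: poly_fun_eq_0_iff)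
    have ord: "ord_at g P (fmul hi (poly_fun A B)) = ord_at g P (poly_fun A B) - coef E P" if P: "P \<in> curve_points g" for P
    proof -
      have "ord_at g P (poly_fun h 0) + ord_at g P hi = ord_at g P (poly_fun 1 0)"
        using ord_mult[OF P, of "poly_fun h 0" hi] h hi0 by (simp add: poly_fun_eq_0_iff)
      also have "\<dots> = 0" using curve_valuation.v_const[OF valuation_at[OF P], of 1] by (simp flip: one_pCons)
      finally show ?thesis using ord_mult[OF P hi0 p0] E[OF P] by simp
    qed
    have n: "degree g = 2 * (degree g div 2) + 1" using odd_degree by simp
    have "fmul hi (poly_fun A B) \<in> L \<longleftrightarrow> ord_at g Infty (poly_fun A B) \<ge> - 2 * int M"
    proof
      assume "fmul hi (poly_fun A B) \<in> L"
      then show "ord_at g Infty (poly_fun A B) \<ge> - 2 * int M"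
        unfolding L_def riemann_roch_iff using ord[OF Infty_in] Infty_in hi0 p0
        by (auto simp: lookup_add fmul_eq_0_iff)
    next
      assume *: "ord_at g Infty (poly_fun A B) \<ge> - 2 * int M"
      have "ord_at g P (fmul hi (poly_fun A B)) \<ge> - coef (E + frag_cmul (2 * int M) (frag_of Infty)) P"
        if P: "P \<in> curve_points g" for P
      proof (cases P)
        case Infty
        then show ?thesis using * ord[OF P] by (simp add: lookup_add)
      next
        case (Aff x y)
        have "ord_at g P (poly_fun A B) \<ge> 0"
          using affine_valuation.v_poly_fun_nonneg[OF affine_valuation_ord_at] P Aff by blast
        then show ?thesis using ord[OF P] Aff by (simp add: lookup_add)
      qed
      then show "fmul hi (poly_fun A B) \<in> L" unfolding L_def riemann_roch_iff by blast
    qed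
    also have "\<dots> \<longleftrightarrow> degree A \<le> M \<and> (B = 0 \<or> degree B < K)"
      unfolding ord_at_infinity_poly_fun[OF AB] K_def using n M AB by auto
    finally show ?thesis .
  qed
  have "\<exists>A B. F = fmul hi (poly_fun A B)" if F: "F \<in> L" for F
  proof -
    have "fmul (poly_fun h 0) F = 0 \<or> ord_at g (Aff x y) (fmul (poly_fun h 0) F) \<ge> 0" if P: "Aff x y \<in> curve_points g" for x y
      using F P ord_mult[OF P, of "poly_fun h 0" F] h(1) E[OF P] unfolding L_def riemann_roch_iff
      by (force simp: lookup_add fmul_eq_0_iff poly_fun_eq_0_iff)
    then obtain A B where AB: "fmul (poly_fun h 0) F = poly_fun A B" by (rule regular_affine)
    have "F = fmul hi (fmul (poly_fun h 0) F)"
      using h(2) by (simp add: fmul_commute[of hi] flip: fmul_assoc)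
    then show ?thesis using AB by metis
  qed
  then show ?thesis using iff by blast
qed

text \<open>A basis is given by X^i / h for i \<le> M and X^j Y / h for j < K, indexed by a sum
  type; together they are (M + 1) + K elements.\<close>

lemma dim_riemann_roch_explicit:
  assumes h: "h \<noteq> 0"
    and E: "\<And>P. P \<in> curve_points g \<Longrightarrow> coef E P = ord_at g P (poly_fun h 0)"
    and M: "degree g \<le> M"
  defines "L \<equiv> riemann_roch_space g (E + frag_cmul (2 * int M) (frag_of Infty))"
  shows "\<exists>S. finite S \<and> L \<subseteq> fs.span S" and "int (fs.dim L) = 2 * int M + 1 - int (degree g div 2)"
proof -
  have "poly_fun h 0 \<noteq> 0" using h by (simp add: poly_fun_eq_0_iff)
  then obtain hi where hi: "fmul (poly_fun h 0) hi = poly_fun 1 0" "hi \<noteq> 0" by (rule exists_fmul_inverse)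
  define K where "K = M - degree g div 2"
  have L: "L = {fmul hi (poly_fun A B) | A B. degree A \<le> M \<and> (B = 0 \<or> degree B < K)}"
    unfolding L_def K_def by (rule riemann_roch_explicit[OF h hi(1) E M])
  define b where "b = (\<lambda>i. fmul hi (case i of Inl i \<Rightarrow> poly_fun (monom 1 i) 0 | Inr j \<Rightarrow> poly_fun 0 (monom 1 j)))"
  define I where "I = {..M} <+> {..<K}"
  have finI: "finite I" by (simp add: I_def)
  have comb: "(\<Sum>i\<in>I. scale_fun (u i) (b i))
      = fmul hi (poly_fun (\<Sum>i\<le>M. monom (u (Inl i)) i) (\<Sum>j<K. monom (u (Inr j)) j))" for u
  proof -
    have s: "scale_fun c (fmul hi (poly_fun A B)) = fmul hi (poly_fun (smult c A) (smult c B))" for c A B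
      by (simp add: scale_fun_eq fmul_poly_fun fmul_commute[of hi] flip: fmul_assoc)
    have sums: "(\<Sum>i\<in>J. fmul hi (poly_fun (A i) (B i))) = fmul hi (poly_fun (sum A J) (sum B J))"
      for A B and J :: "nat set"
      by (induction J rule: infinite_finite_induct) (simp_all add: poly_fun_add flip: fmul_add_right)
    show ?thesis
      unfolding I_def by (subst sum.Plus) (simp_all add: b_def s sums poly_fun_add smult_monom flip: fmul_add_right)
  qed
  have zero: "u i = 0" if "(\<Sum>i\<in>I. scale_fun (u i) (b i)) = 0" "i \<in> I" for u i
  proof -
    have "(\<Sum>i\<le>M. monom (u (Inl i)) i) = 0" "(\<Sum>j<K. monom (u (Inr j)) j) = 0"
      using that(1) hi(2) unfolding comb by (auto simp: fmul_eq_0_iff poly_fun_eq_0_iff)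
    then have c: "coeff (\<Sum>i\<le>M. monom (u (Inl i)) i) k = 0" "coeff (\<Sum>j<K. monom (u (Inr j)) j) k = 0" for k by simp_all
    have "k \<le> M \<Longrightarrow> u (Inl k) = 0" "k < K \<Longrightarrow> u (Inr k) = 0" for k
      using c(1)[of k] c(2)[of k] by (simp_all add: coeff_sum)
    then show ?thesis using that(2) by (auto simp: I_def)
  qed
  have inj: "inj_on b I"
  proof (rule inj_onI, rule ccontr)
    fix i j assume ij: "i \<in> I" "j \<in> I" "b i = b j" "i \<noteq> j"
    define u where "u = (\<lambda>k. if k = i then 1 else if k = j then - 1 else (0::'a))"
    have "(\<Sum>k\<in>I. scale_fun (u k) (b k)) = scale_fun 1 (b i) + scale_fun (- 1) (b j)"
    proof -
      have "(\<Sum>k\<in>I. scale_fun (u k) (b k)) = (\<Sum>k\<in>{i, j}. scale_fun (u k) (b k))"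
        using ij finI by (intro sum.mono_neutral_right) (auto simp: u_def)
      then show ?thesis using ij(4) by (simp add: u_def)
    qed
    also have "\<dots> = 0" using ij(3) by simp
    finally have "u i = 0" using zero ij(1) by blast
    then show False by (simp add: u_def)
  qed
  have indep: "fs.independent (b ` I)"
  proof (rule fs.independent_if_scalars_zero)
    show "finite (b ` I)" using finI by simp
    fix f x assume *: "(\<Sum>x\<in>b ` I. scale_fun (f x) x) = 0" "x \<in> b ` I"
    then have "(\<Sum>i\<in>I. scale_fun (f (b i)) (b i)) = 0" using inj by (simp add: sum.reindex)
    then show "f x = 0" using zero[of "\<lambda>i. f (b i)"] *(2) by auto
  qed
  have span: "L \<subseteq> fs.span (b ` I)"
  proof
    fix F assume "F \<in> L"
    then obtain A B where F: "F = fmul hi (poly_fun A B)" "degree A \<le> M" "B = 0 \<or> degree B < K"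
      unfolding L by blast
    define u where "u = case_sum (coeff A) (coeff B)"
    have "(\<Sum>i\<le>M. monom (coeff A i) i) = A" using poly_as_sum_of_monoms'[OF F(2)] .
    moreover have "(\<Sum>j<K. monom (coeff B j) j) = B"
    proof (rule poly_eqI)
      fix k
      show "coeff (\<Sum>j<K. monom (coeff B j) j) k = coeff B k"
        using F(3) by (auto simp: coeff_sum coeff_eq_0)
    qed
    ultimately have "F = (\<Sum>i\<in>I. scale_fun (u i) (b i))" unfolding comb by (simp add: u_def F(1))
    then show "F \<in> fs.span (b ` I)"
      by (simp add: fs.span_sum fs.span_scale fs.span_base)
  qed
  have sub: "b ` I \<subseteq> L"
  proof (rule image_subsetI)
    fix i assume i: "i \<in> I"
    show "b i \<in> L"
    proof (cases i)
      case (Inl k)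
      then have "degree (monom 1 k :: 'a poly) \<le> M" using i by (auto simp: I_def degree_monom_eq)
      then show ?thesis unfolding L b_def Inl by auto
    next
      case (Inr k)
      then have "degree (monom 1 k :: 'a poly) < K" using i by (auto simp: I_def degree_monom_eq)
      then show ?thesis unfolding L b_def Inr sum.case mem_Collect_eq
        by (intro exI[of _ "0 :: 'a poly"] exI[of _ "monom 1 k :: 'a poly"]) simp
    qed
  qed
  show "\<exists>S. finite S \<and> L \<subseteq> fs.span S" using span finI by blast
  have "fs.dim L = card I"
    using fs.dim_unique[OF sub span indep refl] card_image[OF inj] by simp
  also have "card I = (M + 1) + K" by (simp add: I_def card_Plus)
  finally show "int (fs.dim L) = 2 * int M + 1 - int (degree g div 2)" using M by (simp add: K_def)
qed

text \<open>Every divisor lies below one of the form div h + 2 M \<infinity>, for which deg - l + 1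
  is exactly \<open>degree g div 2\<close>. The maximum is attained at such a divisor with h =
  1.\<close>

theorem genus_eq: "genus g = int (degree g div 2)"
proof -
  define \<phi> where "\<phi> = (\<lambda>D. div_degree D - int (fs.dim (riemann_roch_space g D)) + 1)"
  have upper: "\<phi> D \<le> int (degree g div 2)" if D: "Poly_Mapping.keys D \<subseteq> curve_points g" for D
  proof -
    obtain h E where h: "h \<noteq> 0" "Poly_Mapping.keys E \<subseteq> curve_points g" "div_degree E = 0"
      "\<And>P. P \<in> curve_points g \<Longrightarrow> coef E P = ord_at g P (poly_fun h 0)" "\<And>x y. \<bar>coef D (Aff x y)\<bar> \<le> coef E (Aff x y)"
      using exists_dominating_poly[OF D] by blast
    \<comment> \<open>The summand \<open>degree g\<close> makes the explicit dimension formula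
      applicable; the other one makes 2 M large enough to dominate D at infinity.\<close>
    define M where "M = degree g + nat \<bar>coef D Infty - coef E Infty\<bar>"
    define E' where "E' = E + frag_cmul (2 * int M) (frag_of Infty)"
    have "degree g \<le> M" by (simp add: M_def)
    note dim = dim_riemann_roch_explicit[OF h(1,4) this, folded E'_def]
    have keys: "Poly_Mapping.keys E' \<subseteq> curve_points g"
      unfolding E'_def using Poly_Mapping.keys_add[of E "frag_cmul (2 * int M) (frag_of Infty)"]
        keys_cmul[of "2 * int M" "frag_of (Infty :: 'a curve_point)"] h(2) Infty_in by auto
    have "coef D P \<le> coef E' P" for P
    proof (cases P)
      case Infty
      have "coef D Infty - coef E Infty \<le> \<bar>coef D Infty - coef E Infty\<bar>" by (rule abs_ge_self)
      then show ?thesis by (simp add: Infty E'_def lookup_add M_def) arith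
    next
      case (Aff x y)
      then show ?thesis using h(5)[of x y] by (simp add: E'_def lookup_add)
    qed
    moreover obtain S where "finite S" "riemann_roch_space g E' \<subseteq> fs.span S" using dim(1) by blast
    ultimately have "int (fs.dim (riemann_roch_space g E')) \<le> int (fs.dim (riemann_roch_space g D)) + (div_degree E' - div_degree D)"
      using dim_riemann_roch_lower[OF D keys] by blast
    moreover have "div_degree E' = 2 * int M" by (simp add: E'_def div_degree_add div_degree_cmul h(3))
    ultimately show ?thesis using dim(2) by (simp add: \<phi>_def)
  qed
  define D where "D = frag_cmul (2 * int (degree g)) (frag_of (Infty :: 'a curve_point))"
  have one: "coef 0 P = ord_at g P (poly_fun 1 0)" if "P \<in> curve_points g" for P
    using curve_valuation.v_const[OF valuation_at[OF that], of 1] by (simp flip: one_pCons)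
  have "int (fs.dim (riemann_roch_space g D)) = 2 * int (degree g) + 1 - int (degree g div 2)"
    using dim_riemann_roch_explicit(2)[of 1 0 "degree g", OF _ one] by (simp add: D_def)
  then have attained: "\<phi> D = int (degree g div 2)" by (simp add: \<phi>_def D_def div_degree_cmul)
  have "D \<in> carrier (divisors g)"
    using keys_cmul[of "2 * int (degree g)" "frag_of (Infty :: 'a curve_point)"] Infty_in
    by (auto simp: D_def divisors_def)
  then have "(SUP D \<in> carrier (divisors g). \<phi> D) = int (degree g div 2)"
    using upper attained by (intro cSup_eq_maximum) (auto simp: divisors_def intro: rev_image_eqI)
  then show ?thesis by (simp add: genus_def \<phi>_def)
qed

end

section \<open>From principal divisors to norm equations\<close>

context closed_curve
begin

lemma principal_divisors_iff:
  "D \<in> principal_divisors g \<longleftrightarrow> Poly_Mapping.keys D \<subseteq> curve_points g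
     \<and> (\<exists>F. F \<noteq> 0 \<and> (\<forall>P\<in>curve_points g. coef D P = ord_at g P F))"
  by (simp add: principal_divisors_def divisors_def)

lemma principal_0: "0 \<in> principal_divisors g"
proof -
  have "\<forall>P\<in>curve_points g. coef 0 P = ord_at g P (poly_fun 1 0)"
    using curve_valuation.v_const[OF valuation_at, of _ 1] by (simp flip: one_pCons)
  moreover have "poly_fun 1 0 \<noteq> (0 :: 'a curve_fun)" by (simp add: poly_fun_eq_0_iff)
  ultimately show ?thesis
    unfolding principal_divisors_iff by (metis keys_zero empty_subsetI)
qed

lemma principal_add:
  assumes "D \<in> principal_divisors g" "E \<in> principal_divisors g"
  shows "D + E \<in> principal_divisors g"
proof -
  obtain F H where "F \<noteq> 0" "H \<noteq> 0" and "\<And>P. P \<in> curve_points g \<Longrightarrow> coef D P = ord_at g P F"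
    "\<And>P. P \<in> curve_points g \<Longrightarrow> coef E P = ord_at g P H"
    using assms unfolding principal_divisors_iff by blast
  then have "\<forall>P\<in>curve_points g. coef (D + E) P = ord_at g P (fmul F H)" "fmul F H \<noteq> 0"
    by (simp_all add: lookup_add ord_mult fmul_eq_0_iff)
  moreover have "Poly_Mapping.keys (D + E) \<subseteq> curve_points g"
    using assms Poly_Mapping.keys_add[of D E] unfolding principal_divisors_iff by blast
  ultimately show ?thesis unfolding principal_divisors_iff by blast
qed

lemma principal_uminus:
  assumes "D \<in> principal_divisors g"
  shows "- D \<in> principal_divisors g"
proof -
  obtain F where F: "F \<noteq> 0" "\<And>P. P \<in> curve_points g \<Longrightarrow> coef D P = ord_at g P F"
    using assms unfolding principal_divisors_iff by blast
  obtain H where H: "fmul F H = poly_fun 1 0" "H \<noteq> 0" using exists_fmul_inverse[OF F(1)] .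
  have "coef (- D) P = ord_at g P H" if P: "P \<in> curve_points g" for P
    using ord_mult[OF P F(1) H(2)] F(2)[OF P] H(1) curve_valuation.v_const[OF valuation_at[OF P], of 1]
    by (simp flip: one_pCons)
  then show ?thesis using assms H(2) unfolding principal_divisors_iff keys_minus by blast
qed

lemma principal_diff: "D \<in> principal_divisors g \<Longrightarrow> E \<in> principal_divisors g \<Longrightarrow> D - E \<in> principal_divisors g"
  using principal_add[of D "- E"] principal_uminus[of E] by simp

lemma ord_at_root_prod:
  assumes "finite S" "P \<in> curve_points g"
  shows "ord_at g P (poly_fun (root_prod S m) 0) = (\<Sum>u\<in>S. int (m u) * ord_at g P (poly_fun [:- u, 1:] 0))"
  using assms(1)
proof (induction S rule: finite_induct)
  case empty
  show ?case using curve_valuation.v_const[OF valuation_at[OF assms(2)], of 1]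
    by (simp add: root_prod_def flip: one_pCons)
next
  case (insert u S)
  interpret v: curve_valuation g "ord_at g P" by (rule valuation_at[OF assms(2)])
  have "root_prod (insert u S) m = [:- u, 1:] ^ m u * root_prod S m"
    using insert.hyps by (simp add: root_prod_def)
  then have "ord_at g P (poly_fun (root_prod (insert u S) m) 0)
      = ord_at g P (poly_fun ([:- u, 1:] ^ m u) 0) + ord_at g P (poly_fun (root_prod S m) 0)"
    by (metis v.v_poly_mult root_prod_nonzero pCons_eq_0_iff power_not_zero zero_neq_one)
  then show ?case using insert v.v_poly_power[of "[:- u, 1:]"] by simp
qed

end

lemma poly_eq_root_prod:
  fixes p :: "'a::alg_closed_field poly"
  assumes "finite S" "p \<noteq> 0" "\<And>x. order x p = (if x \<in> S then m x else 0)"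
  shows "\<exists>l. l \<noteq> 0 \<and> p = smult l (root_prod S m)"
  using assms
proof (induction m arbitrary: p rule: multiplicity_induct)
  case (zero m)
  have "degree p = 0"
  proof (rule ccontr)
    assume "degree p \<noteq> 0"
    then obtain x where "poly p x = 0" using alg_closed_imp_poly_has_root by blast
    then have "order x p \<noteq> 0" using zero.prems(1) by (simp add: order_root)
    then show False using zero.prems(2)[of x] zero.hyps[of x] by (auto split: if_splits)
  qed
  then obtain c where "p = [:c:]" by (meson degree_eq_zeroE)
  then show ?case using zero by (intro exI[of _ c]) (auto simp: root_prod_0)
next
  case (add m u)
  have "order u p = Suc (m u)" using add.prems(2)[of u] add.hyps by simp
  then have "poly p u = 0" using add.prems(1) by (simp add: order_root)
  then obtain q where q: "p = [:- u, 1:] * q" unfolding poly_eq_0_iff_dvd by (elim dvdE)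
  have q0: "q \<noteq> 0" using add.prems(1) q by auto
  have "order x q = (if x \<in> S then m x else 0)" for x
  proof -
    have "order x p = order x [:- u, 1:] + order x q" using order_mult[of "[:- u, 1:]" q x] add.prems(1) q by simp
    moreover have "order x [:- u, 1:] = (if x = u then 1 else 0)"
    proof (cases "x = u")
      case True
      then show ?thesis using order_power_n_n[of u 1] by simp
    next
      case False
      then show ?thesis by (simp add: order_0I)
    qed
    ultimately show ?thesis using add.prems(2)[of x] add.hyps by (auto split: if_splits)
  qed
  then obtain l where l: "l \<noteq> 0" "q = smult l (root_prod S m)" using add.IH[OF q0] by blast
  have "root_prod S (m(u := Suc (m u))) = [:- u, 1:] ^ 1 * root_prod S ((m(u := Suc (m u)))(u := (m(u := Suc (m u))) u - 1))"
    by (rule root_prod_update[OF assms(1) add.hyps]) simp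
  then have "root_prod S (m(u := Suc (m u))) = [:- u, 1:] * root_prod S m"
    by (simp only: power_one_right fun_upd_upd fun_upd_same diff_Suc_1 fun_upd_triv)
  then show ?case using l q by (intro exI[of _ l]) (simp only: mult_smult_right not_False_eq_True simp_thms)
qed

locale curve_over_field =
  fixes g :: "'k::field_char_0 poly"
  assumes closed: "closed_curve (base_change g)"
begin

sublocale C: closed_curve "base_change g"
  by (rule closed)

lemma degree_base_change: "degree (base_change g) = degree g"
  by (simp add: base_change_def to_ac.degree_map_poly_hom)

lemma poly_base_change: "poly (base_change g) (to_ac x) = to_ac (poly g x)"
  by (simp add: base_change_def to_ac.poly_map_poly_hom)

lemma Aff_to_ac_in: "Aff (to_ac x) (to_ac y) \<in> curve_points (base_change g) \<longleftrightarrow> y\<^sup>2 = poly g x"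
  by (simp add: curve_points_def poly_base_change flip: to_ac_power)

text \<open>Without affine poles F is A + B Y with polynomials A and B. Its conjugate does not
  vanish at the chosen point over u, so the norm has at u a root of order c u; as F has no other
  affine zeros, the norm has no other roots. The equation then descends to the base field.\<close>

theorem norm_equation_of_function:
  assumes U: "finite U" and e: "\<And>u. u \<in> U \<Longrightarrow> e u ^ 2 = poly g u" "\<And>u. u \<in> U \<Longrightarrow> e u \<noteq> 0"
    and F: "F \<noteq> 0"
    and ord: "\<And>u. u \<in> U \<Longrightarrow> ord_at (base_change g) (Aff (to_ac u) (to_ac (e u))) F = int (c u)"
      "\<And>u. u \<in> U \<Longrightarrow> ord_at (base_change g) (Aff (to_ac u) (- to_ac (e u))) F = 0"
      "\<And>x y. Aff x y \<in> curve_points (base_change g) \<Longrightarrow> x \<notin> to_ac ` U \<Longrightarrow> ord_at (base_change g) (Aff x y) F = 0"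
  obtains A B l where "l \<noteq> 0" "A\<^sup>2 - g * B\<^sup>2 = smult l (root_prod U c)"
    "\<And>u. u \<in> U \<Longrightarrow> c u > 0 \<Longrightarrow> poly A u \<noteq> 0"
proof -
  let ?g = "base_change g"
  have pt: "Aff (to_ac u) (to_ac (e u)) \<in> curve_points ?g" "Aff (to_ac u) (- to_ac (e u)) \<in> curve_points ?g" if "u \<in> U" for u
    using Aff_to_ac_in[of u "e u"] e(1)[OF that] C.Aff_minus by auto
  have fibre: "y = to_ac (e u) \<or> y = - to_ac (e u)" if "Aff (to_ac u) y \<in> curve_points ?g" "u \<in> U" for u y
  proof -
    have "y\<^sup>2 = (to_ac (e u))\<^sup>2"
      using that e(1)[OF that(2)] by (simp add: curve_points_def poly_base_change flip: to_ac_power)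
    then show ?thesis by (simp add: power2_eq_iff)
  qed
  have "F = 0 \<or> ord_at ?g (Aff x y) F \<ge> 0" if "Aff x y \<in> curve_points ?g" for x y
    using ord fibre[of _ y] that by (cases "x \<in> to_ac ` U") fastforce+
  then obtain A B where F_eq: "F = poly_fun A B" by (rule C.regular_affine)
  have AB: "A \<noteq> 0 \<or> B \<noteq> 0" using F F_eq by (auto simp: poly_fun_eq_0_iff)
  define N where "N = A\<^sup>2 - ?g * B\<^sup>2"
  have N: "N \<noteq> 0" unfolding N_def by (rule degree_norm(1)[OF C.odd_degree AB])
  have nonvanish: "poly A (to_ac u) - poly B (to_ac u) * to_ac (e u) \<noteq> 0" if u: "u \<in> U" for u
    using affine_valuation.v_poly_fun_pos_iff[OF C.affine_valuation_ord_at[OF pt(2)[OF u]] AB] ord(2)[OF u] F_eq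
    by simp
  have vanish: "poly A (to_ac u) + poly B (to_ac u) * to_ac (e u) = 0" if u: "u \<in> U" "c u > 0" for u
    using affine_valuation.v_poly_fun_pos_iff[OF C.affine_valuation_ord_at[OF pt(1)[OF u(1)]] AB] ord(1)[OF u(1)] F_eq u(2)
    by simp
  define m where "m = (\<lambda>z. c (inv_into UNIV to_ac z))"
  have "order x N = (if x \<in> to_ac ` U then m x else 0)" for x
  proof (cases "x \<in> to_ac ` U")
    case True
    then obtain u where u: "x = to_ac u" "u \<in> U" by blast
    interpret v: affine_valuation ?g "ord_at ?g (Aff x (to_ac (e u)))" x "to_ac (e u)"
      using C.affine_valuation_ord_at[OF pt(1)[OF u(2)]] u(1) by simp
    have "ord_at ?g (Aff x (to_ac (e u))) (poly_fun [:- x, 1:] 0) = 1"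
      using C.ord_at_linear[OF pt(1)[OF u(2)]] e(2)[OF u(2)] by (simp add: u(1))
    then have "ord_at ?g (Aff x (to_ac (e u))) (poly_fun N 0) = int (order x N)"
      using v.v_poly[OF N] by simp
    moreover have "ord_at ?g (Aff x (to_ac (e u))) (poly_fun A (- B)) = 0"
      using nonvanish[OF u(2)] by (intro v.v_poly_fun_nonroot) (simp add: u(1))
    moreover have "C.fmul (poly_fun A B) (poly_fun A (- B)) = poly_fun N 0"
      by (simp add: C.fmul_poly_fun N_def power2_eq_square algebra_simps)
    ultimately have "int (order x N) = int (c u)"
      using v.v_mult[of "poly_fun A B" "poly_fun A (- B)"] AB ord(1)[OF u(2)] F_eq u(1)
      by (simp add: poly_fun_eq_0_iff)
    then show ?thesis using True u(1) by (simp add: m_def inv_f_f[OF inj_to_ac])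
  next
    case False
    obtain y where y: "Aff x y \<in> curve_points ?g" using C.exists_point_over by blast
    have y': "Aff x (- y) \<in> curve_points ?g" by (rule C.Aff_minus[OF y])
    have "poly A x + poly B x * y \<noteq> 0"
      using affine_valuation.v_poly_fun_pos_iff[OF C.affine_valuation_ord_at[OF y] AB] ord(3)[OF y False] F_eq by simp
    moreover have "poly A x + poly B x * (- y) \<noteq> 0"
      using affine_valuation.v_poly_fun_pos_iff[OF C.affine_valuation_ord_at[OF y'] AB] ord(3)[OF y' False] F_eq by simp
    moreover have "poly N x = (poly A x + poly B x * y) * (poly A x + poly B x * (- y))"
    proof -
      have "poly ?g x = y\<^sup>2" using y by (simp add: curve_points_def)
      then show ?thesis by (simp add: N_def power2_eq_square algebra_simps)
    qed
    ultimately have "poly N x \<noteq> 0" by simp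
    then show ?thesis using False by (simp add: order_0I)
  qed
  then obtain l where l: "l \<noteq> 0" "N = smult l (root_prod (to_ac ` U) m)"
    using poly_eq_root_prod[OF _ N, of "to_ac ` U" m] U by blast
  have "A\<^sup>2 - map_poly to_ac g * B\<^sup>2 = smult l (map_poly to_ac (root_prod U c))"
    unfolding to_ac.map_poly_root_prod[OF inj_to_ac] using l(2) by (simp add: N_def base_change_def m_def)
  moreover have "odd (degree g)" using C.odd_degree by (simp add: degree_base_change)
  ultimately show ?thesis
    using norm_equation_descends[of g U e l A B c thesis] U e l(1) vanish nonvanish that by blast
qed

definition point_divisor :: "'k \<Rightarrow> 'k \<Rightarrow> 'k alg_closure curve_point \<Rightarrow>\<^sub>0 int" where
  "point_divisor x y = frag_of (Aff (to_ac x) (to_ac y)) - frag_of Infty"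

lemma coef_sum: "finite I \<Longrightarrow> coef (sum D I) P = (\<Sum>i\<in>I. coef (D i) P)"
  by (induction I rule: finite_induct) (simp_all add: lookup_add)

text \<open>Multiplying by powers of \<open>X - u\<close> trades the points with a negative coefficient for their
  conjugates, so that the function becomes regular on the affine curve.\<close>

theorem principal_relation_trivial:
  assumes U: "finite U" and d: "d \<noteq> 0" "\<And>u. u \<in> U \<Longrightarrow> poly g u = d\<^sup>2"
    and no_norm: "\<And>A B l c. l \<noteq> 0 \<Longrightarrow> A\<^sup>2 - g * B\<^sup>2 = smult l (root_prod U c) \<Longrightarrow>
       (\<And>u. u \<in> U \<Longrightarrow> c u > 0 \<Longrightarrow> poly A u \<noteq> 0) \<Longrightarrow> \<exists>u\<in>U. c u = 0 \<Longrightarrow> \<forall>u\<in>U. c u = 0"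
    and rel: "(\<Sum>u\<in>U. frag_cmul (a u) (point_divisor u d)) \<in> principal_divisors (base_change g)"
    and u0: "u0 \<in> U" "a u0 = 0"
  shows "\<forall>u\<in>U. a u = 0"
proof -
  let ?g = "base_change g"
  define h where "h = map_poly to_ac (root_prod U (\<lambda>u. nat (- a u)))"
  obtain F where F: "F \<noteq> 0" and divF: "\<And>P. P \<in> curve_points ?g \<Longrightarrow>
      coef (\<Sum>u\<in>U. frag_cmul (a u) (point_divisor u d)) P = ord_at ?g P F"
    using rel unfolding C.principal_divisors_iff by blast
  have h0: "poly_fun h 0 \<noteq> 0" by (simp add: h_def poly_fun_eq_0_iff to_ac.map_poly_hom_eq_0_iff)
  define F' where "F' = C.fmul (poly_fun h 0) F"
  have F'0: "F' \<noteq> 0" using F h0 by (simp add: F'_def C.fmul_eq_0_iff)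
  have ord_h: "ord_at ?g P (poly_fun h 0) = (\<Sum>u\<in>U. int (nat (- a u)) * ord_at ?g P (poly_fun [:- to_ac u, 1:] 0))"
    if P: "P \<in> curve_points ?g" for P
    unfolding h_def to_ac.map_poly_root_prod[OF inj_to_ac]
    using C.ord_at_root_prod[OF _ P, of "to_ac ` U"] U
    by (simp add: sum.reindex inj_on_subset[OF inj_to_ac] inv_f_f[OF inj_to_ac])
  have ord: "ord_at ?g (Aff x y) F' = (\<Sum>u\<in>U. a u * (if Aff x y = Aff (to_ac u) (to_ac d) then 1 else 0)
      + int (nat (- a u)) * (if x = to_ac u then if y = 0 then 2 else 1 else 0))"
    if P: "Aff x y \<in> curve_points ?g" for x y
  proof -
    have "ord_at ?g (Aff x y) F' = ord_at ?g (Aff x y) F + ord_at ?g (Aff x y) (poly_fun h 0)"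
      unfolding F'_def by (subst C.ord_mult[OF P h0 F]) simp
    moreover have "ord_at ?g (Aff x y) F = (\<Sum>u\<in>U. a u * (if Aff x y = Aff (to_ac u) (to_ac d) then 1 else 0))"
      unfolding divF[OF P, symmetric] coef_sum[OF U]
      by (rule sum.cong) (auto simp: point_divisor_def lookup_minus)
    moreover have "ord_at ?g (Aff x y) (poly_fun h 0)
        = (\<Sum>u\<in>U. int (nat (- a u)) * (if x = to_ac u then if y = 0 then 2 else 1 else 0))"
      unfolding ord_h[OF P] C.ord_at_linear[OF P] ..
    ultimately show ?thesis by (simp only: sum.distrib)
  qed
  have pt: "Aff (to_ac u) (to_ac d) \<in> curve_points ?g" "Aff (to_ac u) (- to_ac d) \<in> curve_points ?g" if "u \<in> U" for u
    using Aff_to_ac_in[of u d] d(2)[OF that] C.Aff_minus by auto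
  have ord_plus: "ord_at ?g (Aff (to_ac u) (to_ac d)) F' = a u + int (nat (- a u))" if u: "u \<in> U" for u
  proof -
    have "ord_at ?g (Aff (to_ac u) (to_ac d)) F' = (\<Sum>v\<in>U. if v = u then a v + int (nat (- a v)) else 0)"
      unfolding ord[OF pt(1)[OF u]] using d(1) by (intro sum.cong) auto
    then show ?thesis using U u by (simp add: sum.delta)
  qed
  have "to_ac d \<noteq> - to_ac d"
  proof
    assume "to_ac d = - to_ac d"
    then have "to_ac d = to_ac (- d)" by (simp only: to_ac_minus)
    then have "d = - d" by (simp only: to_ac_eq_iff)
    then have "d + d = 0" by (metis add.right_inverse)
    then have "2 * d = 0" by (simp only: mult_2)
    then show False using d(1) by simp
  qed
  then have ord_minus: "ord_at ?g (Aff (to_ac u) (- to_ac d)) F' = int (nat (- a u))" if u: "u \<in> U" for u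
  proof -
    have "ord_at ?g (Aff (to_ac u) (- to_ac d)) F' = (\<Sum>v\<in>U. if v = u then int (nat (- a v)) else 0)"
      unfolding ord[OF pt(2)[OF u]] using d(1) \<open>to_ac d \<noteq> - to_ac d\<close> by (intro sum.cong) auto
    then show ?thesis using U u by (simp add: sum.delta)
  qed
  \<comment> \<open>For each u, e selects the one of the two conjugate points that carries the whole
    multiplicity of F', and this multiplicity is the absolute value of a u.\<close>
  define e c where "e = (\<lambda>u. if a u \<ge> 0 then d else - d)" and "c = (\<lambda>u. nat \<bar>a u\<bar>)"
  obtain A B l where "l \<noteq> 0" "A\<^sup>2 - g * B\<^sup>2 = smult l (root_prod U c)"
    "\<And>u. u \<in> U \<Longrightarrow> c u > 0 \<Longrightarrow> poly A u \<noteq> 0"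
  proof (rule norm_equation_of_function[OF U _ _ F'0, of e c])
    show "e u ^ 2 = poly g u" "e u \<noteq> 0" if "u \<in> U" for u using d that by (simp_all add: e_def)
    show "ord_at ?g (Aff (to_ac u) (to_ac (e u))) F' = int (c u)"
      "ord_at ?g (Aff (to_ac u) (- to_ac (e u))) F' = 0" if "u \<in> U" for u
      using ord_plus[OF that] ord_minus[OF that] by (auto simp: e_def c_def)
    show "ord_at ?g (Aff x y) F' = 0" if "Aff x y \<in> curve_points ?g" "x \<notin> to_ac ` U" for x y
      unfolding ord[OF that(1)] using that(2) by (intro sum.neutral) auto
  qed blast
  moreover have "\<exists>u\<in>U. c u = 0" using u0 by (auto simp: c_def)
  ultimately have "\<forall>u\<in>U. c u = 0" using no_norm by blast
  then show ?thesis by (simp add: c_def)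
qed

end

section \<open>The group of rational points of the Jacobian\<close>

lemma act_on_divisor_simps [simp]:
  "act_on_divisor \<sigma> 0 = 0" "act_on_divisor \<sigma> (frag_of P) = frag_of (map_curve_point \<sigma> P)"
  "act_on_divisor \<sigma> (D + E) = act_on_divisor \<sigma> D + act_on_divisor \<sigma> E"
  "act_on_divisor \<sigma> (D - E) = act_on_divisor \<sigma> D - act_on_divisor \<sigma> E"
  "act_on_divisor \<sigma> (- D) = - act_on_divisor \<sigma> D"
  by (simp_all add: act_on_divisor_def frag_extend_add frag_extend_diff frag_extend_minus)

lemma coef_act:
  assumes "inj \<sigma>"
  shows "coef (act_on_divisor \<sigma> D) (map_curve_point \<sigma> P) = coef D P"
proof (rule frag_induction[of D UNIV])
  have "inj (map_curve_point \<sigma>)" using assms by (rule curve_point.inj_map)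
  then show "coef (act_on_divisor \<sigma> (frag_of Q)) (map_curve_point \<sigma> P) = coef (frag_of Q) P" for Q
    by (simp add: inj_eq)
qed (simp_all add: lookup_minus)

lemma act_on_divisor_inverse:
  assumes "\<And>x. \<sigma> (\<tau> x) = x"
  shows "act_on_divisor \<sigma> (act_on_divisor \<tau> D) = D"
proof (rule frag_induction[of D UNIV])
  show "act_on_divisor \<sigma> (act_on_divisor \<tau> (frag_of P)) = frag_of P" for P
    using assms by (cases P) simp_all
qed simp_all

lemma field_autsE:
  assumes "\<sigma> \<in> field_auts S"
  shows "field_hom \<sigma>" "bij \<sigma>" "\<And>c. c \<in> S \<Longrightarrow> \<sigma> c = c"
proof -
  have iso: "\<sigma> \<in> ring_iso ring_of_type_algebra ring_of_type_algebra" and "\<forall>c\<in>S. \<sigma> c = c"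
    using assms by (auto simp: field_auts_def)
  then show "\<And>c. c \<in> S \<Longrightarrow> \<sigma> c = c" by blast
  have h: "\<sigma> \<in> Ring.ring_hom ring_of_type_algebra ring_of_type_algebra" and "bij_betw \<sigma> UNIV UNIV"
    using iso by (auto simp: ring_iso_def ring_of_type_algebra_def)
  then show "bij \<sigma>" by simp
  have add: "\<sigma> (x + y) = \<sigma> x + \<sigma> y" and mult: "\<sigma> (x * y) = \<sigma> x * \<sigma> y" and one: "\<sigma> 1 = 1" for x y
    using ring_hom_memE[OF h] by (simp_all add: ring_of_type_algebra_def)
  have "\<sigma> 0 + \<sigma> 0 = \<sigma> 0 + 0" by (simp flip: add)
  then have "\<sigma> 0 = 0" by (simp only: add_left_cancel)
  then show "field_hom \<sigma>" by unfold_locales (simp_all add: add mult one)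
qed

lemma field_auts_inverse:
  assumes "\<sigma> \<in> field_auts S"
  shows "inv_into UNIV \<sigma> \<in> field_auts S"
proof -
  note \<sigma> = field_autsE[OF assms]
  interpret field_hom \<sigma> by (rule \<sigma>(1))
  have b: "\<sigma> (inv_into UNIV \<sigma> x) = x" "inv_into UNIV \<sigma> (\<sigma> x) = x" for x
    using \<sigma>(2) by (simp_all add: bij_is_surj bij_is_inj surj_f_inv_f inv_f_f)
  have "inv_into UNIV \<sigma> (x + y) = inv_into UNIV \<sigma> x + inv_into UNIV \<sigma> y"
    "inv_into UNIV \<sigma> (x * y) = inv_into UNIV \<sigma> x * inv_into UNIV \<sigma> y" "inv_into UNIV \<sigma> 1 = 1" for x y
    using b by (metis hom_add, metis hom_mult, metis hom_one)
  moreover have "bij (inv_into UNIV \<sigma>)" using \<sigma>(2) by (rule bij_imp_bij_inv)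
  moreover have "inv_into UNIV \<sigma> c = c" if "c \<in> S" for c using \<sigma>(3)[OF that] b(2) by metis
  ultimately show ?thesis
    by (auto simp: field_auts_def ring_iso_def ring_of_type_algebra_def intro!: ring_hom_memI)
qed

context curve_over_field
begin

abbreviation Kg :: "'k alg_closure poly" where "Kg \<equiv> base_change g"
abbreviation H where "H \<equiv> principal_divisors Kg"

lemma curve_automorphism:
  assumes "\<sigma> \<in> field_auts (range (to_ac :: 'k \<Rightarrow> 'k alg_closure))"
  shows "curve_automorphism Kg \<sigma>"
proof -
  note \<sigma> = field_autsE[OF assms]
  interpret s: field_hom \<sigma> by (rule \<sigma>(1))
  show ?thesis
  proof unfold_locales
    show "map_poly \<sigma> Kg = Kg"
      by (rule poly_eqI) (simp add: base_change_def coeff_map_poly \<sigma>(3))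
  qed (use \<sigma> in auto)
qed

text \<open>The image of the divisor of F is the divisor of the conjugate function, because orders
  are equivariant and every point of the curve is the image of a point of the curve.\<close>

lemma act_principal:
  assumes "\<sigma> \<in> field_auts (range (to_ac :: 'k \<Rightarrow> 'k alg_closure))" "D \<in> H"
  shows "act_on_divisor \<sigma> D \<in> H"
proof -
  interpret s: curve_automorphism Kg \<sigma> by (rule curve_automorphism[OF assms(1)])
  have surj: "surj (map_curve_point \<sigma>)"
  proof (rule surjI)
    show "map_curve_point \<sigma> (map_curve_point (inv_into UNIV \<sigma>) Q) = Q" for Q
      using s.bij by (cases Q) (simp_all add: bij_is_surj surj_f_inv_f)
  qed
  obtain F where F: "F \<noteq> 0" "\<And>P. P \<in> curve_points Kg \<Longrightarrow> coef D P = ord_at Kg P F"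
    and sub: "Poly_Mapping.keys D \<subseteq> curve_points Kg"
    using assms(2) unfolding C.principal_divisors_iff by blast
  have inj: "inj \<sigma>" using s.bij by (rule bij_is_inj)
  have preimage: "P \<in> curve_points Kg" if "map_curve_point \<sigma> P \<in> curve_points Kg" for P
  proof (cases P)
    case (Aff x y)
    then have "\<sigma> (y\<^sup>2) = \<sigma> (poly Kg x)"
      using that s.sigma.poly_map_poly_hom[of Kg x] unfolding s.fixes_g
      by (simp add: curve_points_def s.sigma.hom_power)
    then show ?thesis using inj Aff by (simp add: curve_points_def inj_eq)
  qed (simp add: curve_points_def)
  have "coef (act_on_divisor \<sigma> D) Q = ord_at Kg Q (s.act_fun F)" if Q: "Q \<in> curve_points Kg" for Q
  proof -
    obtain P where P: "Q = map_curve_point \<sigma> P" using surj by (metis surjD)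
    then have "P \<in> curve_points Kg" using Q preimage by blast
    then show ?thesis unfolding P coef_act[OF inj] using F(2) s.ord_at_act by simp
  qed
  moreover have "Poly_Mapping.keys (act_on_divisor \<sigma> D) \<subseteq> curve_points Kg"
    unfolding act_on_divisor_def
    using keys_frag_extend[of "\<lambda>P. frag_of (map_curve_point \<sigma> P)" D] sub s.map_curve_point_in by fastforce
  moreover have "s.act_fun F \<noteq> 0" using F(1) by (simp add: s.act_fun_eq_0_iff)
  ultimately show ?thesis unfolding C.principal_divisors_iff by blast
qed

definition cls :: "('k alg_closure curve_point \<Rightarrow>\<^sub>0 int) \<Rightarrow> ('k alg_closure curve_point \<Rightarrow>\<^sub>0 int) set" where
  "cls D = H #>\<^bsub>divisors0 Kg\<^esub> D"

text \<open>The divisors of degree zero whose class is rational. The divisor itself may move under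
  the Galois group, as long as it moves by principal divisors.\<close>

definition stable_divisors :: "('k alg_closure curve_point \<Rightarrow>\<^sub>0 int) set" where
  "stable_divisors = {D. Poly_Mapping.keys D \<subseteq> curve_points Kg \<and> div_degree D = 0 \<and>
     (\<forall>\<sigma>\<in>field_auts (range to_ac). act_on_divisor \<sigma> D - D \<in> H)}"

lemma cls_eq: "cls D = {h + D | h. h \<in> H}"
  by (auto simp: cls_def r_coset_def divisors0_def divisors_def)

lemma cls_eq_iff: "cls D = cls E \<longleftrightarrow> D - E \<in> H"
proof
  assume "cls D = cls E"
  moreover have "D \<in> cls D" unfolding cls_eq using C.principal_0 by force
  ultimately obtain h where "h \<in> H" "D = h + E" unfolding cls_eq by blast
  then show "D - E \<in> H" by simp
next
  assume DE: "D - E \<in> H"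
  have "h + D \<in> cls E" if "h \<in> H" for h
    unfolding cls_eq using C.principal_add[OF that DE] by (auto intro!: exI[of _ "h + (D - E)"])
  moreover have "h + E \<in> cls D" if "h \<in> H" for h
    unfolding cls_eq using C.principal_diff[OF that DE] by (auto intro!: exI[of _ "h - (D - E)"])
  ultimately show "cls D = cls E" unfolding cls_eq by blast
qed

lemma act_cls:
  assumes "\<sigma> \<in> field_auts (range to_ac)"
  shows "act_on_divisor \<sigma> ` cls D = cls (act_on_divisor \<sigma> D)"
proof
  show "act_on_divisor \<sigma> ` cls D \<subseteq> cls (act_on_divisor \<sigma> D)"
    unfolding cls_eq using act_principal[OF assms] by auto
  show "cls (act_on_divisor \<sigma> D) \<subseteq> act_on_divisor \<sigma> ` cls D"
  proof
    fix E assume "E \<in> cls (act_on_divisor \<sigma> D)"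
    then obtain h where h: "h \<in> H" "E = h + act_on_divisor \<sigma> D" unfolding cls_eq by blast
    define \<tau> where "\<tau> = inv_into UNIV \<sigma>"
    have "act_on_divisor \<sigma> (act_on_divisor \<tau> h) = h"
      using field_autsE(2)[OF assms] by (intro act_on_divisor_inverse) (simp add: \<tau>_def bij_is_surj surj_f_inv_f)
    then have "E = act_on_divisor \<sigma> (act_on_divisor \<tau> h + D)" by (simp add: h(2))
    moreover have "act_on_divisor \<tau> h \<in> H"
      unfolding \<tau>_def by (rule act_principal[OF field_auts_inverse[OF assms] h(1)])
    ultimately show "E \<in> act_on_divisor \<sigma> ` cls D" unfolding cls_eq by blast
  qed
qed

lemma carrier_jacobian: "carrier (jacobian_points g) = cls ` stable_divisors"
proof -
  have pic: "carrier (pic0 Kg) = cls ` {D. Poly_Mapping.keys D \<subseteq> curve_points Kg \<and> div_degree D = 0}"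
    by (auto simp: pic0_def FactGroup_def RCOSETS_def cls_def divisors0_def divisors_def)
  have "(\<forall>\<sigma>\<in>field_auts (range to_ac). act_on_divisor \<sigma> ` cls D = cls D)
      \<longleftrightarrow> (\<forall>\<sigma>\<in>field_auts (range to_ac). act_on_divisor \<sigma> D - D \<in> H)" for D
    by (simp add: act_cls cls_eq_iff)
  then show ?thesis
    unfolding jacobian_points_def partial_object.simps partial_object.update_convs pic stable_divisors_def by auto
qed

lemma mult_jacobian: "cls D \<otimes>\<^bsub>jacobian_points g\<^esub> cls E = cls (D + E)"
proof -
  have "cls D \<otimes>\<^bsub>jacobian_points g\<^esub> cls E = (\<Union>a\<in>cls D. \<Union>b\<in>cls E. {a + b})"
    by (simp add: jacobian_points_def pic0_def FactGroup_def set_mult_def divisors0_def divisors_def)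
  also have "\<dots> = cls (D + E)"
  proof (intro subset_antisym subsetI)
    fix x assume "x \<in> (\<Union>a\<in>cls D. \<Union>b\<in>cls E. {a + b})"
    then obtain h k where "h \<in> H" "k \<in> H" "x = (h + k) + (D + E)"
      unfolding cls_eq by (auto simp: algebra_simps)
    then show "x \<in> cls (D + E)" unfolding cls_eq using C.principal_add by blast
  next
    fix x assume "x \<in> cls (D + E)"
    then obtain h where "h \<in> H" "x = (h + D) + (0 + E)" unfolding cls_eq by (auto simp: algebra_simps)
    then show "x \<in> (\<Union>a\<in>cls D. \<Union>b\<in>cls E. {a + b})" unfolding cls_eq using C.principal_0 by blast
  qed
  finally show ?thesis .
qed

lemma one_jacobian: "\<one>\<^bsub>jacobian_points g\<^esub> = cls 0"
  by (simp add: jacobian_points_def pic0_def FactGroup_def cls_eq)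

lemma stable_0: "0 \<in> stable_divisors"
  by (simp add: stable_divisors_def C.principal_0)

lemma stable_add:
  assumes "D \<in> stable_divisors" "E \<in> stable_divisors"
  shows "D + E \<in> stable_divisors"
proof -
  have "act_on_divisor \<sigma> (D + E) - (D + E) \<in> H" if "\<sigma> \<in> field_auts (range to_ac)" for \<sigma>
  proof -
    have "(act_on_divisor \<sigma> D - D) + (act_on_divisor \<sigma> E - E) \<in> H"
      using assms that by (intro C.principal_add) (auto simp: stable_divisors_def)
    then show ?thesis by (simp add: add_diff_add)
  qed
  then show ?thesis
    using assms Poly_Mapping.keys_add[of D E]
    unfolding stable_divisors_def mem_Collect_eq div_degree_add by auto
qed

lemma stable_uminus:
  assumes "D \<in> stable_divisors"
  shows "- D \<in> stable_divisors"
proof -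
  have "act_on_divisor \<sigma> (- D) - (- D) \<in> H" if "\<sigma> \<in> field_auts (range to_ac)" for \<sigma>
  proof -
    have "- (act_on_divisor \<sigma> D - D) \<in> H"
      using assms that by (intro C.principal_uminus) (auto simp: stable_divisors_def)
    then show ?thesis by simp
  qed
  then show ?thesis
    using assms unfolding stable_divisors_def mem_Collect_eq div_degree_uminus keys_minus by auto
qed

section \<open>The group structure on the rational classes\<close>

lemma comm_group_jacobian: "comm_group (jacobian_points g)"
proof (rule comm_groupI)
  let ?J = "jacobian_points g"
  show "\<one>\<^bsub>?J\<^esub> \<in> carrier ?J" unfolding one_jacobian carrier_jacobian using stable_0 by blast
  fix x assume "x \<in> carrier ?J"
  then obtain D where D: "x = cls D" "D \<in> stable_divisors" unfolding carrier_jacobian by blast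
  show "\<one>\<^bsub>?J\<^esub> \<otimes>\<^bsub>?J\<^esub> x = x" by (simp add: D(1) one_jacobian mult_jacobian)
  have "cls (- D) \<in> carrier ?J" unfolding carrier_jacobian using stable_uminus[OF D(2)] by blast
  then show "\<exists>y\<in>carrier ?J. y \<otimes>\<^bsub>?J\<^esub> x = \<one>\<^bsub>?J\<^esub>"
    by (intro bexI[of _ "cls (- D)"]) (simp_all add: D(1) one_jacobian mult_jacobian)
  fix y assume "y \<in> carrier ?J"
  then obtain E where E: "y = cls E" "E \<in> stable_divisors" unfolding carrier_jacobian by blast
  show "x \<otimes>\<^bsub>?J\<^esub> y \<in> carrier ?J"
    unfolding D(1) E(1) mult_jacobian carrier_jacobian using stable_add[OF D(2) E(2)] by blast
  show "x \<otimes>\<^bsub>?J\<^esub> y = y \<otimes>\<^bsub>?J\<^esub> x" by (simp add: D(1) E(1) mult_jacobian add.commute)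
  fix z assume "z \<in> carrier ?J"
  then obtain G where G: "z = cls G" unfolding carrier_jacobian by blast
  show "x \<otimes>\<^bsub>?J\<^esub> y \<otimes>\<^bsub>?J\<^esub> z = x \<otimes>\<^bsub>?J\<^esub> (y \<otimes>\<^bsub>?J\<^esub> z)"
    by (simp add: D(1) E(1) G mult_jacobian add.assoc)
qed

lemma cls_in_carrier: "D \<in> stable_divisors \<Longrightarrow> cls D \<in> carrier (jacobian_points g)"
  unfolding carrier_jacobian by blast

lemma frag_cmul_Suc: "frag_cmul (1 + int k) D = frag_cmul (int k) D + D"
  by (simp add: frag_cmul_distrib)

lemma nat_pow_jacobian:
  assumes "D \<in> stable_divisors"
  shows "cls D [^]\<^bsub>jacobian_points g\<^esub> (k::nat) = cls (frag_cmul (int k) D)"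
proof -
  interpret J: comm_group "jacobian_points g" by (rule comm_group_jacobian)
  show ?thesis
    by (induction k) (simp_all add: one_jacobian mult_jacobian frag_cmul_Suc)
qed

lemma stable_cmul: "D \<in> stable_divisors \<Longrightarrow> frag_cmul k D \<in> stable_divisors"
proof -
  assume D: "D \<in> stable_divisors"
  have nat: "frag_cmul (int j) D \<in> stable_divisors" for j :: nat
    by (induction j) (simp_all add: stable_0 frag_cmul_Suc stable_add D)
  show ?thesis
  proof (cases k)
    case (nonneg j)
    then show ?thesis using nat by simp
  next
    case (neg j)
    have "frag_cmul (- int (Suc j)) D = - frag_cmul (int (Suc j)) D" by (simp only: minus_frag_cmul)
    then show ?thesis unfolding neg using stable_uminus[OF nat[of "Suc j"]] by (simp only:)
  qed
qed

lemma int_pow_jacobian: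
  assumes "D \<in> stable_divisors"
  shows "cls D [^]\<^bsub>jacobian_points g\<^esub> (k::int) = cls (frag_cmul k D)"
proof -
  interpret J: comm_group "jacobian_points g" by (rule comm_group_jacobian)
  have inv: "inv\<^bsub>jacobian_points g\<^esub> (cls E) = cls (- E)" if "E \<in> stable_divisors" for E
    using that cls_in_carrier stable_uminus[OF that]
    by (intro J.inv_equality) (simp_all add: one_jacobian mult_jacobian)
  show ?thesis
  proof (cases k)
    case (nonneg j)
    then show ?thesis using nat_pow_jacobian[OF assms] by (simp add: int_pow_int)
  next
    case (neg j)
    have "cls D [^]\<^bsub>jacobian_points g\<^esub> (- int (Suc j)) = inv\<^bsub>jacobian_points g\<^esub> (cls D [^]\<^bsub>jacobian_points g\<^esub> Suc j)"
      by (rule J.int_pow_neg_int) (rule cls_in_carrier[OF assms])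
    also have "\<dots> = cls (- frag_cmul (int (Suc j)) D)"
      unfolding nat_pow_jacobian[OF assms] by (rule inv[OF stable_cmul[OF assms]])
    finally show ?thesis unfolding neg by (simp only: minus_frag_cmul)
  qed
qed

lemma finprod_jacobian:
  assumes "finite I" "\<And>i. i \<in> I \<Longrightarrow> D i \<in> stable_divisors"
  shows "finprod (jacobian_points g) (\<lambda>i. cls (D i)) I = cls (\<Sum>i\<in>I. D i)"
proof -
  interpret J: comm_group "jacobian_points g" by (rule comm_group_jacobian)
  show ?thesis
    using assms
  proof (induction I rule: finite_induct)
    case (insert i I)
    then have "finprod (jacobian_points g) (\<lambda>i. cls (D i)) (insert i I)
        = cls (D i) \<otimes>\<^bsub>jacobian_points g\<^esub> finprod (jacobian_points g) (\<lambda>i. cls (D i)) I"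
      using cls_in_carrier by (intro J.finprod_insert) auto
    then show ?case using insert by (simp add: mult_jacobian)
  qed (simp add: one_jacobian)
qed

lemma curve_to_jacobian_eq: "curve_to_jacobian g (Aff x y) = cls (point_divisor x y)"
  by (simp add: curve_to_jacobian_def cls_def point_divisor_def)

lemma point_divisor_stable:
  assumes "y\<^sup>2 = poly g x"
  shows "point_divisor x y \<in> stable_divisors"
proof -
  have "Aff (to_ac x) (to_ac y) \<in> curve_points Kg" using assms Aff_to_ac_in by blast
  then have "Poly_Mapping.keys (point_divisor x y) \<subseteq> curve_points Kg"
    unfolding point_divisor_def
    using Poly_Mapping.keys_diff[of "frag_of (Aff (to_ac x) (to_ac y))" "frag_of Infty"] C.Infty_in by auto
  moreover have "act_on_divisor \<sigma> (point_divisor x y) - point_divisor x y \<in> H" if "\<sigma> \<in> field_auts (range to_ac)" for \<sigma>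
    using field_autsE(3)[OF that] C.principal_0 by (simp add: point_divisor_def)
  ultimately show ?thesis
    by (simp add: stable_divisors_def point_divisor_def div_degree_diff)
qed

text \<open>The point over u0 is set aside, so a relation among the others has coefficient zero
  there. Since \<open>int_independent\<close> indexes exponents by classes and not by roots, the
  classes must also be distinct; a coincidence would be a relation with coefficients 1 and
  -1.\<close>

theorem jacobian_independent_points:
  assumes U: "finite U" and d: "\<And>u. u \<in> U \<Longrightarrow> d\<^sup>2 = poly g u" and u0: "u0 \<in> U"
    and rel: "\<And>a. (\<Sum>u\<in>U. frag_cmul (a u) (point_divisor u d)) \<in> H \<Longrightarrow> a u0 = 0 \<Longrightarrow> \<forall>u\<in>U. a u = 0"
  shows "enat (card U - 1) \<le> abelian_rank (jacobian_points g)"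
proof -
  define U' where "U' = U - {u0}"
  have U': "finite U'" "U = insert u0 U'" "u0 \<notin> U'" using U u0 by (auto simp: U'_def)
  have rel': "\<forall>u\<in>U'. a u = 0" if "(\<Sum>u\<in>U'. frag_cmul (a u) (point_divisor u d)) \<in> H" for a
  proof -
    define a' where "a' = a(u0 := 0)"
    have "(\<Sum>u\<in>U. frag_cmul (a' u) (point_divisor u d)) = (\<Sum>u\<in>U'. frag_cmul (a' u) (point_divisor u d))"
      using U' by (simp add: a'_def)
    also have "\<dots> = (\<Sum>u\<in>U'. frag_cmul (a u) (point_divisor u d))"
      using U'(3) by (intro sum.cong) (auto simp: a'_def)
    finally have "\<forall>u\<in>U. a' u = 0" using rel[of a'] that by (simp add: a'_def)
    then have "a' u = 0" if "u \<in> U'" for u using that U'(2) by blast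
    then show ?thesis using U'(3) by (metis a'_def fun_upd_apply)
  qed
  have st: "point_divisor u d \<in> stable_divisors" if "u \<in> U'" for u
    using point_divisor_stable d that U'(2) by blast
  have inj: "inj_on (\<lambda>u. cls (point_divisor u d)) U'"
  proof (rule inj_onI, rule ccontr)
    fix u v assume uv: "u \<in> U'" "v \<in> U'" "cls (point_divisor u d) = cls (point_divisor v d)" "u \<noteq> v"
    define a where "a = (\<lambda>w. if w = u then 1 else if w = v then - 1 else 0 :: int)"
    have "(\<Sum>w\<in>U'. frag_cmul (a w) (point_divisor w d)) = (\<Sum>w\<in>{u, v}. frag_cmul (a w) (point_divisor w d))"
      using uv U'(1) by (intro sum.mono_neutral_right) (auto simp: a_def)
    also have "\<dots> = point_divisor u d - point_divisor v d" using uv(4) by (simp add: a_def)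
    also have "\<dots> \<in> H" using uv(3) by (simp only: cls_eq_iff)
    finally have "a u = 0" using rel' uv(1) by blast
    then show False by (simp add: a_def)
  qed
  define S where "S = (\<lambda>u. cls (point_divisor u d)) ` U'"
  interpret J: comm_group "jacobian_points g" by (rule comm_group_jacobian)
  have "int_independent (jacobian_points g) S"
    unfolding int_independent_def
  proof (intro conjI allI impI)
    show "finite S" using U'(1) by (simp add: S_def)
    show SJ: "S \<subseteq> carrier (jacobian_points g)" using st cls_in_carrier by (auto simp: S_def)
    fix a :: "_ \<Rightarrow> int"
    assume *: "finprod (jacobian_points g) (\<lambda>s. s [^]\<^bsub>jacobian_points g\<^esub> a s) S = \<one>\<^bsub>jacobian_points g\<^esub>"
    have "finprod (jacobian_points g) (\<lambda>s. s [^]\<^bsub>jacobian_points g\<^esub> a s) S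
        = finprod (jacobian_points g) (\<lambda>u. cls (point_divisor u d) [^]\<^bsub>jacobian_points g\<^esub> a (cls (point_divisor u d))) U'"
      unfolding S_def using SJ by (intro J.finprod_reindex inj) (auto simp: S_def)
    also have "\<dots> = finprod (jacobian_points g) (\<lambda>u. cls (frag_cmul (a (cls (point_divisor u d))) (point_divisor u d))) U'"
      using st cls_in_carrier stable_cmul
      by (intro J.finprod_cong') (auto simp: int_pow_jacobian)
    also have "\<dots> = cls (\<Sum>u\<in>U'. frag_cmul (a (cls (point_divisor u d))) (point_divisor u d))"
      using st stable_cmul by (intro finprod_jacobian U'(1)) blast
    finally have "(\<Sum>u\<in>U'. frag_cmul (a (cls (point_divisor u d))) (point_divisor u d)) - 0 \<in> H"
      using * unfolding one_jacobian cls_eq_iff [symmetric] by simp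
    then have "\<forall>u\<in>U'. a (cls (point_divisor u d)) = 0" by (intro rel') simp
    then show "\<forall>s\<in>S. a s = 0" by (auto simp: S_def)
  qed
  then have "enat (card S) \<le> abelian_rank (jacobian_points g)"
    unfolding abelian_rank_def by (intro Sup_upper) blast
  moreover have "card S = card U - 1" using card_image[OF inj] U' by (simp add: S_def)
  ultimately show ?thesis by simp
qed

text \<open>A multiple equal to zero is a relation supported at u alone; its coefficient at the
  other root u0 is zero, so \<open>rel\<close> applies.\<close>

theorem infinite_order_point:
  assumes U: "finite U" and d: "d\<^sup>2 = poly g u" and u: "u \<in> U" "u0 \<in> U" "u \<noteq> u0"
    and rel: "\<And>a. (\<Sum>u\<in>U. frag_cmul (a u) (point_divisor u d)) \<in> H \<Longrightarrow> a u0 = 0 \<Longrightarrow> \<forall>u\<in>U. a u = 0"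
  shows "has_infinite_order (jacobian_points g) (curve_to_jacobian g (Aff u d))"
  unfolding has_infinite_order_def curve_to_jacobian_eq
proof (intro conjI allI impI notI)
  have st: "point_divisor u d \<in> stable_divisors" using point_divisor_stable d by blast
  then show "cls (point_divisor u d) \<in> carrier (jacobian_points g)" by (rule cls_in_carrier)
  fix k :: nat assume k: "k > 0" "cls (point_divisor u d) [^]\<^bsub>jacobian_points g\<^esub> k = \<one>\<^bsub>jacobian_points g\<^esub>"
  then have "frag_cmul (int k) (point_divisor u d) \<in> H"
    unfolding nat_pow_jacobian[OF st] one_jacobian cls_eq_iff by simp
  moreover define a where "a = (\<lambda>v. if v = u then int k else 0)"
  moreover have "(\<Sum>v\<in>U. frag_cmul (a v) (point_divisor v d)) = (\<Sum>v\<in>{u}. frag_cmul (a v) (point_divisor v d))"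
    using U u(1) by (intro sum.mono_neutral_right) (auto simp: a_def)
  ultimately have "\<forall>v\<in>U. a v = 0" using u(3) by (intro rel) (simp_all add: a_def)
  then show False using u(1) k(1) by (auto simp: a_def)
qed

end

section \<open>The Galois group acting on the roots\<close>

lemma ring_of_type_algebra_uminus:
  fixes x :: "'a::field"
  shows "\<ominus>\<^bsub>ring_of_type_algebra\<^esub> x = - x"
proof -
  interpret R: field "ring_of_type_algebra :: 'a ring" by (rule field_from_type_algebra)
  show ?thesis by (rule R.minus_equality) (simp_all add: ring_of_type_algebra_def)
qed

lemma ring_of_type_algebra_inverse:
  fixes x :: "'a::field"
  assumes "x \<noteq> 0"
  shows "inv\<^bsub>ring_of_type_algebra\<^esub> x = inverse x"
proof -
  interpret R: field "ring_of_type_algebra :: 'a ring" by (rule field_from_type_algebra)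
  show ?thesis by (rule R.inv_char) (use assms in \<open>simp_all add: ring_of_type_algebra_def\<close>)
qed

lemma field_hom_eq_on_generate_field:
  fixes \<sigma> \<tau> :: "'a::field \<Rightarrow> 'b::field"
  assumes "field_hom \<sigma>" "field_hom \<tau>" "\<And>s. s \<in> S \<Longrightarrow> \<sigma> s = \<tau> s"
    and "x \<in> generate_field ring_of_type_algebra S"
  shows "\<sigma> x = \<tau> x"
proof -
  interpret s: field_hom \<sigma> by fact
  interpret t: field_hom \<tau> by fact
  note simps = s.hom_add t.hom_add s.hom_mult t.hom_mult s.hom_uminus t.hom_uminus s.hom_inverse t.hom_inverse
  have zero: "\<zero>\<^bsub>ring_of_type_algebra\<^esub> = (0 :: 'a)" "\<one>\<^bsub>ring_of_type_algebra\<^esub> = (1 :: 'a)"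
    and ops: "a \<oplus>\<^bsub>ring_of_type_algebra\<^esub> b = a + b" "a \<otimes>\<^bsub>ring_of_type_algebra\<^esub> b = a * b" for a b :: 'a
    by (simp_all add: ring_of_type_algebra_def)
  from assms(4) show ?thesis
    by (induction rule: generate_field.induct)
       (simp_all add: zero ops assms(3) ring_of_type_algebra_uminus ring_of_type_algebra_inverse simps)
qed

text \<open>The composition law for the matrices of the standard representation: the difference of
  the unit vectors of x and y is expanded in the basis vectors and f is applied. The omitted index
  u0 contributes nothing, since its factor is f u0 - f u0.\<close>

lemma permutation_matrix_comp:
  fixes f :: "'k \<Rightarrow> rat"
  assumes "finite U" "u0 \<in> U" "x \<in> U" "y \<in> U"
  shows "(\<Sum>u\<in>U - {u0}. (f u - f u0) * (of_bool (x = u) - of_bool (y = u))) = f x - f y"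
proof -
  have "(\<Sum>u\<in>U - {u0}. (f u - f u0) * (of_bool (x = u) - of_bool (y = u)))
      = (\<Sum>u\<in>U. (f u - f u0) * (of_bool (x = u) - of_bool (y = u)))"
    using assms(1,2) by (intro sum.mono_neutral_left) auto
  also have "\<dots> = (\<Sum>u\<in>U. (if x = u then f u - f u0 else 0)) - (\<Sum>u\<in>U. (if y = u then f u - f u0 else 0))"
    unfolding sum_subtractf [symmetric] by (intro sum.cong) (auto simp: algebra_simps)
  also have "\<dots> = f x - f y" using assms by (simp add: sum.delta')
  finally show ?thesis .
qed

text \<open>The standard representation: the permutation representation on \<open>\<rat>\<^sup>U\<close> restricted to the
  hyperplane of sum zero, in the basis of all \<open>e u - e u0\<close>.\<close>

theorem min_faithful_dim_le:
  fixes G :: "('k \<Rightarrow> 'k) monoid"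
  assumes G: "carrier G = S" "\<And>\<sigma> \<tau>. \<sigma> \<otimes>\<^bsub>G\<^esub> \<tau> = \<sigma> \<circ> \<tau>"
    and S: "\<And>\<sigma>. \<sigma> \<in> S \<Longrightarrow> \<exists>\<tau>\<in>S. \<sigma> \<circ> \<tau> = id \<and> \<tau> \<circ> \<sigma> = id"
      "\<And>\<sigma> u. \<sigma> \<in> S \<Longrightarrow> u \<in> U \<Longrightarrow> \<sigma> u \<in> U"
      "\<And>\<sigma> \<tau>. \<sigma> \<in> S \<Longrightarrow> \<tau> \<in> S \<Longrightarrow> (\<And>u. u \<in> U \<Longrightarrow> \<sigma> u = \<tau> u) \<Longrightarrow> \<sigma> = \<tau>"
    and U: "finite U" "card U \<ge> 2"
  shows "min_faithful_dim G \<le> card U - 1"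
proof -
  obtain u0 where u0: "u0 \<in> U" using U by fastforce
  define N where "N = card U - 1"
  have "card (U - {u0}) = N" using U u0 by (simp add: N_def)
  then obtain w where w: "bij_betw w {0..<N} (U - {u0})"
    using ex_bij_betw_nat_finite[of "U - {u0}"] U(1) by auto
  have wU: "w i \<in> U" "w i \<noteq> u0" if "i < N" for i
    using bij_betwE[OF w] that by auto
  have w_eq: "w i = w j \<longleftrightarrow> i = j" if "i < N" "j < N" for i j
    using w that by (auto simp: bij_betw_def inj_on_def)
  \<comment> \<open>The coefficient at the unit vector of v in the image of the basis vector
    belonging to u. For v other than u0 it is also the coordinate with respect to the basis.\<close>
  define e :: "('k \<Rightarrow> 'k) \<Rightarrow> 'k \<Rightarrow> 'k \<Rightarrow> rat" where
    "e = (\<lambda>\<sigma> v u. of_bool (\<sigma> u = v) - of_bool (\<sigma> u0 = v))"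
  define \<rho> where "\<rho> = (\<lambda>\<sigma>. mat N N (\<lambda>(i, j). e \<sigma> (w i) (w j)))"
  have dim: "\<rho> \<sigma> \<in> carrier_mat N N" for \<sigma> by (simp add: \<rho>_def)
  have mult: "\<rho> (\<sigma> \<circ> \<tau>) = \<rho> \<sigma> * \<rho> \<tau>" if "\<tau> \<in> S" for \<sigma> \<tau>
  proof (rule eq_matI)
    fix i j assume "i < dim_row (\<rho> \<sigma> * \<rho> \<tau>)" "j < dim_col (\<rho> \<sigma> * \<rho> \<tau>)"
    then have ij: "i < N" "j < N" by (simp_all add: \<rho>_def)
    have "(\<rho> \<sigma> * \<rho> \<tau>) $$ (i, j) = (\<Sum>k\<in>{0..<N}. e \<sigma> (w i) (w k) * e \<tau> (w k) (w j))"
      using ij by (simp add: \<rho>_def scalar_prod_def)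
    also have "\<dots> = (\<Sum>u\<in>U - {u0}. e \<sigma> (w i) u * e \<tau> u (w j))"
      by (rule sum.reindex_bij_betw[OF w])
    also have "\<dots> = (\<Sum>u\<in>U - {u0}. (of_bool (\<sigma> u = w i) - of_bool (\<sigma> u0 = w i)) * (of_bool (\<tau> (w j) = u) - of_bool (\<tau> u0 = u)))"
      by (simp add: e_def)
    also have "\<dots> = of_bool (\<sigma> (\<tau> (w j)) = w i) - of_bool (\<sigma> (\<tau> u0) = w i)"
      using S(2)[OF that] wU[OF ij(2)] u0 by (intro permutation_matrix_comp U(1)) auto
    finally show "\<rho> (\<sigma> \<circ> \<tau>) $$ (i, j) = (\<rho> \<sigma> * \<rho> \<tau>) $$ (i, j)"
      using ij by (simp add: \<rho>_def e_def)
  qed (simp_all add: \<rho>_def)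
  have one: "\<rho> id = 1\<^sub>m N"
    by (rule eq_matI) (use wU w_eq in \<open>auto simp: \<rho>_def e_def\<close>)
  have unit: "\<rho> \<sigma> \<in> carrier (GL_rat N)" if s: "\<sigma> \<in> S" for \<sigma>
  proof -
    obtain \<tau> where \<tau>: "\<tau> \<in> S" "\<sigma> \<circ> \<tau> = id" "\<tau> \<circ> \<sigma> = id" using S(1)[OF s] by blast
    have "\<rho> \<sigma> * \<rho> \<tau> = 1\<^sub>m N" "\<rho> \<tau> * \<rho> \<sigma> = 1\<^sub>m N"
      using mult[OF \<tau>(1), of \<sigma>] mult[OF s, of \<tau>] \<tau> one by simp_all
    then show ?thesis
      using dim by (auto simp: GL_rat_def units_of_def Units_def ring_mat_def intro!: bexI[of _ "\<rho> \<tau>"])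
  qed
  have "\<rho> \<in> hom G (GL_rat N)"
    using unit mult G by (auto simp: hom_def GL_rat_def units_of_def ring_mat_def)
  moreover have "inj_on \<rho> (carrier G)"
  proof (rule inj_onI)
    fix \<sigma> \<tau> assume st: "\<sigma> \<in> carrier G" "\<tau> \<in> carrier G" "\<rho> \<sigma> = \<rho> \<tau>"
    have entry: "e \<sigma> v u = e \<tau> v u" if "u \<in> U - {u0}" "v \<in> U - {u0}" for u v
    proof -
      have "u \<in> w ` {0..<N}" "v \<in> w ` {0..<N}" using w that by (auto simp: bij_betw_def)
      then obtain i j where "i < N" "j < N" "u = w j" "v = w i" by auto
      then show ?thesis using arg_cong[OF st(3), of "\<lambda>M. M $$ (i, j)"] by (simp add: \<rho>_def)
    qed
    have "U - {u0} \<noteq> {}"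
    proof
      assume "U - {u0} = {}"
      then have "card U \<le> 1" by (metis Diff_eq_empty_iff card_mono card.empty card.insert finite.intros empty_iff One_nat_def)
      then show False using U(2) by simp
    qed
    then obtain u1 where u1: "u1 \<in> U - {u0}" by blast
    have inj: "\<sigma> u1 \<noteq> \<sigma> u0" if "\<sigma> \<in> S" for \<sigma>
      using S(1)[OF that] u1 by (metis DiffD2 comp_apply id_apply singletonI)
    have same: "\<tau> u0 = \<sigma> u0" if "e \<sigma> (\<sigma> u0) u1 = e \<tau> (\<sigma> u0) u1" "\<sigma> \<in> S" for \<sigma> \<tau>
      using that(1) inj[OF that(2)] by (auto simp: e_def of_bool_def split: if_splits)
    have st': "\<sigma> \<in> S" "\<tau> \<in> S" using st G by auto
    \<comment> \<open>If v = \<sigma> u0 differs from u0, the entry in row v and column u1 is -1, as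
      \<sigma> u1 is not v, and this forces \<tau> u0 = v. Row u0 does not exist, so the case that
      both maps fix u0 stands apart.\<close>
    have eq0: "\<sigma> u0 = \<tau> u0"
    proof (cases "\<sigma> u0 = u0 \<and> \<tau> u0 = u0")
      case False
      then have "\<sigma> u0 \<in> U - {u0} \<or> \<tau> u0 \<in> U - {u0}" using S(2) st' u0 by auto
      then show ?thesis using same[of \<sigma> \<tau>] same[of \<tau> \<sigma>] entry[OF u1] st' by metis
    qed simp
    have "\<sigma> u = \<tau> u" if "u \<in> U" for u
    proof (cases "u = u0")
      case False
      have iff: "\<sigma> u = v \<longleftrightarrow> \<tau> u = v" if "v \<in> U - {u0}" for v
        using entry[OF _ that, of u] \<open>u \<in> U\<close> False eq0 by (simp add: e_def of_bool_def split: if_splits)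
      show ?thesis
        using iff[of "\<sigma> u"] iff[of "\<tau> u"] S(2)[OF st'(1) that] S(2)[OF st'(2) that] by (metis DiffI singletonD)
    qed (use eq0 in simp)
    then show "\<sigma> = \<tau>" by (rule S(3)[OF st'])
  qed
  ultimately have "\<exists>\<rho>\<in>hom G (GL_rat N). inj_on \<rho> (carrier G)" by blast
  then show ?thesis unfolding min_faithful_dim_def N_def by (rule Least_le)
qed

text \<open>The roots generate the field over the rationals, so an automorphism is determined by its
  permutation of the roots and the standard representation is faithful.\<close>

lemma min_faithful_dim_galois_le:
  fixes f :: "int poly" and F :: "'k::field_char_0 poly"
  assumes F: "F = map_poly of_int f" "F \<noteq> 0"
    and gen: "generate_field (ring_of_type_algebra :: 'k ring) (\<rat> \<union> {u. poly F u = 0}) = UNIV"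
    and card: "card {u. poly F u = 0} \<ge> 2"
  shows "min_faithful_dim (galois_group_over_rat :: ('k \<Rightarrow> 'k) monoid) \<le> card {u. poly F u = 0} - 1"
proof (rule min_faithful_dim_le)
  show "carrier (galois_group_over_rat :: ('k \<Rightarrow> 'k) monoid) = field_auts \<rat>"
    and "\<sigma> \<otimes>\<^bsub>galois_group_over_rat\<^esub> \<tau> = \<sigma> \<circ> \<tau>" for \<sigma> \<tau> :: "'k \<Rightarrow> 'k"
    by (simp_all add: galois_group_over_rat_def)
  show "finite {u. poly F u = 0}" using F(2) by (rule poly_roots_finite)
  show "card {u. poly F u = 0} \<ge> 2" by (rule card)
  fix \<sigma> :: "'k \<Rightarrow> 'k" assume \<sigma>: "\<sigma> \<in> field_auts \<rat>"
  interpret s: field_hom \<sigma> by (rule field_autsE(1)[OF \<sigma>])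
  show "\<exists>\<tau>\<in>field_auts \<rat>. \<sigma> \<circ> \<tau> = id \<and> \<tau> \<circ> \<sigma> = id"
    using field_auts_inverse[OF \<sigma>] field_autsE(2)[OF \<sigma>]
    by (intro bexI[of _ "inv_into UNIV \<sigma>"]) (auto simp: fun_eq_iff bij_is_surj bij_is_inj surj_f_inv_f inv_f_f)
  have "map_poly \<sigma> F = F"
    by (rule poly_eqI) (simp add: F(1) coeff_map_poly field_autsE(3)[OF \<sigma>])
  then show "\<sigma> u \<in> {u. poly F u = 0}" if "u \<in> {u. poly F u = 0}" for u
    using s.poly_map_poly_hom[of F u] that by simp
  fix \<tau> :: "'k \<Rightarrow> 'k" assume \<tau>: "\<tau> \<in> field_auts \<rat>" and "\<And>u. u \<in> {u. poly F u = 0} \<Longrightarrow> \<sigma> u = \<tau> u"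
  then have "\<sigma> x = \<tau> x" if "x \<in> \<rat> \<union> {u. poly F u = 0}" for x
    using that field_autsE(3)[OF \<sigma>] field_autsE(3)[OF \<tau>] by auto
  then have "\<sigma> x = \<tau> x" for x
    using field_hom_eq_on_generate_field[OF field_autsE(1)[OF \<sigma>] field_autsE(1)[OF \<tau>]] gen by blast
  then show "\<sigma> = \<tau>" by blast
qed

section \<open>Irreducible polynomials over algebraic closures\<close>

text \<open>The minimal polynomial p of x over the base field divides g and so has the same degree.
  It cannot divide the derivative of g, which is nonzero of smaller degree in characteristic zero;
  hence x is not a root of the derivative.\<close>

lemma irreducible_simple_roots:
  fixes g :: "'k::field_char_0 poly"
  assumes "Factorial_Ring.irreducible g" "poly (map_poly to_ac g) x = 0"
  shows "order x (map_poly to_ac g) = 1"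
proof -
  define I where "I = {p :: 'k poly. poly (map_poly to_ac p) x = 0}"
  have g0: "g \<noteq> 0" and gu: "\<not> g dvd 1" using assms(1) by (auto simp: Factorial_Ring.irreducible_def)
  have "g \<in> I" using assms(2) by (simp add: I_def)
  then obtain p where p: "p \<in> I" "p \<noteq> 0" and min: "\<And>q. q \<in> I \<Longrightarrow> q \<noteq> 0 \<Longrightarrow> degree p \<le> degree q"
    using ex_has_least_nat[of "\<lambda>q. q \<in> I \<and> q \<noteq> 0" g degree] g0 by blast
  have dvd: "p dvd q" if "q \<in> I" for q
  proof -
    have "q mod p = q - p * (q div p)" by (simp add: minus_mult_div_eq_mod)
    then have "q mod p \<in> I"
      using that p(1) by (simp add: I_def to_ac.map_poly_diff to_ac.map_poly_times)
    moreover have "q mod p = 0 \<or> degree (q mod p) < degree p" using p(2) by (rule degree_mod_less)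
    ultimately have "q mod p = 0" using min[of "q mod p"] by (meson not_less)
    then show ?thesis by (simp add: dvd_eq_mod_eq_0)
  qed
  have np: "\<not> p dvd 1"
  proof
    assume "p dvd 1"
    then have "degree p = 0" using p(2) by (simp add: is_unit_iff_degree)
    then obtain c where "p = [:c:]" by (meson degree_eq_zeroE)
    then show False using p by (simp add: I_def map_poly_pCons)
  qed
  have "pderiv g \<notin> I"
  proof
    assume "pderiv g \<in> I"
    then have pd: "p dvd pderiv g" by (rule dvd)
    obtain q where q: "g = p * q" using dvd[OF \<open>g \<in> I\<close>] by (elim dvdE)
    then have "q dvd 1" using assms(1) np by (metis Factorial_Ring.irreducibleD)
    moreover have "q \<noteq> 0" using q g0 by auto
    ultimately have dp: "degree g = degree p" using q p(2) by (simp add: degree_mult_eq is_unit_iff_degree)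
    have "degree g \<noteq> 0" using gu g0 by (simp add: is_unit_iff_degree)
    then have "pderiv g \<noteq> 0" "degree (pderiv g) < degree g" by (simp_all add: pderiv_eq_0_iff degree_pderiv)
    then show False using dvd_imp_degree_le[OF pd] dp by simp
  qed
  moreover have "pderiv (map_poly to_ac g) = map_poly to_ac (pderiv g)"
    by (rule poly_eqI) (simp add: coeff_pderiv coeff_map_poly)
  ultimately have "order x (pderiv (map_poly to_ac g)) = 0" by (simp add: I_def order_0I)
  then show ?thesis using order_pderiv[OF _ assms(2)] g0 by (simp add: to_ac.map_poly_hom_eq_0_iff)
qed

theorem theorem3p9:
  fixes f :: "int poly" and n :: nat
    and fL g :: "'k::field_char_0 poly" and d :: 'k and \<pp> :: "'k set"
    and G :: "('k \<Rightarrow> 'k) monoid"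
  assumes "Polynomial.lead_coeff f = 1" and "Factorial_Ring.irreducible f"
    and "Polynomial.degree f = n" and "odd n" and "n \<ge> 5"
    and "fL = map_poly of_int f" and "is_splitting_field fL"
    and "G = galois_group_over_rat"
    and "simple_group G \<or> G \<cong> sym_group n"
    and "primeideal \<pp> ring_of_integers" and "\<pp> \<noteq> {0}"
    and "{m :: int. of_int m \<in> \<pp>} \<noteq> {m. 2 dvd m}"
    and "g = fL + [:d\<^sup>2:]"
    and "d \<in> \<pp>"
    and "Factorial_Ring.irreducible g"
    and "\<forall>i. Polynomial.coeff (g - fL) i \<in> \<pp>" and "distinct_roots_mod \<pp> g"
  shows "int n - 1 = 2 * genus (base_change g)
    \<and> (\<forall>u. poly fL u = 0 \<longrightarrow> Aff u d \<in> curve_points g \<and> Aff u (- d) \<in> curve_points g)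
    \<and> (\<forall>u. poly fL u = 0 \<longrightarrow>
          has_infinite_order (jacobian_points g) (curve_to_jacobian g (Aff u d))
        \<and> has_infinite_order (jacobian_points g) (curve_to_jacobian g (Aff u (- d))))
    \<and> (simple_group G \<longrightarrow> enat (min_faithful_dim G) \<le> abelian_rank (jacobian_points g))
    \<and> (G \<cong> sym_group n \<longrightarrow> enat (n - 1) \<le> abelian_rank (jacobian_points g))"
proof -
  interpret P: integer_prime \<pp> by (rule integer_prime.intro) (fact assms)+
  have deg_fL: "degree fL = n" unfolding assms(6) using assms(3) by (simp add: degree_map_poly)
  have lc: "lead_coeff fL = 1" using assms(1,3,6) deg_fL by (simp add: coeff_map_poly)
  obtain us where us: "fL = (\<Prod>u\<leftarrow>us. [:- u, 1:])"
    using assms(7) lc unfolding is_splitting_field_def by auto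
  have gen: "generate_field (ring_of_type_algebra :: 'k ring) (\<rat> \<union> {u. poly fL u = 0}) = UNIV"
    using assms(7) unfolding is_splitting_field_def by blast
  define U where "U = set us"
  have roots: "poly fL u = 0 \<longleftrightarrow> u \<in> U" for u
    unfolding us U_def by (induction us) (auto simp del: mult_pCons_left)
  have "degree (\<Prod>u\<leftarrow>us. [:- u, 1:]) = length us" for us :: "'k list"
  proof (induction us)
    case (Cons u us)
    have "(\<Prod>u\<leftarrow>us. [:- u, 1:]) \<noteq> 0" by (induction us) (auto simp del: mult_pCons_left)
    then show ?case using Cons by (simp add: degree_mult_eq del: mult_pCons_left)
  qed simp
  then have len: "length us = n" using deg_fL us by simp
  have deg_g: "degree g = n"
    unfolding assms(13) using deg_fL assms(5) by (subst degree_add_eq_left) simp_all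
  have alg: "\<forall>u\<in>set us. algebraic_int u"
    unfolding algebraic_int_altdef_ipoly using roots assms(1,6) by (auto simp: U_def)
  have d2: "d\<^sup>2 \<in> \<pp>"
    using P.ideal_mult[OF P.ideal_in[OF assms(14)] assms(14)] by (simp add: power2_eq_square)
  have distinct: "distinct us" and incongruent: "\<And>u v. u \<in> U \<Longrightarrow> v \<in> U \<Longrightarrow> u \<noteq> v \<Longrightarrow> u - v \<notin> \<pp>"
    using P.distinct_roots_mod_split[OF us alg d2 assms(13) _ assms(17)] deg_g len by (auto simp: U_def)
  have U: "finite U" "card U = n" using distinct len by (simp_all add: U_def distinct_card)
  have fL: "fL = root_prod U (\<lambda>_. 1)"
    using prod.distinct_set_conv_list[OF distinct, of "\<lambda>u. [:- u, 1:]"] by (simp add: us root_prod_def U_def)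
  have gU: "poly g u = d\<^sup>2" if "u \<in> U" for u using roots that by (simp add: assms(13))
  obtain u1 where u1: "u1 \<in> U" using U assms(5) by fastforce
  \<comment> \<open>For d = 0 the points (u, d) would be of order at most two. This cannot happen,
    because g would then have the linear factor X - u1 and not be irreducible.\<close>
  have d0: "d \<noteq> 0"
  proof
    assume "d = 0"
    then have "poly g u1 = 0" using gU[OF u1] by simp
    then obtain q where q: "g = [:- u1, 1:] * q" unfolding poly_eq_0_iff_dvd by (elim dvdE)
    have "\<not> [:- u1, 1:] dvd 1" by (simp add: is_unit_iff_degree)
    then have "q dvd 1" using assms(15) q by (metis Factorial_Ring.irreducibleD)
    moreover have "q \<noteq> 0" using q deg_g assms(5) by auto
    ultimately have "degree g = degree [:- u1, 1:] + 0" unfolding q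
      by (subst degree_mult_eq) (auto simp: is_unit_iff_degree)
    then show False using deg_g assms(5) by simp
  qed
  obtain V m where V: "valuation_subring V m" "{x. algebraic_int x} \<subseteq> V" "\<pp> \<subseteq> m"
    using exists_dominating_valuation_subring[OF P.subring_ideal_axioms] .
  interpret V: valuation_subring V m by (rule V(1))
  have UV: "U \<subseteq> V" using alg V(2) by (auto simp: U_def)
  \<comment> \<open>The ideal m contains \<open>\<pp>\<close> and might identify more integers. It
    does not identify two roots: their difference is invertible modulo \<open>\<pp>\<close>, so in m
    it would put 1 into m.\<close>
  have inc_m: "u - v \<notin> m" if uv: "u \<in> U" "v \<in> U" "u \<noteq> v" for u v
  proof
    assume m: "u - v \<in> m"
    have "algebraic_int (u - v)" using P.diff_in[of u v] alg uv by (simp add: U_def)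
    then obtain y where y: "algebraic_int y" "(u - v) * y - 1 \<in> \<pp>"
      using P.inverse_mod incongruent[OF uv] by blast
    have "(u - v) * y - ((u - v) * y - 1) \<in> m"
      by (rule V.ideal_diff) (use V.ideal_mult_right[OF m, of y] y V(2,3) in auto)
    then show False using V.ideal_proper by simp
  qed
  have parity: "(\<forall>u\<in>U. even (c u)) \<or> (\<forall>u\<in>U. odd (c u))"
    if "l \<noteq> 0" "A\<^sup>2 - g * B\<^sup>2 = smult l (root_prod U c)" for A B l and c :: "'k \<Rightarrow> nat"
    using V.norm_parity[OF U(1) UV inc_m _ _ _ that(1), of "d\<^sup>2" A B c] that(2) d2 V(3) assms(4) U(2)
    unfolding assms(13) fL by blast
  have no_norm: "\<forall>u\<in>U. c u = 0"
    if h: "l \<noteq> 0" "A\<^sup>2 - g * B\<^sup>2 = smult l (root_prod U c)"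
      "\<And>u. u \<in> U \<Longrightarrow> c u > 0 \<Longrightarrow> poly A u \<noteq> 0" "\<exists>u\<in>U. c u = 0" for A B l and c :: "'k \<Rightarrow> nat"
  proof -
    obtain u0 where u0: "u0 \<in> U" "c u0 = 0" using h(4) by blast
    have "odd (degree g)" "\<And>u. u \<in> U \<Longrightarrow> poly g u \<noteq> 0" using deg_g assms(4) gU d0 by simp_all
    then show ?thesis using parity h(1-3) u0 by (rule norm_descent[OF assms(15) _ U(1)])
  qed
  interpret J: curve_over_field g
  proof (unfold_locales)
    show "odd (degree (base_change g))"
      unfolding base_change_def to_ac.degree_map_poly_hom using deg_g assms(4) by simp
    show "order x (base_change g) = 1" if "poly (base_change g) x = 0" for x
      using irreducible_simple_roots[OF assms(15)] that by (simp add: base_change_def)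
  qed
  \<comment> \<open>Both signs of d are treated at once, since \<open>no_norm\<close> involves only
    g and the roots.\<close>
  have rel: "\<forall>u\<in>U. a u = 0"
    if "(\<Sum>u\<in>U. frag_cmul (a u) (J.point_divisor u z)) \<in> J.H" "u0 \<in> U" "a u0 = 0" "z = d \<or> z = - d" for a u0 z
  proof (rule J.principal_relation_trivial[OF U(1) _ _ no_norm])
    show "z \<noteq> 0" using that(4) d0 by auto
    show "poly g u = z\<^sup>2" if "u \<in> U" for u using gU[OF that] \<open>z = d \<or> z = - d\<close> by auto
  qed (use that in auto)
  have "int n - 1 = 2 * genus (base_change g)"
    unfolding J.C.genus_eq J.degree_base_change deg_g using assms(4) by (auto elim!: oddE)
  moreover have "Aff u d \<in> curve_points g \<and> Aff u (- d) \<in> curve_points g" if "poly fL u = 0" for u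
    using that gU roots by (simp add: curve_points_def)
  moreover have "has_infinite_order (jacobian_points g) (curve_to_jacobian g (Aff u z))"
    if u: "poly fL u = 0" and z: "z = d \<or> z = - d" for u z
  proof -
    have uU: "u \<in> U" using u roots by simp
    have "U \<noteq> {u}" using U(2) assms(5) by auto
    then obtain u0 where u0: "u0 \<in> U" "u \<noteq> u0" using uU by blast
    have "z\<^sup>2 = poly g u" using gU[OF uU] z by auto
    then show ?thesis using rel[OF _ u0(1) _ z] by (rule J.infinite_order_point[OF U(1) _ uU u0])
  qed
  moreover have rank: "enat (n - 1) \<le> abelian_rank (jacobian_points g)"
    unfolding U(2) [symmetric]
    using gU rel[OF _ u1, of _ d] by (intro J.jacobian_independent_points[OF U(1) _ u1]) simp_all
  moreover have "enat (min_faithful_dim G) \<le> abelian_rank (jacobian_points g)"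
  proof -
    have R: "{u. poly fL u = 0} = U" using roots by blast
    have "fL \<noteq> 0" using lc by auto
    then have "min_faithful_dim G \<le> n - 1"
      unfolding assms(8)
      using min_faithful_dim_galois_le[OF assms(6) _ gen] U assms(5) unfolding R by simp
    then have "enat (min_faithful_dim G) \<le> enat (n - 1)" by simp
    then show ?thesis using rank by (rule order_trans)
  qed
  ultimately show ?thesis by blast
qed

end
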